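(* Let $K$ be a number field with ring of integers $\mathcal{O}_K$, and let $\beta\in\mathcal{O}_K$ with $|N(\beta)|>1$. Suppose that $(\beta,\{0,1,\dots,|N(\beta)|-1\})$ is a canonical number system in $\mathcal{O}_K$ and that no ramified prime ideal of $\mathcal{O}_K$ divides $\beta$. Then there is a constant $C_1$ depending only on $\beta$ such that for every $\alpha\in\mathcal{O}_K$ that is relatively prime to $\beta$ and is not a root of unity, every digit $b\in\{1,\dots,|N(\beta)|-1\}$ and every positive integer $N$, $$\mathcal{M}_b(\alpha,\beta,N)\le C_1 N^{\sigma(\beta)},\qquad \sigma(\beta):=\frac{\log(|N(\beta)|-1)}{\log|N(\beta)|}.$$
   Context: $N(\beta)$ denotes the norm of $\beta$ from $K$ to $\mathbb{Q}$. The pair $(\beta,\{0,1,\dots,|N(\beta)|-1\})$ is called a canonical number system (CNS) in $\mathcal{O}_K$ if every $\gamma\in\mathcal{O}_K$ can be represented uniquely (up to leading zero digits) as $\gamma=a_0+a_1\beta+\cdots+a_m\beta^m$ with $a_j\in\{0,1,\dots,|N(\beta)|-1\}$ for $j=0,1,\dots,m$; this is the radix expansion of $\gamma$ in base $\beta$, and one writes $(\gamma)_{\beta,j}:=a_j$ for $j=0,1,\dots,m$. For $b\in\{0,1,\dots,|N(\beta)|-1\}$, $$\mathcal{M}_b(\alpha,\beta,N):=\#\{1\le n\le N:\ (\alpha^n)_{\beta,j}\ne b \text{ for all digit positions } j \text{ of the radix expansion of } \alpha^n\}.$$ Elements $\alpha,\beta\in\mathcal{O}_K$ are relatively prime if $\alpha\notin\mathfrak{p}$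 for every prime ideal $\mathfrak{p}$ of $\mathcal{O}_K$ dividing $(\beta)$. A prime ideal $\mathfrak{p}$ is ramified if $v_{\mathfrak{p}}(q)>1$, where $q$ is the unique integer prime in $\mathfrak{p}$ and $v_{\mathfrak{p}}(q)$ is the exponent of $\mathfrak{p}$ in the prime ideal factorization of $(q)$. *)

theory Defs
  imports
    Complex_Main
    "HOL-Computational_Algebra.Polynomial"
    "HOL-Computational_Algebra.Primes"
    "HOL-Algebra.Divisibility"
    "HOL-Algebra.Ideal_Product"
    "Jordan_Normal_Form.Determinant"
begin

section \<open>Number fields and the norm\<close>

abbreviation rat_scale :: "rat \<Rightarrow> 'a::field_char_0 \<Rightarrow> 'a"
  where "rat_scale r x \<equiv> of_rat r * x"

global_interpretation rat_vs: vector_space "rat_scale :: rat \<Rightarrow> 'a::field_char_0 \<Rightarrow> 'a"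
  by unfold_locales (simp_all add: algebra_simps of_rat_add of_rat_mult)

text \<open>A number field is rendered as a type: a field of characteristic 0 that is
  finite-dimensional over the rational numbers.\<close>

definition number_field :: "'k::field_char_0 itself \<Rightarrow> bool"
  where "number_field _ \<longleftrightarrow>
    (\<exists>B. finite_dimensional_vector_space (rat_scale :: rat \<Rightarrow> 'k \<Rightarrow> 'k) B)"

definition rat_basis :: "'k::field_char_0 list"
  where "rat_basis = (SOME bs. distinct bs \<and> rat_vs.independent (set bs) \<and> rat_vs.span (set bs) = UNIV)"

text \<open>The norm from the field to the rationals: the determinant of multiplication by \<open>x\<close>.
  It does not depend on the choice of \<open>rat_basis\<close>.\<close>

definition field_norm :: "'k::field_char_0 \<Rightarrow> rat"
  where "field_norm x =
    (let bs = rat_basis :: 'k list; n = length bs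
     in det (mat n n (\<lambda>(i, j). rat_vs.representation (set bs) (x * bs ! j) (bs ! i))))"


section \<open>The ring of integers and its prime ideals\<close>

definition ring_of_integers :: "'k::field_char_0 ring"  (\<open>\<O>\<close>)
  where "\<O> = \<lparr>carrier = {x. algebraic_int x}, monoid.mult = (*), one = 1, zero = 0, add = (+)\<rparr>"

text \<open>The exponents \<open>e\<close> of the factorization of \<open>I\<close> as a product of \<open>P\<close> to the power \<open>e P\<close>
  over the nonzero prime ideals \<open>P\<close>.\<close>

definition is_prime_ideal_factorization :: "'k::field_char_0 set \<Rightarrow> ('k set \<Rightarrow> nat) \<Rightarrow> bool"
  where "is_prime_ideal_factorization I e \<longleftrightarrow>
    finite {P. e P \<noteq> 0} \<and>
    (\<forall>P. e P \<noteq> 0 \<longrightarrow> primeideal P \<O> \<and> P \<noteq> {0}) \<and>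
    I = finprod (ideals_set \<O>) (\<lambda>P. P [^]\<^bsub>ideals_set \<O>\<^esub> e P) {P. e P \<noteq> 0}"

definition ideal_valuation :: "'k::field_char_0 set \<Rightarrow> 'k set \<Rightarrow> nat"
  where "ideal_valuation P I = (THE e. is_prime_ideal_factorization I e) P"

definition ramified :: "'k::field_char_0 set \<Rightarrow> bool"
  where "ramified P \<longleftrightarrow> primeideal P \<O> \<and> P \<noteq> {0} \<and>
    ideal_valuation P (PIdl\<^bsub>\<O>\<^esub> of_nat (THE q. prime q \<and> of_nat q \<in> P)) > 1"

definition ideal_divides_elem :: "'k::field_char_0 set \<Rightarrow> 'k \<Rightarrow> bool"
  where "ideal_divides_elem P x \<longleftrightarrow> P divides\<^bsub>ideals_set \<O>\<^esub> (PIdl\<^bsub>\<O>\<^esub> x)"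

definition relatively_prime :: "'k::field_char_0 \<Rightarrow> 'k \<Rightarrow> bool"
  where "relatively_prime \<alpha> \<beta> \<longleftrightarrow>
    (\<forall>P. primeideal P \<O> \<and> ideal_divides_elem P \<beta> \<longrightarrow> \<alpha> \<notin> P)"


section \<open>Canonical number systems\<close>

definition digits :: "'k::field_char_0 \<Rightarrow> nat set"
  where "digits \<beta> = {a. of_nat a \<le> \<bar>field_norm \<beta>\<bar> - 1}"

text \<open>A digit string \<open>a\<^sub>0, \<dots>, a\<^sub>m\<close>, taken up to leading zero digits, is a polynomial \<open>p\<close> over
  the natural numbers: \<open>coeff p j\<close> is the digit at position \<open>j\<close>, and \<open>m = degree p\<close> is the
  top position once the leading zeros are dropped (zero has the single digit 0).\<close>

definition is_radix_expansion :: "'k::field_char_0 \<Rightarrow> 'k \<Rightarrow> nat poly \<Rightarrow> bool"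
  where "is_radix_expansion \<beta> \<gamma> p \<longleftrightarrow>
    (\<forall>j\<le>degree p. coeff p j \<in> digits \<beta>) \<and>
    \<gamma> = (\<Sum>j\<le>degree p. of_nat (coeff p j) * \<beta> ^ j)"

definition canonical_number_system :: "'k::field_char_0 \<Rightarrow> bool"
  where "canonical_number_system \<beta> \<longleftrightarrow>
    (\<forall>\<gamma> \<in> carrier \<O>. \<exists>!p. is_radix_expansion \<beta> \<gamma> p)"

definition radix_expansion :: "'k::field_char_0 \<Rightarrow> 'k \<Rightarrow> nat poly"
  where "radix_expansion \<beta> \<gamma> = (THE p. is_radix_expansion \<beta> \<gamma> p)"

definition missing_digit_count :: "nat \<Rightarrow> 'k::field_char_0 \<Rightarrow> 'k \<Rightarrow> nat \<Rightarrow> nat"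
  where "missing_digit_count b \<alpha> \<beta> N =
    card {n \<in> {1..N}. \<forall>j\<le>degree (radix_expansion \<beta> (\<alpha> ^ n)).
                        coeff (radix_expansion \<beta> (\<alpha> ^ n)) j \<noteq> b}"

definition sigma :: "'k::field_char_0 \<Rightarrow> real"
  where "sigma \<beta> = ln (real_of_rat \<bar>field_norm \<beta>\<bar> - 1) / ln (real_of_rat \<bar>field_norm \<beta>\<bar>)"

end

theory Submission
  imports Defs "Jordan_Normal_Form.Spectral_Radius" "HOL-Number_Theory.Residues"
begin

text \<open>
Let \<open>q\<close> be the number of digits and let \<open>f\<close> be the minimal polynomial of \<open>\<beta>\<close>. Being the base of a
canonical number system forces the ring of integers to be \<open>\<int>[\<beta>]\<close>, the constant coefficient of \<open>f\<close> to be
\<open>q\<close> up to sign, and all conjugates of \<open>\<beta>\<close> to lie outside the closed unit disc. That no ramified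
prime divides \<open>\<beta>\<close> means that the linear coefficient of \<open>f\<close> is coprime to \<open>q\<close>. By Hensel lifting, \<open>f\<close>
then has a root \<open>B\<close> modulo any power of \<open>q\<close> with \<open>q\<close> dividing \<open>B\<close>, and \<open>h(\<beta>) \<mapsto> h(B)\<close> turns the powers of
\<open>\<alpha> = h(\<beta>)\<close> into powers of an integer \<open>a\<close> coprime to \<open>q\<close>.

Put \<open>D = \<phi>(q\<^sup>2)\<close>, \<open>A = a\<^sup>D\<close> and \<open>g = gcd (A - 1) (q ^ k)\<close>. The order of \<open>A\<close> modulo \<open>q ^ k\<close> is a multiple of
\<open>q ^ k div g\<close> (\<open>order_modulo_prime_power_quotient\<close>), and it tends to infinity with \<open>k\<close> because \<open>\<alpha>\<close> is not
a root of unity. Choose \<open>k\<close> least such that this quotient exceeds \<open>N\<close>, and \<open>l\<close> greatest such that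
\<open>q ^ l \<le> g\<close>. If \<open>\<alpha> ^ n\<close> misses the digit \<open>b\<close>, then its digits at the positions from \<open>l\<close> to \<open>k - 1\<close> form one of
\<open>(q - 1) ^ (k - l)\<close> strings, and \<open>q ^ (k - l) \<le> q\<^sup>2 * N\<close>; this is where the exponent comes from. So it
suffices that \<open>n mod D\<close> together with this string determines \<open>n \<le> N\<close> up to boundedly many choices.

The residue of \<open>\<alpha> ^ n\<close> modulo \<open>\<beta> ^ k\<close> determines \<open>n \<le> N\<close> within its class modulo \<open>D\<close>, so the choices correspond to
the possible lower parts, that is, to expansions of length \<open>l\<close>. As \<open>a ^ n\<close> modulo \<open>g\<close> depends only on
\<open>n mod D\<close>, these lower parts lie in one coset of the kernel of \<open>\<int>[\<beta>] \<rightarrow> \<int>/g\<close>, a lattice of index at least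
\<open>q ^ l\<close>. Divided by \<open>\<beta> ^ l\<close>, all expansions of length \<open>l\<close> fall into a bounded region that does not depend on
\<open>l\<close>. Among too many of them two would be so close that their difference has norm less than \<open>q ^ l\<close> in
absolute value; but its norm is a multiple of \<open>g\<close>, so the difference is 0. This is
\<open>congruent_expansions_bound_exists\<close>. The bound depends on \<open>\<beta>\<close> alone, which makes the final constant uniform
in \<open>\<alpha>\<close>, even if powers of \<open>\<alpha>\<close> are much closer to 1 at one prime divisor of \<open>\<beta>\<close> than at another. Norms are
realized as determinants of integer polynomials in the companion matrix of \<open>f\<close>.

The two hypotheses on prime ideals are translated by means of the ideals \<open>(p, \<beta>)\<close> for the primes \<open>p\<close> dividing \<open>q\<close>.
Each of them divides \<open>\<beta>\<close> (\<open>residue_ideal_divides_generator\<close>). If \<open>p\<close> divides the linear coefficient of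
\<open>f\<close>, then \<open>p\<close> lies in the square of \<open>(p, \<beta>)\<close>, and unique factorization of \<open>(p)\<close> into prime ideals shows
that \<open>(p, \<beta>)\<close> is ramified (\<open>residue_ideal_ramified\<close>).
\<close>

hide_const (open) up_ring.coeff up_ring.monom

section \<open>Minimal polynomials and conjugates\<close>

abbreviation ipoly :: "int poly \<Rightarrow> 'a::comm_ring_1 \<Rightarrow> 'a" where
  "ipoly h x \<equiv> poly (map_poly of_int h) x"

lemma ipoly_simps:
  fixes x :: "'a::comm_ring_1"
  shows "ipoly 0 x = 0" "ipoly 1 x = 1"
    "ipoly (p + r) x = ipoly p x + ipoly r x"
    "ipoly (p - r) x = ipoly p x - ipoly r x"
    "ipoly (- p) x = - ipoly p x"
    "ipoly (p * r) x = ipoly p x * ipoly r x"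
    "ipoly (p ^ n) x = ipoly p x ^ n"
    "ipoly (Polynomial.smult c p) x = of_int c * ipoly p x"
    "ipoly (pCons c p) x = of_int c + x * ipoly p x"
    "ipoly (monom c n) x = of_int c * x ^ n"
  by (simp_all add: hom_distribs poly_monom map_poly_monom)

lemma ipoly_altdef:
  fixes x :: "'a::comm_ring_1"
  assumes "degree h < l"
  shows "ipoly h x = (\<Sum>i<l. of_int (coeff h i) * x ^ i)"
proof -
  have deg: "degree (map_poly of_int h :: 'a poly) < l"
    using assms degree_map_poly_le[of "of_int :: int \<Rightarrow> 'a" h] by simp
  have "ipoly h x = (\<Sum>i\<le>degree (map_poly of_int h :: 'a poly). of_int (coeff h i) * x ^ i)"
    by (simp add: poly_altdef coeff_map_poly)
  also have "\<dots> = (\<Sum>i<l. of_int (coeff h i) * x ^ i)"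
  proof (intro sum.mono_neutral_left ballI)
    fix i assume "i \<in> {..<l} - {..degree (map_poly of_int h :: 'a poly)}"
    hence "coeff (map_poly of_int h :: 'a poly) i = 0" by (intro coeff_eq_0) auto
    thus "of_int (coeff h i) * x ^ i = 0" by (simp add: coeff_map_poly)
  qed (use deg in auto)
  finally show ?thesis .
qed

lemma poly_int_altdef:
  fixes h :: "int poly"
  assumes "degree h < l"
  shows "poly h x = (\<Sum>i<l. coeff h i * x ^ i)"
proof -
  have "map_poly of_int h = h" by (rule poly_eqI) (simp add: coeff_map_poly)
  thus ?thesis using ipoly_altdef[OF assms, of x] by simp
qed

lemma dvd_minus_coeff_0: "(x::int) dvd poly h x - coeff h 0"
  by (cases h) simp

text \<open>A primitive integer polynomial of least degree vanishing at \<open>z\<close> divides all others, by pseudo-division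
and multiplicativity of the content. Dividing a monic polynomial, it is itself monic up to sign.\<close>

lemma minimal_int_poly:
  fixes z :: "'a::field_char_0"
  assumes "algebraic_int z"
  obtains f :: "int poly" where "lead_coeff f = 1" "\<And>h. ipoly h z = 0 \<longleftrightarrow> f dvd h"
proof -
  obtain p0 where p0: "ipoly p0 z = 0" "lead_coeff p0 = 1"
    using assms by (auto simp: algebraic_int_altdef_ipoly)
  define P where "P h \<longleftrightarrow> h \<noteq> 0 \<and> ipoly h z = 0" for h :: "int poly"
  have "P p0" using p0 by (auto simp: P_def)
  then obtain m where m: "P m" and min: "\<And>h. P h \<Longrightarrow> degree m \<le> degree h"
    using ex_has_least_nat[of P p0 degree] by blast
  define m' where "m' = primitive_part m"
  have m0: "m \<noteq> 0" "ipoly m z = 0" using m by (auto simp: P_def)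
  have m'0: "m' \<noteq> 0" and cm': "content m' = 1" and dm': "degree m' = degree m"
    using m0 by (auto simp: m'_def)
  have mm': "m = Polynomial.smult (content m) m'" by (simp add: m'_def)
  have "of_int (content m) * ipoly m' z = 0"
    using m0(2) by (subst (asm) mm') (simp add: ipoly_simps)
  hence z': "ipoly m' z = 0" using m0 by simp
  have dvd: "m' dvd h" if h: "ipoly h z = 0" for h
  proof -
    obtain a r where ar: "a \<noteq> 0" "Polynomial.smult a h = m' * r + pseudo_mod h m'"
      using pseudo_mod(1)[OF m'0, of h] by blast
    have "ipoly (pseudo_mod h m') z = 0"
    proof -
      have "ipoly (Polynomial.smult a h) z = ipoly (m' * r + pseudo_mod h m') z"
        by (simp only: ar(2))
      thus ?thesis by (simp add: ipoly_simps h z')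
    qed
    hence "pseudo_mod h m' = 0"
      using pseudo_mod(2)[OF m'0, of h] min[of "pseudo_mod h m'"] dm' by (force simp: P_def)
    hence eq: "Polynomial.smult a h = m' * r" using ar by simp
    hence "normalize a * content h = content r"
      by (metis cm' content_mult content_smult mult_1)
    hence "a dvd content r" by (metis dvd_triv_left normalize_dvd_iff)
    hence "[:a:] dvd r" by (simp add: const_poly_dvd_iff_dvd_content)
    then obtain r' where "r = [:a:] * r'" by (elim dvdE)
    hence "Polynomial.smult a h = Polynomial.smult a (m' * r')" using eq by simp
    hence "Polynomial.smult a (h - m' * r') = 0" by (simp add: smult_diff_right)
    hence "h = m' * r'" using ar(1) by simp
    thus ?thesis by simp
  qed
  have iff: "ipoly h z = 0 \<longleftrightarrow> m' dvd h" for h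
    using dvd[of h] z' by (auto simp: ipoly_simps)
  obtain s where s: "p0 = m' * s" using dvd[OF p0(1)] by (elim dvdE)
  have "lead_coeff m' * lead_coeff s = 1" using p0(2) s by (simp add: lead_coeff_mult)
  hence "lead_coeff m' = 1 \<or> lead_coeff m' = -1" by (simp add: zmult_eq_1_iff) auto
  thus ?thesis
  proof
    assume "lead_coeff m' = 1" thus ?thesis using iff by (rule that)
  next
    assume "lead_coeff m' = -1"
    thus ?thesis using iff by (intro that[of "- m'"]) auto
  qed
qed

locale integral_generator =
  fixes \<beta> :: "'k::field_char_0" and f :: "int poly"
  assumes monic: "lead_coeff f = 1"
    and ipoly_eq_0_iff: "ipoly h \<beta> = 0 \<longleftrightarrow> f dvd h"
begin

lemma f_nonzero: "f \<noteq> 0" using monic by auto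

lemma ipoly_f: "ipoly f \<beta> = 0" by (simp add: ipoly_eq_0_iff)

lemma degree_pos: "degree f > 0"
proof (rule ccontr)
  assume "\<not> degree f > 0"
  hence "f = 1" using monic by (metis degree_0_id gr0I one_pCons)
  thus False using ipoly_f by (simp add: ipoly_simps)
qed

lemma ipoly_eq_iff: "ipoly h \<beta> = ipoly h' \<beta> \<longleftrightarrow> f dvd h - h'"
  using ipoly_eq_0_iff[of "h - h'"] by (simp add: ipoly_simps)

text \<open>The minimal polynomial of a root of \<open>f\<close> divides \<open>f\<close>, and since \<open>f\<close> is irreducible it cannot be a
proper divisor. So a conjugate of \<open>\<beta>\<close> satisfies the same integral relations as \<open>\<beta>\<close>.\<close>

lemma conjugate_root_iff:
  fixes \<mu> :: complex
  assumes \<mu>: "ipoly f \<mu> = 0"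
  shows "ipoly h \<mu> = 0 \<longleftrightarrow> f dvd h"
proof
  assume h: "ipoly h \<mu> = 0"
  have "algebraic_int \<mu>" using \<mu> monic by (auto simp: algebraic_int_altdef_ipoly)
  from this obtain m :: "int poly" where m: "lead_coeff m = 1" "\<And>h. ipoly h \<mu> = 0 \<longleftrightarrow> m dvd h"
    by (rule minimal_int_poly) blast
  obtain g where g: "f = m * g" using m(2)[of f] \<mu> by (auto elim: dvdE)
  have "ipoly m \<beta> * ipoly g \<beta> = 0"
    using ipoly_f unfolding g by (simp add: ipoly_simps)
  hence "f dvd m \<or> f dvd g" by (simp add: ipoly_eq_0_iff)
  moreover have "\<not> f dvd g"
  proof
    assume "f dvd g"
    then obtain u where u: "g = f * u" by (elim dvdE)
    have "f * (m * u) = m * (f * u)" by (rule mult.left_commute)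
    also have "\<dots> = f * 1" using g unfolding u mult_1_right by (rule sym)
    finally have "m * u = 1" using f_nonzero mult_left_cancel by blast
    moreover have "ipoly m \<mu> = 0" by (simp add: m(2))
    ultimately show False by (metis ipoly_simps(2,6) mult_zero_left zero_neq_one)
  qed
  moreover have "m dvd h" using h m(2) by blast
  ultimately show "f dvd h" by (blast intro: dvd_trans)
next
  assume "f dvd h"
  thus "ipoly h \<mu> = 0" using \<mu> by (auto elim!: dvdE simp: ipoly_simps)
qed

text \<open>If \<open>\<mu>\<close> is a root on the unit circle, then so is its inverse, which is its complex conjugate. Hence
\<open>\<mu>\<close> is a root of the reflected polynomial, \<open>f\<close> divides its own reflection, and the constant coefficients
show that \<open>f\<close> has constant coefficient 1 or -1.\<close>

lemma conjugate_root_not_on_unit_circle: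
  fixes \<mu> :: complex
  assumes \<mu>: "ipoly f \<mu> = 0" and c: "\<bar>coeff f 0\<bar> \<noteq> 1"
  shows "norm \<mu> \<noteq> 1"
proof
  assume n: "norm \<mu> = 1"
  have cnj: "cnj (ipoly h z) = ipoly h (cnj z)" for h z
    by (induction h) (auto simp: ipoly_simps)
  have inv: "inverse \<mu> = cnj \<mu>" using n
    by (metis complex_div_cnj divide_inverse inverse_1 lambda_one norm_one of_real_1 power_one mult_1 div_by_1)
  have "\<mu> \<noteq> 0" using n by auto
  have "poly (reflect_poly (map_poly of_int f)) \<mu> = \<mu> ^ degree f * ipoly f (cnj \<mu>)"
    using \<open>\<mu> \<noteq> 0\<close> inv by (simp add: poly_reflect_poly_nz)
  also have "ipoly f (cnj \<mu>) = 0" using cnj[of f \<mu>] \<mu> by simp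
  also have "reflect_poly (map_poly of_int f) = (map_poly of_int (reflect_poly f) :: complex poly)"
    by (intro poly_eqI) (simp add: coeff_reflect_poly coeff_map_poly)
  finally have "f dvd reflect_poly f" using conjugate_root_iff[OF \<mu>] by simp
  then obtain g where "reflect_poly f = f * g" by (elim dvdE)
  hence "coeff f 0 * coeff g 0 = 1"
    using monic by (metis coeff_0_reflect_poly coeff_mult_0)
  thus False using c by (auto simp: zmult_eq_1_iff)
qed

text \<open>If every natural number has an expansion with digits of bounded size, then no conjugate of \<open>\<beta>\<close> can lie
inside the open unit disc: the values of all these expansions there would be bounded by a geometric series.\<close>

lemma conjugate_root_outside_unit_disc:
  fixes \<mu> :: complex
  assumes \<mu>: "ipoly f \<mu> = 0" and c: "\<bar>coeff f 0\<bar> \<noteq> 1"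
    and ex: "\<And>n::nat. \<exists>h. (\<forall>i. \<bar>coeff h i\<bar> \<le> M) \<and> ipoly h \<beta> = of_nat n"
  shows "norm \<mu> > 1"
proof (rule ccontr)
  assume "\<not> norm \<mu> > 1"
  hence n: "norm \<mu> < 1" using conjugate_root_not_on_unit_circle[OF \<mu> c] by simp
  have bound: "real k \<le> of_int M / (1 - norm \<mu>)" for k
  proof -
    obtain h where h: "\<And>i. \<bar>coeff h i\<bar> \<le> M" "ipoly h \<beta> = of_nat k" using ex[of k] by auto
    have "ipoly h \<beta> = ipoly [:int k:] \<beta>" using h(2) by (simp add: ipoly_simps)
    hence "ipoly (h - [:int k:]) \<mu> = 0" by (simp only: ipoly_eq_iff conjugate_root_iff[OF \<mu>])
    hence eq: "ipoly h \<mu> = of_nat k" by (simp add: ipoly_simps)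
    have M: "M \<ge> 0" using h(1)[of 0] by linarith
    define l where "l = Suc (degree h)"
    have "real k = norm (ipoly h \<mu>)" by (simp add: eq)
    also have "\<dots> = norm (\<Sum>i<l. of_int (coeff h i) * \<mu> ^ i)"
      by (subst ipoly_altdef[of _ l]) (auto simp: l_def)
    also have "\<dots> \<le> (\<Sum>i<l. norm (of_int (coeff h i) * \<mu> ^ i))" by (rule norm_sum)
    also have "\<dots> \<le> (\<Sum>i<l. of_int M * norm \<mu> ^ i)"
    proof (intro sum_mono)
      fix i
      have "norm (of_int (coeff h i) * \<mu> ^ i) = real_of_int \<bar>coeff h i\<bar> * norm \<mu> ^ i"
        by (simp add: norm_mult norm_power)
      also have "\<dots> \<le> of_int M * norm \<mu> ^ i"
        using h(1)[of i] by (intro mult_right_mono) (auto simp del: of_int_abs)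
      finally show "norm (of_int (coeff h i) * \<mu> ^ i) \<le> of_int M * norm \<mu> ^ i" .
    qed
    also have "\<dots> = of_int M * (\<Sum>i<l. norm \<mu> ^ i)" by (simp add: sum_distrib_left)
    also have "\<dots> \<le> of_int M * (1 / (1 - norm \<mu>))"
    proof (intro mult_left_mono)
      have "(\<Sum>i<l. norm \<mu> ^ i) = (1 - norm \<mu> ^ l) / (1 - norm \<mu>)"
        using n by (simp add: sum_gp_strict)
      also have "\<dots> \<le> 1 / (1 - norm \<mu>)" using n by (intro divide_right_mono) auto
      finally show "(\<Sum>i<l. norm \<mu> ^ i) \<le> 1 / (1 - norm \<mu>)" .
    qed (use M in auto)
    finally show ?thesis by simp
  qed
  obtain k :: nat where "real k > of_int M / (1 - norm \<mu>)" using reals_Archimedean2 by blast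
  thus False using bound[of k] by simp
qed

end

section \<open>The companion matrix and norms\<close>

text \<open>The matrix of multiplication by \<open>\<beta>\<close> with respect to the powers of \<open>\<beta>\<close>, oriented such that the column
vector of the powers of a root is an eigenvector.\<close>

definition companion :: "int poly \<Rightarrow> int mat" where
  "companion f = mat (degree f) (degree f)
    (\<lambda>(i, j). if i = degree f - 1 then - coeff f j else if j = Suc i then 1 else 0)"

lemma companion_carrier [simp]: "companion f \<in> carrier_mat (degree f) (degree f)"
  "dim_row (companion f) = degree f" "dim_col (companion f) = degree f"
  by (simp_all add: companion_def)

lemma companion_pow_carrier [simp]: "companion f ^\<^sub>m k \<in> carrier_mat (degree f) (degree f)"
  by (simp add: pow_carrier_mat)

text \<open>Stated for arbitrary ring elements \<open>x\<close>, with an error term in place of the condition that \<open>x\<close> is a root: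
it is needed for \<open>\<beta>\<close> itself and for integers that are roots only modulo some \<open>g\<close>.\<close>

lemma companion_row:
  fixes x :: "'a::comm_ring_1"
  assumes "lead_coeff f = 1" "i < degree f"
  shows "(\<Sum>j<degree f. of_int (companion f $$ (i, j)) * x ^ j) =
    x ^ Suc i - (if i = degree f - 1 then ipoly f x else 0)"
proof (cases "i = degree f - 1")
  case True
  have "ipoly f x = (\<Sum>j<Suc (degree f). of_int (coeff f j) * x ^ j)"
    by (rule ipoly_altdef) simp
  also have "\<dots> = (\<Sum>j<degree f. of_int (coeff f j) * x ^ j) + x ^ degree f"
    using assms by simp
  finally show ?thesis using True assms(2)
    by (simp add: companion_def sum_negf)
next
  case False
  hence "(\<Sum>j<degree f. of_int (companion f $$ (i, j)) * x ^ j) =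
      (\<Sum>j<degree f. if j = Suc i then x ^ j else 0)"
    using assms(2) by (intro sum.cong) (auto simp: companion_def)
  also have "\<dots> = x ^ Suc i" using assms(2) False by simp
  finally show ?thesis using False by simp
qed

lemma mat_mult_entry:
  assumes "A \<in> carrier_mat n m" "B \<in> carrier_mat m l" "i < n" "j < l"
  shows "(A * B) $$ (i, j) = (\<Sum>s<m. A $$ (i, s) * B $$ (s, j))"
  using assms by (auto simp: scalar_prod_def atLeast0LessThan intro!: sum.cong)

lemma companion_pow_row:
  fixes x :: "'a::comm_ring_1"
  assumes f: "lead_coeff f = 1" and i: "i < degree f"
  shows "\<exists>u. (\<Sum>j<degree f. of_int ((companion f ^\<^sub>m k) $$ (i, j)) * x ^ j) = x ^ (k + i) + ipoly f x * u"
  using i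
proof (induction k arbitrary: i)
  case 0
  have "(\<Sum>j<degree f. of_int ((companion f ^\<^sub>m 0) $$ (i, j)) * x ^ j) = (\<Sum>j<degree f. if j = i then x ^ j else 0)"
    using 0 by (intro sum.cong) auto
  also have "\<dots> = x ^ (0 + i) + ipoly f x * 0" using 0 by simp
  finally show ?case by blast
next
  case (Suc k)
  let ?d = "degree f" and ?C = "companion f"
  obtain u where u: "\<And>i. i < ?d \<Longrightarrow>
      (\<Sum>j<?d. of_int ((?C ^\<^sub>m k) $$ (i, j)) * x ^ j) = x ^ (k + i) + ipoly f x * u i"
    using Suc.IH by metis
  have "(\<Sum>j<?d. of_int ((?C ^\<^sub>m Suc k) $$ (i, j)) * x ^ j) =
     (\<Sum>j<?d. \<Sum>s<?d. of_int ((?C ^\<^sub>m k) $$ (i, s)) * (of_int (?C $$ (s, j)) * x ^ j))"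
  proof (intro sum.cong refl)
    fix j assume "j \<in> {..<?d}"
    hence "(?C ^\<^sub>m Suc k) $$ (i, j) = (\<Sum>s<?d. (?C ^\<^sub>m k) $$ (i, s) * ?C $$ (s, j))"
      unfolding pow_mat.simps using Suc.prems
      by (intro mat_mult_entry[where n = ?d and l = ?d]) simp_all
    thus "of_int ((?C ^\<^sub>m Suc k) $$ (i, j)) * x ^ j =
       (\<Sum>s<?d. of_int ((?C ^\<^sub>m k) $$ (i, s)) * (of_int (?C $$ (s, j)) * x ^ j))"
      by (simp add: sum_distrib_right mult.assoc)
  qed
  also have "\<dots> = (\<Sum>s<?d. of_int ((?C ^\<^sub>m k) $$ (i, s)) * (\<Sum>j<?d. of_int (?C $$ (s, j)) * x ^ j))"
    by (subst sum.swap) (simp add: sum_distrib_left)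
  also have "\<dots> = (\<Sum>s<?d. of_int ((?C ^\<^sub>m k) $$ (i, s)) * (x ^ Suc s - (if s = ?d - 1 then ipoly f x else 0)))"
    using f by (intro sum.cong refl) (simp add: companion_row del: power_Suc)
  also have "\<dots> = x * (\<Sum>s<?d. of_int ((?C ^\<^sub>m k) $$ (i, s)) * x ^ s)
      - (\<Sum>s<?d. if s = ?d - 1 then of_int ((?C ^\<^sub>m k) $$ (i, s)) * ipoly f x else 0)"
    unfolding sum_distrib_left sum_subtractf[symmetric]
    by (intro sum.cong refl) (auto simp: algebra_simps)
  also have "\<dots> = x * (x ^ (k + i) + ipoly f x * u i) - of_int ((?C ^\<^sub>m k) $$ (i, ?d - 1)) * ipoly f x"
    unfolding u[OF Suc.prems] using Suc.prems by simp
  also have "\<dots> = x ^ (Suc k + i) + ipoly f x * (x * u i - of_int ((?C ^\<^sub>m k) $$ (i, ?d - 1)))"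
    by (simp add: algebra_simps)
  finally show ?case by blast
qed

text \<open>The value of the polynomial \<open>h\<close> at the companion matrix, that is, the matrix of multiplication by
\<open>h(\<beta>)\<close>. Its determinant is the norm of \<open>h(\<beta>)\<close>.\<close>

definition poly_companion :: "int poly \<Rightarrow> int poly \<Rightarrow> int mat" where
  "poly_companion f h = mat (degree f) (degree f)
    (\<lambda>(i, j). \<Sum>k\<le>degree h. coeff h k * (companion f ^\<^sub>m k) $$ (i, j))"

lemma poly_companion_carrier [simp]:
  "poly_companion f h \<in> carrier_mat (degree f) (degree f)"
  "dim_row (poly_companion f h) = degree f" "dim_col (poly_companion f h) = degree f"
  by (simp_all add: poly_companion_def)

lemma poly_companion_row:
  fixes x :: "'a::comm_ring_1"
  assumes f: "lead_coeff f = 1" and i: "i < degree f"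
  shows "\<exists>u. (\<Sum>j<degree f. of_int (poly_companion f h $$ (i, j)) * x ^ j) = ipoly h x * x ^ i + ipoly f x * u"
proof -
  let ?d = "degree f" and ?C = "companion f"
  have "\<forall>k. \<exists>u. (\<Sum>j<?d. of_int ((?C ^\<^sub>m k) $$ (i, j)) * x ^ j) = x ^ (k + i) + ipoly f x * u"
    using companion_pow_row[OF f i] by blast
  from choice[OF this] obtain u where
    u: "\<And>k. (\<Sum>j<?d. of_int ((?C ^\<^sub>m k) $$ (i, j)) * x ^ j) = x ^ (k + i) + ipoly f x * u k"
    by blast
  have "(\<Sum>j<?d. of_int (poly_companion f h $$ (i, j)) * x ^ j) =
     (\<Sum>j<?d. \<Sum>k\<le>degree h. of_int (coeff h k) * (of_int ((?C ^\<^sub>m k) $$ (i, j)) * x ^ j))"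
    using i by (intro sum.cong) (auto simp: poly_companion_def sum_distrib_right mult.assoc)
  also have "\<dots> = (\<Sum>k\<le>degree h. of_int (coeff h k) * (\<Sum>j<?d. of_int ((?C ^\<^sub>m k) $$ (i, j)) * x ^ j))"
    by (subst sum.swap) (simp add: sum_distrib_left)
  also have "\<dots> = (\<Sum>k\<le>degree h. of_int (coeff h k) * x ^ k) * x ^ i
      + ipoly f x * (\<Sum>k\<le>degree h. of_int (coeff h k) * u k)"
    unfolding u sum_distrib_left sum_distrib_right sum.distrib[symmetric]
    by (intro sum.cong refl) (simp add: algebra_simps power_add)
  also have "(\<Sum>k\<le>degree h. of_int (coeff h k) * x ^ k) = ipoly h x"
    using ipoly_altdef[of h "Suc (degree h)" x] by (simp add: lessThan_Suc_atMost)
  finally show ?thesis by blast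
qed

text \<open>A unimodular matrix with first column \<open>v\<close> transforms \<open>H\<close> into a matrix whose first column is divisible
by \<open>g\<close>.\<close>

lemma dvd_det_if_dvd_mult_vec:
  fixes H :: "int mat"
  assumes H: "H \<in> carrier_mat d d" and d: "d > 0" and v0: "v 0 = 1"
    and dv: "\<And>i. i < d \<Longrightarrow> g dvd (\<Sum>j<d. H $$ (i, j) * v j)"
  shows "g dvd det H"
proof -
  define V where "V = mat d d (\<lambda>(i, j). if j = 0 then v i else if i = j then 1 else 0)"
  have V: "V \<in> carrier_mat d d" by (simp add: V_def)
  have "det V = prod_list (diag_mat V)"
    by (rule det_lower_triangular[OF _ V]) (auto simp: V_def)
  also have "diag_mat V = replicate d 1"
    using v0 by (intro nth_equalityI) (auto simp: diag_mat_def V_def)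
  finally have detV: "det V = 1" by simp
  have HV: "H * V \<in> carrier_mat d d" using H V by simp
  have "det H = det (H * V)" using det_mult[OF H V] detV by simp
  also have "\<dots> = (\<Sum>i<d. (H * V) $$ (i, 0) * cofactor (H * V) i 0)"
    by (rule laplace_expansion_column[OF HV d])
  also have "g dvd \<dots>"
  proof (intro dvd_sum dvd_mult2)
    fix i assume "i \<in> {..<d}"
    hence i: "i < d" by simp
    have "(H * V) $$ (i, 0) = (\<Sum>j<d. H $$ (i, j) * V $$ (j, 0))"
      by (rule mat_mult_entry[OF H V i d])
    also have "\<dots> = (\<Sum>j<d. H $$ (i, j) * v j)"
      using d by (intro sum.cong) (auto simp: V_def)
    finally show "g dvd (H * V) $$ (i, 0)" using dv[OF i] by simp
  qed
  finally show ?thesis .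
qed

text \<open>The first column has a single nonzero entry, and its minor is an identity matrix.\<close>

lemma abs_det_companion:
  assumes "degree f > 0"
  shows "\<bar>det (companion f)\<bar> = \<bar>coeff f 0\<bar>"
proof -
  let ?d = "degree f" and ?C = "companion f"
  have "det ?C = (\<Sum>i<?d. ?C $$ (i, 0) * cofactor ?C i 0)"
    by (rule laplace_expansion_column) (use assms in auto)
  also have "\<dots> = (\<Sum>i<?d. if i = ?d - 1 then - coeff f 0 * cofactor ?C i 0 else 0)"
    using assms by (intro sum.cong refl) (auto simp: companion_def)
  also have "\<dots> = - coeff f 0 * cofactor ?C (?d - 1) 0" using assms by simp
  finally have det: "det ?C = - coeff f 0 * cofactor ?C (?d - 1) 0" .
  have "mat_delete ?C (?d - 1) 0 = 1\<^sub>m (?d - 1)"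
    using assms by (intro eq_matI) (auto simp: mat_delete_def companion_def)
  hence "\<bar>cofactor ?C (?d - 1) 0\<bar> = 1" by (simp add: cofactor_def power_abs)
  thus ?thesis by (simp add: det abs_mult)
qed

context integral_generator
begin

text \<open>A left kernel vector of the matrix yields a nonzero polynomial \<open>W\<close> of degree less than that of \<open>f\<close> with
\<open>h(\<beta>) W(\<beta>) = 0\<close>, and \<open>W(\<beta>)\<close> is not 0.\<close>

lemma det_poly_companion_eq_0:
  assumes "det (poly_companion f h) = 0"
  shows "ipoly h \<beta> = 0"
proof -
  let ?d = "degree f" and ?H = "poly_companion f h"
  have HT: "transpose_mat ?H \<in> carrier_mat ?d ?d" by simp
  have "det (transpose_mat ?H) = 0" using assms by (simp add: det_transpose[of _ ?d])
  then obtain w where w: "w \<in> carrier_vec ?d" "w \<noteq> 0\<^sub>v ?d" and w0: "transpose_mat ?H *\<^sub>v w = 0\<^sub>v ?d"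
    using det_0_iff_vec_prod_zero[OF HT] by blast
  have col: "(\<Sum>i<?d. w $ i * ?H $$ (i, j)) = 0" if "j < ?d" for j
  proof -
    have "(transpose_mat ?H *\<^sub>v w) $ j = (\<Sum>i<?d. ?H $$ (i, j) * w $ i)"
      using that w by (auto simp: scalar_prod_def atLeast0LessThan intro!: sum.cong)
    thus ?thesis using w0 that by (simp add: mult.commute)
  qed
  define W where "W = (\<Sum>i<?d. monom (w $ i) i)"
  have coeffW: "coeff W i = (if i < ?d then w $ i else 0)" for i
    by (simp add: W_def coeff_sum)
  have "W \<noteq> 0"
  proof
    assume "W = 0"
    hence "w $ i = 0" if "i < ?d" for i using coeffW[of i] that by simp
    thus False using w by (metis carrier_vecD eq_vecI index_zero_vec)
  qed
  have "degree W < ?d" using degree_pos coeffW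
    by (metis \<open>W \<noteq> 0\<close> leading_coeff_0_iff)
  hence "\<not> f dvd W" using \<open>W \<noteq> 0\<close> by (auto dest: dvd_imp_degree_le)
  have Wval: "ipoly W \<beta> = (\<Sum>i<?d. of_int (w $ i) * \<beta> ^ i)"
    using ipoly_altdef[OF \<open>degree W < ?d\<close>, of \<beta>] by (simp add: coeffW)
  have "0 = (\<Sum>j<?d. of_int (\<Sum>i<?d. w $ i * ?H $$ (i, j)) * \<beta> ^ j)" by (simp add: col)
  also have "\<dots> = (\<Sum>j<?d. \<Sum>i<?d. of_int (w $ i) * (of_int (?H $$ (i, j)) * \<beta> ^ j))"
    by (simp add: sum_distrib_right mult.assoc)
  also have "\<dots> = (\<Sum>i<?d. of_int (w $ i) * (\<Sum>j<?d. of_int (?H $$ (i, j)) * \<beta> ^ j))"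
    by (subst sum.swap) (simp add: sum_distrib_left)
  also have "\<dots> = (\<Sum>i<?d. of_int (w $ i) * (ipoly h \<beta> * \<beta> ^ i))"
  proof (intro sum.cong refl)
    fix i assume "i \<in> {..<?d}"
    thus "of_int (w $ i) * (\<Sum>j<?d. of_int (?H $$ (i, j)) * \<beta> ^ j) = of_int (w $ i) * (ipoly h \<beta> * \<beta> ^ i)"
      using poly_companion_row[OF monic, of i h \<beta>] ipoly_f by auto
  qed
  also have "\<dots> = ipoly h \<beta> * ipoly W \<beta>"
    by (simp add: Wval sum_distrib_left mult_ac)
  finally show ?thesis using \<open>\<not> f dvd W\<close> ipoly_eq_0_iff[of W] by auto
qed

text \<open>If \<open>h(\<beta>)\<close> is in the kernel of the reduction \<open>\<beta> \<mapsto> B\<close> modulo \<open>g\<close>, then its norm is divisible by \<open>g\<close>,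
because the vector of the powers of \<open>B\<close> is sent to 0 modulo \<open>g\<close>.\<close>

lemma dvd_det_poly_companion:
  assumes "g dvd poly f B" "g dvd poly h B"
  shows "g dvd det (poly_companion f h)"
proof (rule dvd_det_if_dvd_mult_vec[where d = "degree f" and v = "\<lambda>i. B ^ i"])
  fix i assume i: "i < degree f"
  have id: "map_poly of_int p = p" for p :: "int poly" by (rule poly_eqI) (simp add: coeff_map_poly)
  obtain u where "(\<Sum>j<degree f. poly_companion f h $$ (i, j) * B ^ j) = poly h B * B ^ i + poly f B * u"
    using poly_companion_row[OF monic i, of h B] by (auto simp: id)
  thus "g dvd (\<Sum>j<degree f. poly_companion f h $$ (i, j) * B ^ j)" using assms by simp
qed (use degree_pos in auto)

text \<open>The number \<open>h(\<beta>)\<close> is an eigenvalue of an integer matrix, hence a root of its monic characteristic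
polynomial.\<close>

lemma algebraic_int_ipoly: "algebraic_int (ipoly h \<beta>)"
proof -
  let ?d = "degree f" and ?H = "poly_companion f h"
  define H where "H = (map_mat of_int ?H :: 'k mat)"
  have H: "H \<in> carrier_mat ?d ?d" by (simp add: H_def)
  define b where "b = vec ?d (\<lambda>i. \<beta> ^ i)"
  have b: "b \<in> carrier_vec ?d" "b $ 0 = 1" using degree_pos by (simp_all add: b_def)
  have "H *\<^sub>v b = ipoly h \<beta> \<cdot>\<^sub>v b"
  proof (rule eq_vecI)
    fix i assume "i < dim_vec (ipoly h \<beta> \<cdot>\<^sub>v b)"
    hence i: "i < ?d" by (simp add: b_def)
    have "(H *\<^sub>v b) $ i = (\<Sum>j<?d. of_int (?H $$ (i, j)) * \<beta> ^ j)"
      using i by (auto simp: H_def b_def scalar_prod_def atLeast0LessThan intro!: sum.cong)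
    also have "\<dots> = ipoly h \<beta> * \<beta> ^ i"
      using poly_companion_row[OF monic i, of h \<beta>] ipoly_f by auto
    finally show "(H *\<^sub>v b) $ i = (ipoly h \<beta> \<cdot>\<^sub>v b) $ i" using i by (simp add: b_def)
  qed (simp add: H_def b_def)
  moreover have "b \<noteq> 0\<^sub>v ?d" using b(2) degree_pos by auto
  ultimately have "eigenvector H b (ipoly h \<beta>)"
    using H b(1) by (auto simp: eigenvector_def)
  hence "eigenvalue H (ipoly h \<beta>)" by (auto simp: eigenvalue_def)
  hence "poly (char_poly H) (ipoly h \<beta>) = 0" using eigenvalue_root_char_poly[OF H] by simp
  hence "ipoly (char_poly ?H) (ipoly h \<beta>) = 0"
    unfolding H_def by (simp add: of_int_hom.char_poly_hom[of _ ?d])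
  moreover have "lead_coeff (char_poly ?H) = 1"
    using degree_monic_char_poly[of ?H ?d] by auto
  ultimately show ?thesis by (auto simp: algebraic_int_altdef_ipoly)
qed

end

section \<open>Counting expansions in a congruence class\<close>

lemma smult_mat_pow:
  fixes A :: "'a::comm_ring_1 mat"
  assumes A: "A \<in> carrier_mat n n"
  shows "(a \<cdot>\<^sub>m A) ^\<^sub>m k = a ^ k \<cdot>\<^sub>m (A ^\<^sub>m k)"
proof (induction k)
  case 0
  show ?case using A by (intro eq_matI) auto
next
  case (Suc k)
  have Ak: "A ^\<^sub>m k \<in> carrier_mat n n" using A by (rule pow_carrier_mat)
  have "(a \<cdot>\<^sub>m A) ^\<^sub>m Suc k = (a ^ k \<cdot>\<^sub>m (A ^\<^sub>m k)) * (a \<cdot>\<^sub>m A)" using Suc.IH by simp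
  also have "\<dots> = a ^ k \<cdot>\<^sub>m (A ^\<^sub>m k * (a \<cdot>\<^sub>m A))"
    by (rule mult_smult_assoc_mat[OF Ak]) (use A in auto)
  also have "A ^\<^sub>m k * (a \<cdot>\<^sub>m A) = a \<cdot>\<^sub>m (A ^\<^sub>m k * A)"
    by (rule mult_smult_distrib[OF Ak A])
  also have "a ^ k \<cdot>\<^sub>m (a \<cdot>\<^sub>m (A ^\<^sub>m k * A)) = a ^ Suc k \<cdot>\<^sub>m (A ^\<^sub>m Suc k)"
    using A Ak by (intro eq_matI) auto
  finally show ?case .
qed

lemma mat_pow_add:
  fixes A :: "'a::comm_ring_1 mat"
  assumes A: "A \<in> carrier_mat n n"
  shows "A ^\<^sub>m (k + m) = A ^\<^sub>m k * A ^\<^sub>m m"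
proof (induction m)
  case 0
  show ?case using A by simp
next
  case (Suc m)
  have "A ^\<^sub>m (k + Suc m) = (A ^\<^sub>m k * A ^\<^sub>m m) * A" using Suc.IH by simp
  also have "\<dots> = A ^\<^sub>m k * (A ^\<^sub>m m * A)"
    by (rule assoc_mult_mat[of _ n n _ n _ n]) (use A in auto)
  finally show ?case by simp
qed

lemma det_mat_pow:
  fixes A :: "'a::comm_ring_1 mat"
  assumes A: "A \<in> carrier_mat n n"
  shows "det (A ^\<^sub>m k) = det A ^ k"
proof (induction k)
  case (Suc k)
  thus ?case using det_mult[OF pow_carrier_mat[OF A] A] by simp
qed (use A in simp)

lemma eigenvalue_companion:
  fixes \<mu> :: complex
  assumes f: "lead_coeff f = 1" and d: "degree f > 0"
    and ev: "eigenvalue (map_mat of_int (companion f)) \<mu>"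
  shows "ipoly f \<mu> = 0"
proof -
  let ?d = "degree f" and ?C = "map_mat of_int (companion f) :: complex mat"
  obtain v where v: "v \<in> carrier_vec ?d" "v \<noteq> 0\<^sub>v ?d" and Cv: "?C *\<^sub>v v = \<mu> \<cdot>\<^sub>v v"
    using ev by (auto simp: eigenvalue_def eigenvector_def)
  have row: "(\<Sum>j<?d. of_int (companion f $$ (i, j)) * v $ j) = \<mu> * v $ i" if "i < ?d" for i
  proof -
    have "(?C *\<^sub>v v) $ i = (\<Sum>j<?d. of_int (companion f $$ (i, j)) * v $ j)"
      using that v by (auto simp: scalar_prod_def atLeast0LessThan intro!: sum.cong)
    thus ?thesis using that v by (simp add: Cv)
  qed
  have pow: "v $ i = \<mu> ^ i * v $ 0" if "i < ?d" for i
    using that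
  proof (induction i)
    case (Suc i)
    have "(\<Sum>j<?d. of_int (companion f $$ (i, j)) * v $ j) = (\<Sum>j<?d. if j = Suc i then v $ j else 0)"
      using Suc.prems by (intro sum.cong) (auto simp: companion_def)
    hence "v $ Suc i = \<mu> * v $ i" using row[of i] Suc.prems by simp
    thus ?case using Suc by simp
  qed simp
  have v0: "v $ 0 \<noteq> 0"
  proof
    assume "v $ 0 = 0"
    hence "v = 0\<^sub>v ?d" using v(1) pow by (intro eq_vecI) auto
    thus False using v(2) by simp
  qed
  have last: "v $ (?d - 1) = \<mu> ^ (?d - 1) * v $ 0" by (rule pow) (use d in simp)
  have "\<mu> ^ ?d = \<mu> * \<mu> ^ (?d - 1)" using d by (simp add: power_eq_if)
  hence "\<mu> ^ ?d * v $ 0 = \<mu> * v $ (?d - 1)" by (simp only: last mult.assoc)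
  also have "\<dots> = (\<Sum>j<?d. of_int (companion f $$ (?d - 1, j)) * v $ j)"
    by (rule row[symmetric]) (use d in simp)
  also have "\<dots> = (\<Sum>j<?d. of_int (companion f $$ (?d - 1, j)) * \<mu> ^ j) * v $ 0"
    unfolding sum_distrib_right
  proof (intro sum.cong refl)
    fix j assume "j \<in> {..<?d}"
    hence "v $ j = \<mu> ^ j * v $ 0" by (intro pow) simp
    thus "of_int (companion f $$ (?d - 1, j)) * v $ j = of_int (companion f $$ (?d - 1, j)) * \<mu> ^ j * v $ 0"
      by (simp only: mult.assoc)
  qed
  also have "\<dots> = (\<mu> ^ ?d - ipoly f \<mu>) * v $ 0"
    using d by (subst companion_row[OF f]) auto
  finally have "ipoly f \<mu> * v $ 0 = 0"
    by (simp only: left_diff_distrib) simp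
  thus ?thesis using v0 by simp
qed

lemma norm_det_le:
  fixes A :: "complex mat"
  assumes A: "A \<in> carrier_mat n n" and e: "\<And>i j. i < n \<Longrightarrow> j < n \<Longrightarrow> norm (A $$ (i, j)) \<le> e"
  shows "norm (det A) \<le> fact n * e ^ n"
proof -
  have "norm (det A) \<le> (\<Sum>p | p permutes {0..<n}. norm (signof p * (\<Prod>i = 0..<n. A $$ (i, p i))))"
    unfolding det_def'[OF A] by (rule norm_sum)
  also have "\<dots> \<le> (\<Sum>p | p permutes {0..<n}. e ^ n)"
  proof (intro sum_mono)
    fix p assume "p \<in> {p. p permutes {0..<n}}"
    hence p: "p permutes {0..<n}" by simp
    have "norm (signof p * (\<Prod>i = 0..<n. A $$ (i, p i))) = (\<Prod>i = 0..<n. norm (A $$ (i, p i)))"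
      by (simp add: norm_mult sign_def prod_norm)
    also have "\<dots> \<le> (\<Prod>i = 0..<n. e)"
      using e permutes_in_image[OF p] by (intro prod_mono) auto
    finally show "norm (signof p * (\<Prod>i = 0..<n. A $$ (i, p i))) \<le> e ^ n" by simp
  qed
  also have "\<dots> = fact n * e ^ n"
    by (simp add: card_permutations[of "{0..<n}" n])
  finally show ?thesis .
qed

locale expanding_generator = integral_generator +
  assumes expanding: "ipoly f (\<mu>::complex) = 0 \<Longrightarrow> norm \<mu> > 1"
begin

abbreviation "d \<equiv> degree f"

lemma coeff_f_0_nonzero: "coeff f 0 \<noteq> 0"
proof
  assume "coeff f 0 = 0"
  hence "ipoly f (0::complex) = 0" by (simp add: poly_0_coeff_0 coeff_map_poly)
  thus False using expanding[of 0] by simp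
qed

text \<open>The eigenvalues of the inverse companion matrix are the inverses of the conjugates of \<open>\<beta>\<close>, so its
spectral radius is less than 1 and its powers tend to 0 geometrically.\<close>

lemma inverse_companion_decay:
  obtains D :: "complex mat" and c r :: real where
    "D \<in> carrier_mat d d" "map_mat of_int (companion f) * D = 1\<^sub>m d"
    "0 < r" "r < 1" "c \<ge> 0"
    "\<And>k i j. i < d \<Longrightarrow> j < d \<Longrightarrow> norm ((D ^\<^sub>m k) $$ (i, j)) \<le> c * r ^ k"
proof -
  define C where "C = (map_mat of_int (companion f) :: complex mat)"
  have C: "C \<in> carrier_mat d d" by (simp add: C_def)
  have "det C = of_int (det (companion f))" by (simp add: C_def of_int_hom.hom_det)
  hence "det C \<noteq> 0" using abs_det_companion[OF degree_pos] coeff_f_0_nonzero by auto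
  hence "C \<in> Units (ring_mat TYPE(complex) d ())" by (rule det_non_zero_imp_unit[OF C])
  then obtain D where D: "D \<in> carrier_mat d d" "D * C = 1\<^sub>m d" "C * D = 1\<^sub>m d"
    by (auto simp: Units_def ring_mat_simps)
  have ev: "norm \<nu> < 1" if "eigenvalue D \<nu>" for \<nu>
  proof -
    obtain v where v: "v \<in> carrier_vec d" "v \<noteq> 0\<^sub>v d" and Dv: "D *\<^sub>v v = \<nu> \<cdot>\<^sub>v v"
      using \<open>eigenvalue D \<nu>\<close> D by (auto simp: eigenvalue_def eigenvector_def)
    have "v = (C * D) *\<^sub>v v" using D v by simp
    also have "\<dots> = C *\<^sub>v (D *\<^sub>v v)" by (rule assoc_mult_mat_vec[OF C D(1) v(1)])
    also have "\<dots> = \<nu> \<cdot>\<^sub>v (C *\<^sub>v v)" unfolding Dv by (rule mult_mat_vec[OF C v(1)])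
    finally have eq: "v = \<nu> \<cdot>\<^sub>v (C *\<^sub>v v)" .
    have "\<nu> \<noteq> 0"
    proof
      assume "\<nu> = 0"
      have "v $ i = 0" if "i < d" for i
        using arg_cong[OF eq, of "\<lambda>w. w $ i"] that C \<open>\<nu> = 0\<close> by simp
      hence "v = 0\<^sub>v d" using v(1) by (intro eq_vecI) auto
      thus False using v by simp
    qed
    have "C *\<^sub>v v = inverse \<nu> \<cdot>\<^sub>v (\<nu> \<cdot>\<^sub>v (C *\<^sub>v v))"
      using \<open>\<nu> \<noteq> 0\<close> by (simp add: smult_smult_assoc)
    also have "\<dots> = inverse \<nu> \<cdot>\<^sub>v v" using eq by simp
    finally have "eigenvalue C (inverse \<nu>)"
      using v C by (auto simp: eigenvalue_def eigenvector_def)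
    hence "ipoly f (inverse \<nu>) = 0"
      using eigenvalue_companion[OF monic degree_pos] by (simp add: C_def)
    hence "norm (inverse \<nu>) > 1" by (rule expanding)
    thus ?thesis using \<open>\<nu> \<noteq> 0\<close> by (simp add: norm_inverse one_less_inverse_iff)
  qed
  define s where "s = spectral_radius D"
  have "s < 1" "s \<ge> 0"
    using spectral_radius_mem_max(1)[OF D(1) degree_pos] ev by (auto simp: s_def spectrum_def)
  define r where "r = (s + 1) / 2"
  have r: "0 < r" "s < r" "r < 1" using \<open>s < 1\<close> \<open>s \<ge> 0\<close> by (auto simp: r_def)
  define M where "M = complex_of_real (inverse r) \<cdot>\<^sub>m D"
  have M: "M \<in> carrier_mat d d" using D by (simp add: M_def)
  have DM: "D = complex_of_real r \<cdot>\<^sub>m M" using r D by (intro eq_matI) (auto simp: M_def)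
  have evM: "norm \<kappa> < 1" if \<kappa>: "eigenvalue M \<kappa>" for \<kappa>
  proof -
    obtain v where v: "v \<in> carrier_vec d" "v \<noteq> 0\<^sub>v d" and Mv: "M *\<^sub>v v = \<kappa> \<cdot>\<^sub>v v"
      using \<kappa> M by (auto simp: eigenvalue_def eigenvector_def)
    have "D *\<^sub>v v = complex_of_real r \<cdot>\<^sub>v (M *\<^sub>v v)"
      unfolding DM using M v(1) by (intro eq_vecI) auto
    also have "\<dots> = (complex_of_real r * \<kappa>) \<cdot>\<^sub>v v" by (simp add: Mv smult_smult_assoc)
    finally have "eigenvalue D (complex_of_real r * \<kappa>)"
      using v D by (auto simp: eigenvalue_def eigenvector_def)
    hence "norm (complex_of_real r * \<kappa>) \<le> s"
      unfolding s_def using spectral_radius_mem_max(2)[OF D(1) degree_pos] by (auto simp: spectrum_def)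
    hence "r * norm \<kappa> \<le> s" using r by (simp add: norm_mult)
    hence "r * norm \<kappa> < r * 1" using r by linarith
    thus ?thesis using r by (simp only: mult_less_cancel_left_pos)
  qed
  have "spectral_radius M < 1"
    using spectral_radius_mem_max(1)[OF M degree_pos] evM by (auto simp: spectrum_def)
  then obtain c where c: "\<And>k. norm_bound (M ^\<^sub>m k) c"
    using spectral_radius_jnf_norm_bound_less_1_upper_triangular[OF M] by blast
  have bound: "norm ((D ^\<^sub>m k) $$ (i, j)) \<le> max 0 c * r ^ k" if ij: "i < d" "j < d" for k i j
  proof -
    have Mk: "M ^\<^sub>m k \<in> carrier_mat d d" using M by (rule pow_carrier_mat)
    have "norm ((M ^\<^sub>m k) $$ (i, j)) \<le> c" using c[of k] carrier_matD[OF Mk] ij unfolding norm_bound_def by metis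
    hence "r ^ k * norm ((M ^\<^sub>m k) $$ (i, j)) \<le> r ^ k * c"
      using r by (intro mult_left_mono) auto
    also have "r ^ k * norm ((M ^\<^sub>m k) $$ (i, j)) = norm ((D ^\<^sub>m k) $$ (i, j))"
      unfolding DM smult_mat_pow[OF M] using Mk M ij r by (simp add: norm_mult norm_power)
    finally have "norm ((D ^\<^sub>m k) $$ (i, j)) \<le> r ^ k * c" .
    also have "\<dots> \<le> r ^ k * max 0 c" using r by (intro mult_left_mono) auto
    finally show ?thesis by (simp add: mult.commute)
  qed
  show ?thesis
    by (rule that[OF D(1) D(3)[unfolded C_def] r(1,3) _ bound]) simp_all
qed

text \<open>The number \<open>K\<close> bounds the size of a set \<open>Y\<close> of expansions of length \<open>l\<close> with coefficients up to \<open>M\<close>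
that have different values at \<open>\<beta>\<close> but are congruent under a reduction \<open>\<beta> \<mapsto> B\<close> modulo some \<open>g\<close> that is
at least the absolute norm of \<open>\<beta> ^ l\<close>.\<close>

definition congruent_expansions_bound :: "int \<Rightarrow> nat \<Rightarrow> bool" where
  "congruent_expansions_bound M K \<longleftrightarrow> (\<forall>l g B Y. finite Y \<longrightarrow>
     (\<forall>y\<in>Y. \<forall>i. \<bar>coeff y i\<bar> \<le> M) \<longrightarrow> (\<forall>y\<in>Y. \<forall>i\<ge>l. coeff y i = 0) \<longrightarrow>
     inj_on (\<lambda>y. ipoly y \<beta>) Y \<longrightarrow> \<bar>coeff f 0\<bar> ^ l \<le> g \<longrightarrow> g dvd poly f B \<longrightarrow>
     (\<forall>y\<in>Y. \<forall>y'\<in>Y. g dvd poly (y - y') B) \<longrightarrow> card Y \<le> K)"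

lemma congruent_expansions_boundD:
  assumes "congruent_expansions_bound M K"
    and "finite Y" "\<forall>y\<in>Y. \<forall>i. \<bar>coeff y i\<bar> \<le> M" "\<forall>y\<in>Y. \<forall>i\<ge>l. coeff y i = 0"
    and "inj_on (\<lambda>y. ipoly y \<beta>) Y" "\<bar>coeff f 0\<bar> ^ l \<le> g" "g dvd poly f B"
    and "\<forall>y\<in>Y. \<forall>y'\<in>Y. g dvd poly (y - y') B"
  shows "card Y \<le> K"
  using assms unfolding congruent_expansions_bound_def by blast

text \<open>For an expansion \<open>y\<close> of length \<open>l\<close> let \<open>T\<close> be the matrix of multiplication by \<open>y(\<beta>) / \<beta> ^ l\<close>. Its
entries are bounded independently of \<open>l\<close> by a geometric series in the inverse companion matrix. Cover the
bounded region by small cells. If two expansions share a cell, then the matrix for their difference has small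
entries and so a determinant of absolute value less than 1; multiplied by the norm of \<open>\<beta> ^ l\<close> this bounds
the norm of the difference by \<open>g\<close>. Being divisible by \<open>g\<close>, the norm vanishes.\<close>

lemma congruent_expansions_bound_exists: "\<exists>K. congruent_expansions_bound M K"
proof -
  obtain D :: "complex mat" and c r :: real where
    D: "D \<in> carrier_mat d d" "map_mat of_int (companion f) * D = 1\<^sub>m d"
    and r: "0 < r" "r < 1" and c: "c \<ge> 0"
    and decay: "\<And>k i j. i < d \<Longrightarrow> j < d \<Longrightarrow> norm ((D ^\<^sub>m k) $$ (i, j)) \<le> c * r ^ k"
    by (rule inverse_companion_decay) blast
  define C where "C = (map_mat of_int (companion f) :: complex mat)"
  have C: "C \<in> carrier_mat d d" by (simp add: C_def)
  have CD: "C * D = 1\<^sub>m d" using D by (simp add: C_def)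
  have Ck: "C ^\<^sub>m k \<in> carrier_mat d d" for k using C by (rule pow_carrier_mat)
  have Dk: "D ^\<^sub>m k \<in> carrier_mat d d" for k using D(1) by (rule pow_carrier_mat)
  have CkDk: "C ^\<^sub>m k * D ^\<^sub>m k = 1\<^sub>m d" for k
  proof (induction k)
    case 0 show ?case using C D by simp
  next
    case (Suc k)
    have D_comm: "D ^\<^sub>m Suc k = D * D ^\<^sub>m k"
      using mat_pow_add[OF D(1), of 1 k] D by simp
    have "C ^\<^sub>m Suc k * D ^\<^sub>m Suc k = C ^\<^sub>m k * C * (D * D ^\<^sub>m k)"
      unfolding D_comm by (simp only: pow_mat.simps)
    also have "\<dots> = C ^\<^sub>m k * (C * (D * D ^\<^sub>m k))" 
      by (rule assoc_mult_mat[OF Ck C]) (use D Dk in auto)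
    also have "C * (D * D ^\<^sub>m k) = C * D * D ^\<^sub>m k"
      by (rule assoc_mult_mat[OF C D(1) Dk, symmetric])
    also have "\<dots> = D ^\<^sub>m k" unfolding CD by (rule left_mult_one_mat[OF Dk])
    finally show ?case using Suc.IH by simp
  qed
  have cancel: "C ^\<^sub>m l * D ^\<^sub>m (l - k) = C ^\<^sub>m k" if "k \<le> l" for k l
  proof -
    have "C ^\<^sub>m l = C ^\<^sub>m k * C ^\<^sub>m (l - k)"
      using mat_pow_add[OF C, of k "l - k"] that by simp
    also have "\<dots> * D ^\<^sub>m (l - k) = C ^\<^sub>m k * (C ^\<^sub>m (l - k) * D ^\<^sub>m (l - k))"
      by (rule assoc_mult_mat[OF Ck Ck Dk])
    also have "\<dots> = C ^\<^sub>m k" unfolding CkDk by (rule right_mult_one_mat[OF Ck])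
    finally show ?thesis .
  qed
  define T where "T l y = mat d d (\<lambda>(i, j). \<Sum>k<l. of_int (coeff y k) * (D ^\<^sub>m (l - k)) $$ (i, j))"
    for l :: nat and y :: "int poly"
  have T: "T l y \<in> carrier_mat d d" for l y by (simp add: T_def)
  have factor: "map_mat of_int (poly_companion f y) = C ^\<^sub>m l * T l y"
    if y: "\<forall>i\<ge>l. coeff y i = 0" for l y
  proof (rule eq_matI)
    fix i j assume "i < dim_row (C ^\<^sub>m l * T l y)" "j < dim_col (C ^\<^sub>m l * T l y)"
    hence ij: "i < d" "j < d" using C by (simp_all add: T_def)
    have "(C ^\<^sub>m l * T l y) $$ (i, j) = (\<Sum>s<d. (C ^\<^sub>m l) $$ (i, s) * T l y $$ (s, j))"
      by (rule mat_mult_entry[OF Ck T ij])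
    also have "\<dots> = (\<Sum>s<d. \<Sum>k<l. of_int (coeff y k) * ((C ^\<^sub>m l) $$ (i, s) * (D ^\<^sub>m (l - k)) $$ (s, j)))"
      using ij by (intro sum.cong refl) (simp add: T_def sum_distrib_left mult_ac)
    also have "\<dots> = (\<Sum>k<l. of_int (coeff y k) * (C ^\<^sub>m l * D ^\<^sub>m (l - k)) $$ (i, j))"
      by (subst sum.swap) (simp add: mat_mult_entry[OF Ck Dk ij] sum_distrib_left)
    also have "\<dots> = (\<Sum>k<l. of_int (coeff y k) * (C ^\<^sub>m k) $$ (i, j))"
      by (intro sum.cong refl) (simp add: cancel)
    also have "\<dots> = (\<Sum>k<l. of_int (coeff y k * (companion f ^\<^sub>m k) $$ (i, j)))"
      using ij by (simp add: C_def of_int_hom.mat_hom_pow[of _ d, symmetric])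
    also have "\<dots> = (\<Sum>k\<le>degree y. of_int (coeff y k * (companion f ^\<^sub>m k) $$ (i, j)))"
      using y by (intro sum.mono_neutral_cong) (auto simp: coeff_eq_0 not_less)
    also have "\<dots> = map_mat of_int (poly_companion f y) $$ (i, j)"
      using ij by (simp add: poly_companion_def)
    finally show "map_mat of_int (poly_companion f y) $$ (i, j) = (C ^\<^sub>m l * T l y) $$ (i, j)" ..
  qed (use C in \<open>simp_all add: T_def\<close>)
  define R where "R = of_int M * c / (1 - r)"
  have bound: "norm (T l y $$ (i, j)) \<le> R" if ij: "i < d" "j < d" and y: "\<forall>i. \<bar>coeff y i\<bar> \<le> M" for l y i j
  proof -
    have M: "M \<ge> 0" using y by (meson abs_ge_zero order_trans)
    have "norm (T l y $$ (i, j)) \<le> (\<Sum>k<l. norm (of_int (coeff y k) * (D ^\<^sub>m (l - k)) $$ (i, j)))"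
      using ij by (simp add: T_def norm_sum)
    also have "\<dots> \<le> (\<Sum>k<l. of_int M * (c * r ^ (l - k)))"
    proof (intro sum_mono)
      fix k
      have "norm (of_int (coeff y k) * (D ^\<^sub>m (l - k)) $$ (i, j)) = of_int \<bar>coeff y k\<bar> * norm ((D ^\<^sub>m (l - k)) $$ (i, j))"
        by (simp add: norm_mult)
      also have "\<dots> \<le> of_int M * (c * r ^ (l - k))"
        using y M by (intro mult_mono decay ij) (auto simp del: of_int_abs)
      finally show "norm (of_int (coeff y k) * (D ^\<^sub>m (l - k)) $$ (i, j)) \<le> of_int M * (c * r ^ (l - k))" .
    qed
    also have "\<dots> = of_int M * c * (\<Sum>k<l. r ^ (l - k))" by (simp add: sum_distrib_left mult.assoc)
    also have "(\<Sum>k<l. r ^ (l - k)) = (\<Sum>k<l. r ^ Suc k)"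
      by (rule sum.reindex_bij_witness[of _ "\<lambda>k. l - Suc k" "\<lambda>k. l - Suc k"]) (auto simp: Suc_diff_Suc)
    also have "\<dots> \<le> (\<Sum>k<l. r ^ k)" using r by (intro sum_mono power_decreasing) auto
    also have "\<dots> \<le> 1 / (1 - r)"
      using r by (simp add: sum_gp_strict divide_right_mono)
    finally show ?thesis using M c by (simp add: R_def mult_left_mono)
  qed
  \<comment> \<open>Entries of size at most \<open>2 * e\<close> force a determinant of absolute value at most \<open>1 / 2\<close>.\<close>
  define e where "e = 1 / (4 * fact d :: real)"
  have e: "e > 0" by (simp add: e_def)
  define m where "m = \<lceil>R / e\<rceil> + 1"
  define cells where "cells = ({..<d} \<times> {..<d}) \<rightarrow>\<^sub>E ({-m..m} \<times> {-m..m})"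
  have fin_cells: "finite cells" by (auto simp: cells_def intro!: finite_PiE)
  define cell where "cell l y = (\<lambda>ij\<in>{..<d} \<times> {..<d}. (\<lfloor>Re (T l y $$ ij) / e\<rfloor>, \<lfloor>Im (T l y $$ ij) / e\<rfloor>))"
    for l y
  have floor_range: "\<lfloor>t / e\<rfloor> \<in> {-m..m}" if "\<bar>t\<bar> \<le> R" for t
  proof -
    have "\<bar>t / e\<bar> \<le> R / e" using that e by (simp add: abs_divide divide_right_mono)
    hence "t / e \<le> R / e" "- (R / e) \<le> t / e" by linarith+
    hence "\<lfloor>t / e\<rfloor> \<le> m" "- m \<le> \<lfloor>t / e\<rfloor>" unfolding m_def by linarith+
    thus ?thesis by simp
  qed
  show ?thesis
    unfolding congruent_expansions_bound_def
  proof (intro exI[of _ "card cells"] allI impI)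
    fix l :: nat and g B :: int and Y :: "int poly set"
    assume fin: "finite Y" and small: "\<forall>y\<in>Y. \<forall>i. \<bar>coeff y i\<bar> \<le> M"
      and len: "\<forall>y\<in>Y. \<forall>i\<ge>l. coeff y i = 0" and inj: "inj_on (\<lambda>y. ipoly y \<beta>) Y"
      and g: "\<bar>coeff f 0\<bar> ^ l \<le> g" "g dvd poly f B" and dvd: "\<forall>y\<in>Y. \<forall>y'\<in>Y. g dvd poly (y - y') B"
    have sub: "cell l ` Y \<subseteq> cells"
    proof
      fix x assume "x \<in> cell l ` Y"
      then obtain y where y: "y \<in> Y" and x: "x = cell l y" by auto
      have "(\<lfloor>Re (T l y $$ ij) / e\<rfloor>, \<lfloor>Im (T l y $$ ij) / e\<rfloor>) \<in> {-m..m} \<times> {-m..m}"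
        if ij: "ij \<in> {..<d} \<times> {..<d}" for ij
      proof -
        have "norm (T l y $$ ij) \<le> R" using bound[of "fst ij" "snd ij" y l] small y ij by auto
        thus ?thesis using abs_Re_le_cmod[of "T l y $$ ij"] abs_Im_le_cmod[of "T l y $$ ij"]
          by (intro SigmaI floor_range) linarith+
      qed
      thus "x \<in> cells" unfolding x cells_def cell_def by (auto intro!: restrict_PiE)
    qed
    have "inj_on (cell l) Y"
    proof (rule inj_onI)
      fix y y' assume y: "y \<in> Y" "y' \<in> Y" and eq: "cell l y = cell l y'"
      define w where "w = y - y'"
      have lenw: "\<forall>i\<ge>l. coeff w i = 0" using len y by (simp add: w_def)
      have close: "norm (T l w $$ (i, j)) \<le> 2 * e" if ij: "i < d" "j < d" for i j
      proof -
        have Tw: "T l w $$ (i, j) = T l y $$ (i, j) - T l y' $$ (i, j)"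
          using ij by (simp add: T_def w_def sum_subtractf algebra_simps)
        have "cell l y (i, j) = cell l y' (i, j)" using eq by simp
        hence fl: "\<lfloor>Re (T l y $$ (i, j)) / e\<rfloor> = \<lfloor>Re (T l y' $$ (i, j)) / e\<rfloor>"
          "\<lfloor>Im (T l y $$ (i, j)) / e\<rfloor> = \<lfloor>Im (T l y' $$ (i, j)) / e\<rfloor>"
          using ij by (auto simp: cell_def)
        have floor_close: "\<bar>s - t\<bar> \<le> e" if "\<lfloor>s / e\<rfloor> = \<lfloor>t / e\<rfloor>" for s t
        proof -
          have "\<bar>s / e - t / e\<bar> \<le> 1" using that by linarith
          hence "\<bar>(s - t) / e\<bar> \<le> 1" by (simp add: diff_divide_distrib)
          thus ?thesis using e by (simp add: abs_divide)
        qed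
        have "norm (T l w $$ (i, j)) \<le> \<bar>Re (T l w $$ (i, j))\<bar> + \<bar>Im (T l w $$ (i, j))\<bar>"
          by (rule cmod_le)
        also have "\<dots> \<le> e + e"
          unfolding Tw using floor_close[OF fl(1)] floor_close[OF fl(2)] by (intro add_mono) simp_all
        finally show ?thesis by simp
      qed
      have "norm (det (T l w)) \<le> fact d * (2 * e) ^ d" by (rule norm_det_le[OF T close])
      also have "(2 * e) ^ d \<le> (2 * e) ^ 1"
      proof (rule power_decreasing)
        have "(1::real) \<le> fact d" by (rule fact_ge_1)
        thus "2 * e \<le> 1" unfolding e_def by (subst times_divide_eq_right, subst divide_le_eq_1_pos) linarith+
      qed (use degree_pos e in auto)
      hence "fact d * (2 * e) ^ d \<le> fact d * (2 * e)" by (intro mult_left_mono) auto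
      also have "\<dots> < 1" by (simp add: e_def)
      finally have detT: "norm (det (T l w)) < 1" .
      have "of_int (det (poly_companion f w)) = det (C ^\<^sub>m l * T l w)"
        unfolding factor[OF lenw, symmetric] by (simp add: of_int_hom.hom_det)
      also have "\<dots> = det C ^ l * det (T l w)"
        using det_mult[OF Ck T] det_mat_pow[OF C] by simp
      finally have "norm (of_int (det (poly_companion f w)) :: complex) = norm (det C) ^ l * norm (det (T l w))"
        by (simp only: norm_mult norm_power)
      also have "norm (det C) = of_int \<bar>coeff f 0\<bar>"
        using abs_det_companion[OF degree_pos] by (simp add: C_def of_int_hom.hom_det)
      finally have "real_of_int \<bar>det (poly_companion f w)\<bar> = of_int (\<bar>coeff f 0\<bar> ^ l) * norm (det (T l w))"
        by simp
      also have "\<dots> < of_int (\<bar>coeff f 0\<bar> ^ l) * 1"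
        using detT coeff_f_0_nonzero by (intro mult_strict_left_mono) auto
      finally have "\<bar>det (poly_companion f w)\<bar> < g" using g(1) by linarith
      moreover have "g dvd det (poly_companion f w)"
        using dvd_det_poly_companion[OF g(2)] dvd y by (simp add: w_def)
      ultimately have "det (poly_companion f w) = 0"
        using dvd_imp_le_int[of "det (poly_companion f w)" g] by linarith
      hence "ipoly w \<beta> = 0" by (rule det_poly_companion_eq_0)
      hence "ipoly y \<beta> = ipoly y' \<beta>" by (simp add: w_def ipoly_simps)
      thus "y = y'" using inj y by (auto dest: inj_onD)
    qed
    thus "card Y \<le> card cells" using sub fin_cells by (rule card_inj_on_le)
  qed
qed

end

section \<open>Roots and orders modulo powers of the digit count\<close>

text \<open>The congruence class of 0 modulo \<open>q\<close> is lifted. The derivative at \<open>B\<close> stays congruent to the linear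
coefficient modulo \<open>q\<close>, so it stays invertible; \<open>q\<close> may be composite.\<close>

lemma hensel_root:
  fixes f :: "int poly" and q :: int
  assumes "q dvd coeff f 0" and "coprime (coeff f 1) q"
  shows "\<exists>B. q dvd B \<and> q ^ Suc k dvd poly f B"
proof (induction k)
  case 0
  show ?case using assms by (intro exI[of _ 0]) (simp add: poly_0_coeff_0)
next
  case (Suc k)
  then obtain B where B: "q dvd B" and "q ^ Suc k dvd poly f B" by blast
  then obtain m where m: "poly f B = q ^ Suc k * m" by (auto elim: dvdE)
  have qf': "q dvd poly (pderiv f) B - coeff f 1"
  proof -
    have "B dvd poly (pderiv f) B - coeff (pderiv f) 0" by (cases "pderiv f") simp
    thus ?thesis using B by (simp add: coeff_pderiv) (metis dvd_trans)
  qed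
  have "coprime (poly (pderiv f) B) q"
  proof -
    obtain c where "poly (pderiv f) B = coeff f 1 + q * c" using qf' by (metis dvdE diff_eq_eq add.commute)
    moreover have "gcd (coeff f 1 + q * c) q = gcd (coeff f 1) q"
      using gcd_add_mult[of q c "coeff f 1"] by (simp add: gcd.commute algebra_simps)
    ultimately show ?thesis using assms(2) by (simp add: coprime_iff_gcd_eq_1)
  qed
  \<comment> \<open>The Newton correction: \<open>m + f'(B) t\<close> must vanish modulo \<open>q\<close>.\<close>
  then obtain t where t: "[poly (pderiv f) B * t = - m] (mod q)"
    using cong_solve_coprime_int by (metis cong_scalar_right mult.assoc mult_1 mult.left_commute)
  define B' where "B' = B + q ^ Suc k * t"
  obtain c where c: "poly f (B + q ^ Suc k * t) = poly f B + poly (pderiv f) B * (q ^ Suc k * t) + (q ^ Suc k * t)^2 * c"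
  proof -
    have "\<exists>c. poly f (B + e) = poly f B + poly (pderiv f) B * e + e^2 * c" for e
    proof (induction f)
      case 0 thus ?case by auto
    next
      case (pCons a p)
      then obtain c where c: "poly p (B + e) = poly p B + poly (pderiv p) B * e + e^2 * c" by auto
      show ?case
        by (rule exI[of _ "poly (pderiv p) B + B * c + e * c"], simp add: c pderiv_pCons)
           (simp add: algebra_simps power2_eq_square)
    qed
    thus ?thesis using that by blast
  qed
  have "poly f B' = q ^ Suc k * (m + poly (pderiv f) B * t) + q ^ Suc k * (q ^ Suc k * (t^2 * c))"
    unfolding B'_def c m by (simp add: algebra_simps power2_eq_square)
  moreover have "q dvd m + poly (pderiv f) B * t"
    using t by (metis add.commute cong_iff_dvd_diff diff_minus_eq_add)
  hence "q ^ Suc (Suc k) dvd q ^ Suc k * (m + poly (pderiv f) B * t)"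
    by (metis dvd_refl mult_dvd_mono power_Suc2)
  moreover have "q ^ Suc (Suc k) dvd q ^ Suc k * (q ^ Suc k * (t^2 * c))"
    by (simp add: mult.assoc[symmetric] power_Suc2 del: power_Suc) 
  ultimately have "q ^ Suc (Suc k) dvd poly f B'" by simp
  moreover have "q dvd B'" using B by (simp add: B'_def)
  ultimately show ?case by blast
qed

text \<open>Lifting the exponent: as \<open>A\<close> is 1 modulo \<open>p\<^sup>2\<close>, a geometric sum of \<open>m\<close> terms is congruent to \<open>m\<close>
modulo \<open>p\<^sup>2\<close>. Splitting off blocks of \<open>p\<close> terms removes exactly one factor \<open>p\<close> from both the sum and
the number of terms. Working modulo \<open>p\<^sup>2\<close> instead of \<open>p\<close> treats \<open>p = 2\<close> uniformly.\<close>

lemma prime_power_dvd_geometric_sum: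
  fixes A :: int and p :: nat
  assumes "prime p" and "int p ^ 2 dvd A - 1" and "int p ^ j dvd (\<Sum>i<n. A ^ i)"
  shows "p ^ j dvd n"
  using assms
proof (induction n arbitrary: A j rule: less_induct)
  case (less n)
  have A1: "[A = 1] (mod int p ^ 2)" using less.prems(2) by (simp add: cong_iff_dvd_diff)
  have sum_cong: "[(\<Sum>i<m. A ^ i) = int m] (mod int p ^ 2)" for m
  proof -
    have "[(\<Sum>i<m. A ^ i) = (\<Sum>i<m. 1)] (mod int p ^ 2)"
      by (intro cong_sum) (use cong_pow[OF A1] in simp)
    thus ?thesis by simp
  qed
  show ?case
  proof (cases "j = 0 \<or> n = 0")
    case True thus ?thesis by auto
  next
    case False
    have "int p dvd (\<Sum>i<n. A ^ i)"
      using less.prems(3) False by (meson dvd_power dvd_trans gr0I)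
    moreover have "int p dvd (\<Sum>i<n. A ^ i) - int n"
      using sum_cong[of n] unfolding cong_iff_dvd_diff
      by (meson dvd_power dvd_trans zero_less_numeral)
    ultimately have "int p dvd (\<Sum>i<n. A ^ i) - ((\<Sum>i<n. A ^ i) - int n)" by (rule dvd_diff)
    hence "int p dvd int n" by simp
    hence "p dvd n" by simp
    then obtain n' where n': "n = p * n'" by (elim dvdE)
    have p2: "p \<ge> 2" using less.prems(1) prime_ge_2_nat by blast
    have n'less: "n' < n" using n' p2 False by simp
    obtain c where c: "(\<Sum>i<p. A ^ i) = int p + int p ^ 2 * c"
      using sum_cong[of p] by (metis cong_iff_lin cong_sym)
    have split: "(\<Sum>i<n. A ^ i) = (\<Sum>i<p. A ^ i) * (\<Sum>i<n'. (A ^ p) ^ i)"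
    proof -
      have "(\<Sum>i<p * m. A ^ i) = (\<Sum>i<p. A ^ i) * (\<Sum>i<m. (A ^ p) ^ i)" for m
      proof (induction m)
        case (Suc m)
        have "(\<Sum>i<p * Suc m. A ^ i) = (\<Sum>i<p * m. A ^ i) + (\<Sum>i=p*m..<p*m+p. A ^ i)"
          using sum.atLeastLessThan_concat[of 0 "p*m" "p*m+p" "\<lambda>i. A ^ i"]
          by (simp add: atLeast0LessThan algebra_simps)
        also have "(\<Sum>i=p*m..<p*m+p. A ^ i) = (\<Sum>i<p. A ^ (i + p * m))"
          using sum.shift_bounds_nat_ivl[of "\<lambda>i. A ^ i" 0 "p*m" p] by (simp add: atLeast0LessThan add.commute)
        also have "\<dots> = (\<Sum>i<p. A ^ i) * (A ^ p) ^ m"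
          by (simp add: power_add power_mult sum_distrib_right)
        finally show ?case using Suc.IH by (simp add: algebra_simps)
      qed simp
      thus ?thesis by (simp add: n')
    qed
    obtain j' where j': "j = Suc j'" using False by (cases j) auto
    have "int p * int p ^ j' dvd int p * ((1 + int p * c) * (\<Sum>i<n'. (A ^ p) ^ i))"
      using less.prems(3) unfolding split c j' by (simp add: algebra_simps power2_eq_square)
    hence "int p ^ j' dvd (1 + int p * c) * (\<Sum>i<n'. (A ^ p) ^ i)"
      using p2 by (subst (asm) dvd_mult_cancel_left) auto
    moreover have "coprime (int p) (1 + int p * c)"
      using gcd_add_mult[of "int p" c 1] by (simp add: coprime_iff_gcd_eq_1 algebra_simps)
    hence "coprime (int p ^ j') (1 + int p * c)" by simp
    ultimately have "int p ^ j' dvd (\<Sum>i<n'. (A ^ p) ^ i)"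
      using coprime_dvd_mult_right_iff by blast
    moreover have "int p ^ 2 dvd A ^ p - 1"
      using cong_pow[OF A1, of p] by (simp add: cong_iff_dvd_diff)
    ultimately have "p ^ j' dvd n'" using less.IH[OF n'less less.prems(1)] by blast
    thus ?thesis by (simp add: n' j' mult_dvd_mono)
  qed
qed

text \<open>Since \<open>A ^ e - 1\<close> is \<open>A - 1\<close> times a geometric sum of \<open>e\<close> terms, the part of \<open>q ^ k\<close> that does not divide
\<open>A - 1\<close> divides the sum, and then \<open>e\<close>, prime by prime.\<close>

lemma order_modulo_prime_power_quotient:
  fixes A :: int and q :: nat
  assumes q: "q > 0" and A: "int q ^ 2 dvd A - 1" and e: "int q ^ k dvd A ^ e - 1"
  shows "q ^ k div nat (gcd (A - 1) (int q ^ k)) dvd e"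
proof -
  define g where "g = gcd (A - 1) (int q ^ k)"
  have g: "g > 0" using q by (simp add: g_def)
  define r where "r = int q ^ k div g"
  have r: "int q ^ k = g * r" by (simp add: r_def g_def)
  define s where "s = (A - 1) div g"
  have s: "A - 1 = g * s" by (simp add: s_def g_def)
  have cop: "coprime r s"
    unfolding r_def s_def g_def using q
    by (subst coprime_commute, intro div_gcd_coprime) auto
  have "A ^ e - 1 = (A - 1) * (\<Sum>i<e. A ^ i)" by (simp add: power_diff_1_eq)
  hence "g * r dvd g * (s * (\<Sum>i<e. A ^ i))" using e by (simp add: r s mult.assoc)
  hence "r dvd s * (\<Sum>i<e. A ^ i)" using g by simp
  hence rdvd: "r dvd (\<Sum>i<e. A ^ i)" using cop by (simp add: coprime_dvd_mult_right_iff)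
  have rpos: "r > 0" using r g q by (metis zero_less_mult_pos zero_less_power of_nat_0_less_iff)
  define r' where "r' = nat r"
  have r': "r = int r'" "r' > 0" using rpos by (auto simp: r'_def)
  have "r' dvd e"
  proof (cases "e = 0")
    case False
    show ?thesis
    proof (rule multiplicity_le_imp_dvd)
      show "r' \<noteq> 0" using r' by simp
      fix p :: nat assume p: "prime p"
      show "multiplicity p r' \<le> multiplicity p e"
      proof (cases "multiplicity p r' = 0")
        case False': False
        have dr: "p ^ multiplicity p r' dvd r'" by (rule multiplicity_dvd)
        have "p dvd r'" using dr False' by (meson dvd_power dvd_trans gr0I)
        hence "int p dvd int q ^ k" using r r' by (metis dvd_mult of_nat_dvd_iff)
        hence "p dvd q" using p by (metis of_nat_dvd_iff of_nat_power prime_dvd_power)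
        hence "int p ^ 2 dvd int q ^ 2" by (metis dvd_power_same of_nat_dvd_iff)
        hence "int p ^ 2 dvd A - 1" using A by (rule dvd_trans)
        moreover have "int p ^ multiplicity p r' dvd (\<Sum>i<e. A ^ i)"
          using dr rdvd r' by (metis dvd_trans of_nat_dvd_iff of_nat_power)
        ultimately have "p ^ multiplicity p r' dvd e"
          using prime_power_dvd_geometric_sum[OF p] by blast
        thus ?thesis using \<open>e \<noteq> 0\<close> p by (intro multiplicity_geI) (auto simp: prime_gt_1_nat)
      qed simp
    qed
  qed simp
  moreover have "q ^ k div nat g = r'"
    using g by (simp add: r'_def r_def nat_div_distrib nat_power_eq)
  ultimately show ?thesis by (simp add: g_def)
qed

section \<open>Canonical number systems\<close>

text \<open>That \<open>q\<close> is the absolute value of the constant coefficient of \<open>f\<close> is a consequence of unique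
representability (\<open>q_eq\<close>).\<close>

locale cns_generator = integral_generator +
  fixes q :: nat
  assumes digits_eq: "digits \<beta> = {..<q}" and cns: "canonical_number_system \<beta>"
begin

abbreviation int_digits :: "nat poly \<Rightarrow> int poly" where
  "int_digits p \<equiv> map_poly int p"

lemma coeff_int_digits [simp]: "coeff (int_digits p) i = int (coeff p i)"
  by (simp add: coeff_map_poly)

lemma int_digits_pCons: "int_digits (pCons a p) = pCons (int a) (int_digits p)"
  by (intro poly_eqI) (simp add: coeff_pCons split: nat.splits)

lemma ipoly_int_digits: "ipoly (int_digits p) \<beta> = (\<Sum>j\<le>degree p. of_nat (coeff p j) * \<beta> ^ j)"
  using ipoly_altdef[of "int_digits p" "Suc (degree p)" \<beta>] degree_map_poly_le[of int p]
  by (simp add: lessThan_Suc_atMost)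

lemma is_radix_expansion_iff:
  assumes "q > 0"
  shows "is_radix_expansion \<beta> \<gamma> p \<longleftrightarrow> (\<forall>j. coeff p j < q) \<and> \<gamma> = ipoly (int_digits p) \<beta>"
proof -
  have "(\<forall>j\<le>degree p. coeff p j < q) \<longleftrightarrow> (\<forall>j. coeff p j < q)"
    using assms coeff_eq_0[of p] by (metis not_le)
  thus ?thesis
    unfolding is_radix_expansion_def digits_eq ipoly_int_digits by simp
qed

lemma q_pos: "q > 0"
proof -
  have "\<exists>!p. is_radix_expansion \<beta> 0 p"
    using cns by (simp add: canonical_number_system_def ring_of_integers_def)
  then obtain p where "is_radix_expansion \<beta> 0 p" by blast
  hence "coeff p 0 \<in> {..<q}" unfolding is_radix_expansion_def digits_eq by blast
  thus ?thesis by auto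
qed

lemma expansion_exists:
  assumes "algebraic_int x"
  obtains p where "\<And>j. coeff p j < q" "x = ipoly (int_digits p) \<beta>"
    "is_radix_expansion \<beta> x p" "radix_expansion \<beta> x = p"
proof -
  have ex1: "\<exists>!p. is_radix_expansion \<beta> x p"
    using cns assms by (simp add: canonical_number_system_def ring_of_integers_def)
  hence "is_radix_expansion \<beta> x (radix_expansion \<beta> x)"
    unfolding radix_expansion_def by (rule theI')
  thus ?thesis using that is_radix_expansion_iff[OF q_pos] by blast
qed

lemma algebraic_int_iff: "algebraic_int x \<longleftrightarrow> (\<exists>h. x = ipoly h \<beta>)"
  using algebraic_int_ipoly expansion_exists by metis

lemma expansion_unique:
  assumes "\<And>j. coeff p j < q" "\<And>j. coeff p' j < q"
    and "ipoly (int_digits p) \<beta> = ipoly (int_digits p') \<beta>"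
  shows "p = p'"
proof -
  define x where "x = ipoly (int_digits p) \<beta>"
  have "\<exists>!p. is_radix_expansion \<beta> x p"
    using cns algebraic_int_ipoly
    by (simp add: canonical_number_system_def ring_of_integers_def x_def)
  moreover have "is_radix_expansion \<beta> x p" "is_radix_expansion \<beta> x p'"
    using assms by (auto simp: is_radix_expansion_iff[OF q_pos] x_def)
  ultimately show ?thesis by blast
qed

lemma q_ge_2: "q \<ge> 2"
proof (rule ccontr)
  assume "\<not> q \<ge> 2"
  have "algebraic_int (1 :: 'a)" by simp
  then obtain p where p: "\<And>j. coeff p j < q" "1 = ipoly (int_digits p) \<beta>"
    by (rule expansion_exists) blast
  have "coeff p j = 0" for j using p(1)[of j] \<open>\<not> q \<ge> 2\<close> by linarith
  hence "p = 0" by (simp add: poly_eq_iff)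
  thus False using p(2) by simp
qed

text \<open>In \<open>\<int>[X]/(f)\<close> the quotient by \<open>X\<close> is \<open>\<int>\<close> modulo the constant coefficient of \<open>f\<close>.\<close>

lemma dvd_of_int_iff: "(\<exists>h. of_int m = \<beta> * ipoly h \<beta>) \<longleftrightarrow> coeff f 0 dvd m"
proof
  assume "\<exists>h. of_int m = \<beta> * ipoly h \<beta>"
  then obtain h where "ipoly [:m:] \<beta> = ipoly (pCons 0 h) \<beta>" by (auto simp: ipoly_simps)
  hence "f dvd [:m:] - pCons 0 h" by (simp only: ipoly_eq_iff)
  then obtain g where g: "[:m:] - pCons 0 h = f * g" by (elim dvdE)
  have "m = coeff ([:m:] - pCons 0 h) 0" by simp
  also have "\<dots> = coeff f 0 * coeff g 0" unfolding g by (simp add: coeff_mult_0)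
  finally show "coeff f 0 dvd m" by simp
next
  assume "coeff f 0 dvd m"
  then obtain c where c: "m = coeff f 0 * c" by (elim dvdE)
  obtain a f' where f': "f = pCons a f'" by (cases f)
  have "0 = of_int (coeff f 0) + \<beta> * ipoly f' \<beta>"
    using ipoly_f by (simp add: f' ipoly_simps)
  hence "of_int (coeff f 0) = \<beta> * ipoly (- f') \<beta>"
    by (simp add: ipoly_simps eq_neg_iff_add_eq_0)
  hence "of_int m = \<beta> * ipoly (Polynomial.smult c (- f')) \<beta>"
    by (simp add: c ipoly_simps algebra_simps)
  thus "\<exists>h. of_int m = \<beta> * ipoly h \<beta>" by blast
qed

text \<open>The digits form a complete system of residues modulo \<open>\<beta>\<close>. They represent \<open>q\<close> itself, which gives one
inequality. If there were more digits than residues, the digit equal to the absolute constant coefficient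
would be a multiple of \<open>\<beta>\<close> and have a second expansion with lowest digit 0.\<close>

lemma q_eq: "int q = \<bar>coeff f 0\<bar>"
proof (rule antisym)
  have f0: "coeff f 0 \<noteq> 0"
  proof
    assume "coeff f 0 = 0"
    then obtain f' where f': "f = pCons 0 f'" by (metis coeff_pCons_0 pCons_cases)
    hence "\<beta> * ipoly f' \<beta> = 0" using ipoly_f by (simp add: ipoly_simps)
    moreover have "\<not> f dvd f'"
      using f' f_nonzero by (auto dest!: dvd_imp_degree_le simp: degree_pCons_eq_if split: if_splits)
    ultimately have "\<beta> = 0" by (simp add: ipoly_eq_0_iff)
    hence "ipoly (int_digits [:0, 1:]) \<beta> = ipoly (int_digits 0) \<beta>"
      by (simp add: int_digits_pCons)
    hence "[:0, 1:] = (0 :: nat poly)"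
      using q_ge_2 by (intro expansion_unique) (auto simp: coeff_pCons split: nat.splits)
    thus False by simp
  qed
  show "\<bar>coeff f 0\<bar> \<le> int q"
  proof (rule ccontr)
    assume "\<not> \<bar>coeff f 0\<bar> \<le> int q"
    obtain p where p: "\<And>j. coeff p j < q" "of_int (int q) = ipoly (int_digits p) \<beta>"
      using expansion_exists[OF algebraic_int_ipoly[of "[:int q:]"]] by (auto simp: ipoly_simps)
    obtain a p' where p': "p = pCons a p'" by (cases p)
    have "a < q" using p(1)[of 0] by (simp add: p')
    have "of_int (int q - int a) = \<beta> * ipoly (int_digits p') \<beta>"
      using p(2) by (simp add: p' int_digits_pCons ipoly_simps algebra_simps)
    hence "coeff f 0 dvd int q - int a" using dvd_of_int_iff by blast
    hence "\<bar>coeff f 0\<bar> \<le> \<bar>int q - int a\<bar>" using \<open>a < q\<close> by (intro dvd_imp_le_int) auto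
    thus False using \<open>\<not> \<bar>coeff f 0\<bar> \<le> int q\<close> \<open>a < q\<close> by linarith
  qed
  show "int q \<le> \<bar>coeff f 0\<bar>"
  proof (rule ccontr)
    assume less: "\<not> int q \<le> \<bar>coeff f 0\<bar>"
    define c where "c = nat \<bar>coeff f 0\<bar>"
    have c: "c < q" "int c = \<bar>coeff f 0\<bar>" "c > 0" using less f0 by (auto simp: c_def)
    have "coeff f 0 dvd int c" by (simp add: c(2))
    then obtain h where h: "of_int (int c) = \<beta> * ipoly h \<beta>" using dvd_of_int_iff by blast
    obtain p where p: "\<And>j. coeff p j < q" "ipoly h \<beta> = ipoly (int_digits p) \<beta>"
      using expansion_exists[OF algebraic_int_ipoly[of h]] by blast
    have "ipoly (int_digits [:c:]) \<beta> = ipoly (int_digits (pCons 0 p)) \<beta>"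
      using h p(2) by (simp add: int_digits_pCons ipoly_simps)
    hence "[:c:] = pCons 0 p"
      using p(1) c q_pos by (intro expansion_unique) (auto simp: coeff_pCons split: nat.splits)
    thus False using c by simp
  qed
qed

lemma conjugates_outside_unit_disc:
  assumes "ipoly f (\<mu>::complex) = 0"
  shows "norm \<mu> > 1"
proof (rule conjugate_root_outside_unit_disc[OF assms, of "int q"])
  show "\<bar>coeff f 0\<bar> \<noteq> 1" using q_eq q_ge_2 by linarith
  fix n :: nat
  obtain p where "\<And>j. coeff p j < q" "ipoly [:int n:] \<beta> = ipoly (int_digits p) \<beta>"
    using expansion_exists[OF algebraic_int_ipoly[of "[:int n:]"]] by blast
  thus "\<exists>h. (\<forall>i. \<bar>coeff h i\<bar> \<le> int q) \<and> ipoly h \<beta> = of_nat n"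
    by (intro exI[of _ "int_digits p"]) (auto simp: ipoly_simps less_imp_le)
qed

sublocale expanding_generator \<beta> f
  by unfold_locales (rule conjugates_outside_unit_disc)

end

section \<open>Powers with a missing digit\<close>

lemma card_le_card_image_mult_fiber:
  assumes "finite S" "finite T" "\<Phi> ` S \<subseteq> T"
    and "\<And>t. t \<in> T \<Longrightarrow> card {x \<in> S. \<Phi> x = t} \<le> K"
  shows "card S \<le> card T * K"
proof -
  have "S = (\<Union>t\<in>T. {x \<in> S. \<Phi> x = t})" using assms(3) by auto
  hence "card S \<le> (\<Sum>t\<in>T. card {x \<in> S. \<Phi> x = t})"
    using card_UN_le[OF assms(2)] by metis
  also have "\<dots> \<le> card T * K" using sum_bounded_above[of T _ K] assms(4) by simp
  finally show ?thesis .
qed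

lemma power_totient_cong_1_int:
  fixes a :: int and m :: nat
  assumes "m > 1" "coprime a (int m)"
  shows "[a ^ totient m = 1] (mod int m)"
  using residues.euler_theorem[of "int m" a] assms by (simp add: residues_def)

text \<open>The choice of the window of digits. Here \<open>q ^ k div g k\<close> is a lower bound for the order of a power of
\<open>\<alpha>\<close> modulo \<open>\<beta> ^ k\<close>. It grows by a factor of at most \<open>q\<close> from one \<open>k\<close> to the next, so the first
value above \<open>N\<close> is at most \<open>q * N\<close>; another factor \<open>q\<close> is lost in rounding \<open>g k\<close> down to a power of \<open>q\<close>.\<close>

lemma geometric_order_scale:
  fixes q N Hm :: nat and g :: "nat \<Rightarrow> nat"
  assumes q: "q \<ge> 2" and N: "N \<ge> 1" and gdvd: "\<And>k. g k dvd q ^ k" and gmono: "\<And>k. g k dvd g (Suc k)"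
    and gK: "g K \<le> Hm" and K: "q ^ K > N * Hm"
  obtains k l where "k \<le> K" "l \<le> k" "q ^ l \<le> g k" "N < q ^ k div g k" "q ^ (k - l) \<le> q ^ 2 * N"
proof -
  have gpos: "g k > 0" for k using q by (intro dvd_pos_nat[OF _ gdvd[of k]]) simp
  define r where "r k = q ^ k div g k" for k
  have r: "r k * g k = q ^ k" for k using gdvd[of k] by (simp add: r_def)
  have "N * g K \<le> N * Hm" using gK by simp
  hence "N * g K < r K * g K" using K r[of K] by linarith
  hence rK: "N < r K" by simp
  define k where "k = (LEAST k. N < r k)"
  have k: "N < r k" unfolding k_def by (rule LeastI[of _ K]) (rule rK)
  have kK: "k \<le> K" unfolding k_def by (rule Least_le) (rule rK)
  have "r 0 \<le> 1" using r[of 0] by simp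
  hence "k \<noteq> 0" using k N by (intro notI) simp
  then obtain k' where k': "k = Suc k'" by (cases k) auto
  have rk': "r k' \<le> N" using not_less_Least[of k' "\<lambda>k. N < r k"] k' by (simp add: k_def)
  have "r k * g k' \<le> r k * g k" using gmono[of k'] gpos[of k] k' by (simp add: dvd_imp_le)
  also have "\<dots> = q * (r k' * g k')" by (simp add: r k')
  finally have "r k * g k' \<le> (q * r k') * g k'" by (simp add: mult.assoc)
  hence rk: "r k \<le> q * r k'" using gpos[of k'] by simp
  define l where "l = Max {l. l \<le> k \<and> q ^ l \<le> g k}"
  have fin: "finite {l. l \<le> k \<and> q ^ l \<le> g k}" by simp
  have ne: "0 \<in> {l. l \<le> k \<and> q ^ l \<le> g k}" using gpos[of k] by (simp add: Suc_le_eq)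
  have l: "l \<le> k" "q ^ l \<le> g k" using Max_in[OF fin] ne unfolding l_def by blast+
  have gk: "g k \<le> q ^ Suc l"
  proof (cases "l = k")
    case True
    have "g k \<le> q ^ k" using gdvd[of k] q by (intro dvd_imp_le) auto
    also have "\<dots> \<le> q ^ Suc l" using True q by simp
    finally show ?thesis .
  next
    case False
    show ?thesis
    proof (rule ccontr)
      assume "\<not> g k \<le> q ^ Suc l"
      hence "Suc l \<in> {l. l \<le> k \<and> q ^ l \<le> g k}" using l False by simp
      hence "Suc l \<le> l" unfolding l_def by (rule Max_ge[OF fin])
      thus False by simp
    qed
  qed
  have "q ^ (k - l) * q ^ l = r k * g k" using l(1) r[of k] by (simp add: power_add[symmetric])
  also have "\<dots> \<le> r k * q ^ Suc l" using gk by (rule mult_le_mono2)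
  also have "\<dots> \<le> q * r k' * q ^ Suc l" using rk by (rule mult_le_mono1)
  also have "\<dots> \<le> q * N * q ^ Suc l" using rk' by simp
  also have "\<dots> = q ^ 2 * N * q ^ l" by (simp add: power2_eq_square)
  finally have "q ^ (k - l) \<le> q ^ 2 * N" using q by simp
  thus ?thesis using that[of k l] kK l k by (simp add: r_def)
qed

context cns_generator
begin

definition low_digits :: "nat \<Rightarrow> nat poly \<Rightarrow> int poly" where
  "low_digits l p = (\<Sum>i<l. monom (int (coeff p i)) i)"

lemma coeff_low_digits: "coeff (low_digits l p) i = (if i < l then int (coeff p i) else 0)"
  by (simp add: low_digits_def coeff_sum)

lemma poly_low_digits: "poly (low_digits l p) x = (\<Sum>i<l. int (coeff p i) * x ^ i)"
  by (simp add: low_digits_def poly_sum poly_monom)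

text \<open>Positions from \<open>k\<close> on do not contribute because \<open>q\<close> divides \<open>B\<close>.\<close>

lemma poly_int_digits_cong:
  assumes B: "int q dvd B" and "l \<le> k"
  shows "[poly (int_digits p) B = poly (low_digits l p) B + (\<Sum>i=l..<k. int (coeff p i) * B ^ i)] (mod int q ^ k)"
proof -
  define L where "L = max k (Suc (degree p))"
  have "degree (int_digits p) < L"
    using degree_map_poly_le[of int p] by (simp add: L_def less_Suc_eq_le le_max_iff_disj max.strict_coboundedI2)
  hence "poly (int_digits p) B = (\<Sum>i<L. int (coeff p i) * B ^ i)"
    by (simp add: poly_int_altdef)
  also have "{..<L} = {..<k} \<union> {k..<L}" by (auto simp: L_def)
  also have "(\<Sum>i\<in>{..<k} \<union> {k..<L}. int (coeff p i) * B ^ i) =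
      (\<Sum>i<k. int (coeff p i) * B ^ i) + (\<Sum>i=k..<L. int (coeff p i) * B ^ i)"
    by (rule sum.union_disjoint) auto
  also have "[\<dots> = (\<Sum>i<k. int (coeff p i) * B ^ i) + 0] (mod int q ^ k)"
  proof (intro cong_add cong_refl)
    have "int q ^ k dvd (\<Sum>i=k..<L. int (coeff p i) * B ^ i)"
    proof (intro dvd_sum dvd_mult)
      fix i assume "i \<in> {k..<L}"
      hence "int q ^ k dvd int q ^ i" by (simp add: le_imp_power_dvd)
      also have "\<dots> dvd B ^ i" using B by (rule dvd_power_same)
      finally show "int q ^ k dvd B ^ i" .
    qed
    thus "[(\<Sum>i=k..<L. int (coeff p i) * B ^ i) = 0] (mod int q ^ k)" by (simp add: cong_0_iff)
  qed
  also have "(\<Sum>i<k. int (coeff p i) * B ^ i) + 0 = poly (low_digits l p) B + (\<Sum>i=l..<k. int (coeff p i) * B ^ i)"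
    using assms(2) by (simp add: poly_low_digits lessThan_atLeast0 sum.atLeastLessThan_concat)
  finally show ?thesis .
qed

lemma ipoly_low_digits_inj:
  assumes "\<And>j. coeff p j < q" "\<And>j. coeff p' j < q"
    and "ipoly (low_digits l p) \<beta> = ipoly (low_digits l p') \<beta>"
  shows "low_digits l p = low_digits l p'"
proof -
  define cut where "cut p = (\<Sum>i<l. monom (coeff p i) i)" for p :: "nat poly"
  have cut: "coeff (cut p) i = (if i < l then coeff p i else 0)" for p i
    by (simp add: cut_def coeff_sum)
  have low: "int_digits (cut p) = low_digits l p" for p
    by (intro poly_eqI) (simp add: cut coeff_low_digits)
  have "cut p = cut p'"
    using assms q_pos by (intro expansion_unique) (auto simp: cut low)
  thus ?thesis by (metis low)
qed

definition survivors :: "nat \<Rightarrow> 'a \<Rightarrow> nat \<Rightarrow> nat set" where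
  "survivors b \<alpha> N = {n \<in> {1..N}. \<forall>j\<le>degree (radix_expansion \<beta> (\<alpha> ^ n)).
     coeff (radix_expansion \<beta> (\<alpha> ^ n)) j \<noteq> b}"

text \<open>The survivors are sorted by \<open>n mod D\<close> and by their digits in the window from \<open>l\<close> to \<open>k - 1\<close>. In each
class the lower \<open>l\<close> digits are pairwise different, as they determine \<open>a ^ n\<close> modulo \<open>q ^ k\<close> and hence \<open>n\<close>,
and they are congruent modulo \<open>g k\<close>, so there are at most \<open>K\<close> of them.\<close>

lemma card_survivors_le:
  assumes c1: "coprime (coeff f 1) (int q)"
    and K: "congruent_expansions_bound (int q) K"
    and h: "\<alpha> = ipoly h \<beta>" "coprime (coeff h 0) (int q)"
    and \<alpha>: "\<And>k. k > 0 \<Longrightarrow> \<alpha> ^ k \<noteq> 1" and b: "b \<ge> 1" "b < q" and N: "N \<ge> 1"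
  obtains t where "q ^ t \<le> q ^ 2 * N"
    "card (survivors b \<alpha> N) \<le> totient (q ^ 2) * (q - 1) ^ t * K"
proof -
  define D where "D = totient (q ^ 2)"
  have q2: "q ^ 2 > 1" using q_ge_2 by (intro one_less_power) auto
  have D: "D > 0" using q_pos by (simp add: D_def)
  \<comment> \<open>The common divisors of \<open>A - 1\<close> and \<open>f(B)\<close> divide the norm of \<open>\<alpha> ^ D - 1\<close>, which is not 0. So they stay bounded and the orders grow.\<close>
  define Hm where "Hm = nat \<bar>det (poly_companion f (h ^ D - 1))\<bar>"
  have Hm: "Hm > 0"
  proof -
    have "ipoly (h ^ D - 1) \<beta> \<noteq> 0" using \<alpha>[OF D] h(1) by (simp add: ipoly_simps)
    thus ?thesis using det_poly_companion_eq_0 by (auto simp: Hm_def)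
  qed
  define K0 where "K0 = N * Hm"
  have "K0 < 2 ^ K0" by (rule less_exp)
  also have "\<dots> \<le> q ^ K0" using q_ge_2 by (intro power_mono) auto
  finally have K0: "N * Hm < q ^ K0" by (simp add: K0_def)
  obtain B where B: "int q dvd B" "int q ^ Suc K0 dvd poly f B"
    using hensel_root[OF _ c1, of K0] q_eq by auto
  hence fB: "int q ^ K0 dvd poly f B" by (meson dvd_trans le_imp_power_dvd lessI less_imp_le_nat)
  define a where "a = poly h B"
  have "int q dvd a - coeff h 0"
    unfolding a_def using dvd_minus_coeff_0[of B h] B(1) by (rule dvd_trans[rotated])
  hence "[a = coeff h 0] (mod int q)" by (simp add: cong_iff_dvd_diff)
  hence aq: "coprime a (int q)" using h(2) cong_imp_coprime cong_sym by metis
  define A where "A = a ^ D"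
  have "[A = 1] (mod int (q ^ 2))"
    unfolding A_def D_def using q2 aq by (intro power_totient_cong_1_int) auto
  hence A: "int q ^ 2 dvd A - 1" by (simp add: cong_iff_dvd_diff)
  define g where "g k = nat (gcd (A - 1) (int q ^ k))" for k
  have int_g: "int (g k) = gcd (A - 1) (int q ^ k)" for k by (simp add: g_def)
  have gdvd: "g k dvd q ^ k" for k
  proof -
    have "int (g k) dvd int (q ^ k)" by (simp add: int_g)
    thus ?thesis by (simp only: of_nat_dvd_iff)
  qed
  have gmono: "g k dvd g (Suc k)" for k
  proof -
    have "gcd (A - 1) (int q ^ k) dvd gcd (A - 1) (int q ^ Suc k)"
      by (intro gcd_greatest gcd_dvd1 dvd_trans[OF gcd_dvd2]) simp
    hence "int (g k) dvd int (g (Suc k))" by (simp only: int_g)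
    thus ?thesis by (simp only: of_nat_dvd_iff)
  qed
  have gK: "g K0 \<le> Hm"
  proof -
    have "int (g K0) dvd int q ^ K0" by (simp add: int_g)
    hence "int (g K0) dvd poly f B" using fB by (rule dvd_trans)
    moreover have "int (g K0) dvd poly (h ^ D - 1) B"
      by (simp add: int_g A_def a_def)
    ultimately have "int (g K0) dvd det (poly_companion f (h ^ D - 1))"
      by (rule dvd_det_poly_companion)
    hence "int (g K0) dvd int Hm" by (simp add: Hm_def)
    thus ?thesis using Hm by (simp add: dvd_imp_le)
  qed
  obtain k l where kl: "k \<le> K0" "l \<le> k" "q ^ l \<le> g k" "N < q ^ k div g k" "q ^ (k - l) \<le> q ^ 2 * N"
    by (rule geometric_order_scale[OF q_ge_2 N gdvd gmono gK K0]) blast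
  have ord: "e = 0 \<or> N < e" if "int q ^ k dvd A ^ e - 1" for e
  proof -
    have "q ^ k div g k dvd e"
      using order_modulo_prime_power_quotient[OF q_pos A that] by (simp add: g_def)
    thus ?thesis using kl(4) dvd_imp_le[of "q ^ k div g k" e] by linarith
  qed
  define p where "p n = radix_expansion \<beta> (\<alpha> ^ n)" for n
  have p: "coeff (p n) j < q" "\<alpha> ^ n = ipoly (int_digits (p n)) \<beta>" for n j
  proof -
    have "algebraic_int (\<alpha> ^ n)" using algebraic_int_ipoly[of "h ^ n"] by (simp add: h(1) ipoly_simps)
    then obtain p' where "\<And>j. coeff p' j < q" "\<alpha> ^ n = ipoly (int_digits p') \<beta>" "radix_expansion \<beta> (\<alpha> ^ n) = p'"
      by (rule expansion_exists) blast
    thus "coeff (p n) j < q" "\<alpha> ^ n = ipoly (int_digits (p n)) \<beta>" by (simp_all add: p_def)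
  qed
  define Z where "Z n = (\<Sum>i=l..<k. int (coeff (p n) i) * B ^ i)" for n
  have a_pow: "[a ^ n = poly (low_digits l (p n)) B + Z n] (mod int q ^ k)" for n
  proof -
    have "ipoly (h ^ n) \<beta> = ipoly (int_digits (p n)) \<beta>"
      using p(2)[of n] by (simp add: h(1) ipoly_simps)
    hence "f dvd h ^ n - int_digits (p n)" by (simp only: ipoly_eq_iff)
    then obtain u where "h ^ n - int_digits (p n) = f * u" by (elim dvdE)
    hence "poly (h ^ n - int_digits (p n)) B = poly f B * poly u B" by (simp only: poly_mult)
    hence "int q ^ K0 dvd a ^ n - poly (int_digits (p n)) B"
      using fB by (simp add: a_def)
    hence "int q ^ k dvd a ^ n - poly (int_digits (p n)) B"
      using kl(1) by (meson dvd_trans le_imp_power_dvd)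
    hence "[a ^ n = poly (int_digits (p n)) B] (mod int q ^ k)" by (simp add: cong_iff_dvd_diff)
    also have "[poly (int_digits (p n)) B = poly (low_digits l (p n)) B + Z n] (mod int q ^ k)"
      unfolding Z_def by (rule poly_int_digits_cong[OF B(1) kl(2)])
    finally show ?thesis .
  qed
  define S where "S = survivors b \<alpha> N"
  have S: "finite S" "\<And>n. n \<in> S \<Longrightarrow> 1 \<le> n \<and> n \<le> N" "\<And>n j. n \<in> S \<Longrightarrow> coeff (p n) j \<noteq> b"
  proof -
    show "finite S" "\<And>n. n \<in> S \<Longrightarrow> 1 \<le> n \<and> n \<le> N" by (auto simp: S_def survivors_def)
    fix n j assume "n \<in> S"
    thus "coeff (p n) j \<noteq> b"
      \<comment> \<open>Beyond the top position the coefficient is 0, which differs from \<open>b\<close>.\<close>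
      using b(1) coeff_eq_0[of "p n" j] by (cases "j \<le> degree (p n)") (auto simp: S_def survivors_def p_def)
  qed
  define \<Phi> where "\<Phi> n = (n mod D, \<lambda>j\<in>{l..<k}. coeff (p n) j)" for n
  define T where "T = {..<D} \<times> ({l..<k} \<rightarrow>\<^sub>E ({..<q} - {b}))"
  have fib: "card {n \<in> S. \<Phi> n = \<tau>} \<le> K" for \<tau>
  proof -
    define F where "F = {n \<in> S. \<Phi> n = \<tau>}"
    have F: "n \<in> S" "n mod D = m mod D" "Z n = Z m" if "n \<in> F" "m \<in> F" for n m
    proof -
      show "n \<in> S" "n mod D = m mod D" using that by (auto simp: F_def \<Phi>_def)
      have "(\<lambda>j\<in>{l..<k}. coeff (p n) j) = (\<lambda>j\<in>{l..<k}. coeff (p m) j)"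
        using that by (auto simp: F_def \<Phi>_def)
      hence "coeff (p n) j = coeff (p m) j" if "j \<in> {l..<k}" for j
        using that by (metis restrict_apply')
      thus "Z n = Z m" unfolding Z_def by (intro sum.cong) auto
    qed
    have eqI: "n = m" if nm: "n \<in> F" "m \<in> F" "m \<le> n" and low: "low_digits l (p n) = low_digits l (p m)" for n m
    proof -
      have "D dvd n - m" using F(2)[OF nm(1,2)] nm(3) by (metis mod_eq_dvd_iff_nat)
      then obtain e where e: "n = m + D * e" using nm(3) by (metis dvdE le_add_diff_inverse)
      have "[a ^ n = a ^ m] (mod int q ^ k)"
        using cong_trans[OF a_pow[of n]] cong_sym[OF a_pow[of m]] F(3)[OF nm(1,2)] low by metis
      hence "int q ^ k dvd a ^ m * (A ^ e - 1)"
        by (simp add: cong_iff_dvd_diff e A_def power_add power_mult algebra_simps)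
      moreover have "coprime (int q ^ k) (a ^ m)" using aq by (simp add: coprime_commute)
      ultimately have "int q ^ k dvd A ^ e - 1" by (simp add: coprime_dvd_mult_right_iff)
      hence "e = 0 \<or> N < e" by (rule ord)
      moreover have "e \<le> n" using D e by (simp add: trans_le_add2)
      hence "e \<le> N" using S(2) F(1)[OF nm(1,1)] by (meson le_trans)
      ultimately show "n = m" using e by simp
    qed
    define Y where "Y = (\<lambda>n. low_digits l (p n)) ` F"
    have "inj_on (\<lambda>n. low_digits l (p n)) F"
    proof (rule inj_onI)
      fix n m assume "n \<in> F" "m \<in> F" "low_digits l (p n) = low_digits l (p m)"
      thus "n = m" using eqI[of n m] eqI[of m n] by (cases "m \<le> n") auto
    qed
    hence "card F = card Y" by (simp add: Y_def card_image)
    also have "card Y \<le> K"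
    proof (rule congruent_expansions_boundD[OF K])
      show "finite Y" using S(1) by (simp add: Y_def F_def)
      show "\<forall>y\<in>Y. \<forall>i. \<bar>coeff y i\<bar> \<le> int q"
        using p(1) by (auto simp: Y_def coeff_low_digits less_imp_le)
      show "\<forall>y\<in>Y. \<forall>i\<ge>l. coeff y i = 0" by (auto simp: Y_def coeff_low_digits)
      show "inj_on (\<lambda>y. ipoly y \<beta>) Y"
        unfolding Y_def using ipoly_low_digits_inj[OF p(1) p(1)] by (intro inj_onI) blast
      show "\<bar>coeff f 0\<bar> ^ l \<le> int (g k)" using kl(3) by (simp flip: q_eq of_nat_power)
      have gq: "int (g k) dvd int q ^ k" by (simp add: int_g)
      show "int (g k) dvd poly f B"
        using gq fB kl(1) by (meson dvd_trans le_imp_power_dvd)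
      have "int (g k) dvd poly (low_digits l (p n)) B - poly (low_digits l (p m)) B"
        if nm: "n \<in> F" "m \<in> F" for n m
      proof -
        have pw: "[a ^ n = a ^ (n mod D)] (mod int (g k))" for n
        proof -
          have "[A = 1] (mod int (g k))" by (simp add: cong_iff_dvd_diff int_g)
          hence "[a ^ (n mod D) * A ^ (n div D) = a ^ (n mod D) * 1 ^ (n div D)] (mod int (g k))"
            by (intro cong_mult cong_pow cong_refl)
          moreover have "a ^ (n mod D) * A ^ (n div D) = a ^ n"
            by (simp add: A_def power_mult[symmetric] power_add[symmetric] mult.commute)
          ultimately show ?thesis by simp
        qed
        have aP: "[a ^ n = poly (low_digits l (p n)) B + Z n] (mod int (g k))" for n
          using a_pow gq by (rule cong_dvd_modulus)
        have "[poly (low_digits l (p n)) B + Z n = poly (low_digits l (p m)) B + Z n] (mod int (g k))"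
          using aP[of n] aP[of m] pw[of n] pw[of m] F(2,3)[OF nm] by (metis cong_sym cong_trans)
        hence "[poly (low_digits l (p n)) B = poly (low_digits l (p m)) B] (mod int (g k))"
          by (simp add: cong_add_rcancel)
        thus ?thesis by (simp add: cong_iff_dvd_diff)
      qed
      thus "\<forall>y\<in>Y. \<forall>y'\<in>Y. int (g k) dvd poly (y - y') B" by (auto simp: Y_def)
    qed
    finally show ?thesis by (simp add: F_def)
  qed
  have "card S \<le> card T * K"
  proof (rule card_le_card_image_mult_fiber)
    have "\<Phi> n \<in> T" if "n \<in> S" for n
      using D p(1)[of n] S(3)[OF that] by (simp add: \<Phi>_def T_def restrict_PiE_iff)
    thus "\<Phi> ` S \<subseteq> T" by blast
    show "finite T" by (auto simp: T_def intro!: finite_PiE)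
  qed (use S(1) fib in auto)
  also have "card T = D * (q - 1) ^ (k - l)"
    using b by (simp add: T_def card_cartesian_product card_PiE)
  finally show ?thesis using that[of "k - l"] kl(5) by (simp add: S_def D_def)
qed

lemma power_le_powr_sigma:
  assumes "q ^ t \<le> q ^ 2 * N" "N \<ge> 1"
  shows "real ((q - 1) ^ t) \<le> real (q - 1) ^ 2 * real N powr (ln (real q - 1) / ln (real q))"
proof -
  define s where "s = ln (real q - 1) / ln (real q)"
  have q: "real q \<ge> 2" using q_ge_2 by simp
  have s0: "s \<ge> 0" using q by (simp add: s_def)
  have qs: "real q powr s = real (q - 1)"
    using q q_ge_2 by (simp add: s_def powr_def of_nat_diff)
  have pw: "(real q powr s) ^ m = (real q ^ m) powr s" for m
    by (induction m) (simp_all add: powr_mult)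
  have "real ((q - 1) ^ t) = (real q powr s) ^ t" by (simp add: qs)
  also have "\<dots> = (real q ^ t) powr s" by (rule pw)
  also have "\<dots> \<le> (real q ^ 2 * real N) powr s"
  proof (rule powr_mono2[OF s0])
    have "real (q ^ t) \<le> real (q ^ 2 * N)" using assms(1) by (rule of_nat_mono)
    thus "real q ^ t \<le> real q ^ 2 * real N" by simp
  qed simp
  also have "\<dots> = (real q powr s) ^ 2 * real N powr s"
    unfolding pw by (simp add: powr_mult)
  finally show ?thesis unfolding qs unfolding s_def .
qed

end

section \<open>Ideals of a monogenic ring of integers\<close>

text \<open>Products over lists are convenient in the inductive construction of a factorization, whereas valuations are
defined by products of powers over finite sets.\<close>

lemma (in comm_monoid) foldr_mult_eq_finprod:
  assumes "set xs \<subseteq> carrier G"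
  shows "foldr (\<otimes>) xs \<one> = (\<Otimes>x\<in>set xs. x [^] count_list xs x)"
  using assms
proof (induction xs)
  case (Cons x xs)
  define A where "A = set xs - {x}"
  have A: "finite A" "x \<notin> A" and carr: "x \<in> carrier G" "A \<subseteq> carrier G" using Cons.prems by (auto simp: A_def)
  have IH: "foldr (\<otimes>) xs \<one> = x [^] count_list xs x \<otimes> (\<Otimes>y\<in>A. y [^] count_list xs y)"
  proof (cases "x \<in> set xs")
    case True
    hence "set xs = insert x A" by (auto simp: A_def)
    thus ?thesis using Cons A carr by (simp add: Pi_def subset_iff)
  next
    case False
    hence "set xs = A" by (auto simp: A_def)
    thus ?thesis using Cons False carr by (simp add: Pi_def subset_iff count_list_0_iff)
  qed
  have "(\<Otimes>y\<in>set (x # xs). y [^] count_list (x # xs) y) = (\<Otimes>y\<in>insert x A. y [^] count_list (x # xs) y)"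
    by (intro arg_cong[where f = "finprod G _"]) (auto simp: A_def)
  also have "\<dots> = x [^] Suc (count_list xs x) \<otimes> (\<Otimes>y\<in>A. y [^] count_list (x # xs) y)"
    using A carr by (subst finprod_insert) (auto simp: Pi_def subset_iff)
  also have "(\<Otimes>y\<in>A. y [^] count_list (x # xs) y) = (\<Otimes>y\<in>A. y [^] count_list xs y)"
    using A carr by (intro finprod_cong') (auto simp: Pi_def subset_iff)
  also have "x [^] Suc (count_list xs x) \<otimes> (\<Otimes>y\<in>A. y [^] count_list xs y) = x \<otimes> foldr (\<otimes>) xs \<one>"
  proof -
    have "(\<Otimes>y\<in>A. y [^] count_list xs y) \<in> carrier G" using carr by (intro finprod_closed) auto
    thus ?thesis unfolding IH using carr by (simp add: m_assoc[symmetric] m_comm)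
  qed
  finally show ?case by simp
qed simp

locale monogenic_integers = integral_generator +
  assumes algebraic_int_iff: "algebraic_int x \<longleftrightarrow> (\<exists>h. x = ipoly h \<beta>)"
begin

abbreviation OK :: "'a set" where "OK \<equiv> {x. algebraic_int x}"

abbreviation prod_ideal :: "'a set \<Rightarrow> 'a set \<Rightarrow> 'a set" (infixl \<open>\<star>\<close> 70) where
  "I \<star> J \<equiv> ideal_prod \<O> I J"

lemma ring_of_integers_simps [simp]:
  "carrier (\<O> :: 'a ring) = OK" "mult (\<O> :: 'a ring) = (*)" "one (\<O> :: 'a ring) = 1"
  "zero (\<O> :: 'a ring) = 0" "add (\<O> :: 'a ring) = (+)"
  by (simp_all add: ring_of_integers_def)

lemma OK_closed [intro]:
  assumes "x \<in> OK" "y \<in> OK"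
  shows "x + y \<in> OK" "x - y \<in> OK" "x * y \<in> OK"
proof -
  obtain g h where gh: "x = ipoly g \<beta>" "y = ipoly h \<beta>" using assms by (auto simp: algebraic_int_iff)
  show "x + y \<in> OK" "x - y \<in> OK" "x * y \<in> OK"
    using algebraic_int_ipoly[of "g + h"] algebraic_int_ipoly[of "g - h"] algebraic_int_ipoly[of "g * h"]
    by (simp_all add: gh ipoly_simps)
qed

lemma OK_power: "x \<in> OK \<Longrightarrow> x ^ n \<in> OK"
  by (induction n) (use OK_closed(3) in auto)

lemma OK_of_int: "of_int m \<in> OK" and OK_of_nat: "of_nat n \<in> OK"
  by (auto intro: int_imp_algebraic_int)

lemma cring_OK: "cring (\<O> :: 'a ring)"
proof (rule cringI)
  show "abelian_group (\<O> :: 'a ring)"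
  proof (rule abelian_groupI)
    fix x :: 'a assume "x \<in> carrier \<O>"
    thus "\<exists>y\<in>carrier \<O>. y \<oplus>\<^bsub>\<O>\<^esub> x = \<zero>\<^bsub>\<O>\<^esub>" by (intro bexI[of _ "- x"]) auto
  qed (use OK_closed in \<open>auto simp: algebra_simps\<close>)
  show "comm_monoid (\<O> :: 'a ring)"
    by (rule comm_monoidI) (use OK_closed in \<open>auto simp: algebra_simps\<close>)
qed (auto simp: algebra_simps)

interpretation O: cring "\<O> :: 'a ring" by (rule cring_OK)

lemma a_inv_OK: "x \<in> OK \<Longrightarrow> a_inv (\<O> :: 'a ring) x = - x"
  using O.minus_equality[of "- x" x] by simp

lemma ideal_OK_I:
  assumes "I \<subseteq> OK" "0 \<in> I" "\<And>x y. x \<in> I \<Longrightarrow> y \<in> I \<Longrightarrow> x + y \<in> I"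
    and "\<And>r x. r \<in> OK \<Longrightarrow> x \<in> I \<Longrightarrow> r * x \<in> I"
  shows "ideal I (\<O> :: 'a ring)"
proof (rule idealI)
  show "ring (\<O> :: 'a ring)" by (rule O.ring_axioms)
  show "subgroup I (add_monoid (\<O> :: 'a ring))"
  proof
    fix x assume x: "x \<in> I"
    have "- x = (-1) * x" by simp
    also have "\<dots> \<in> I" using x assms(4)[of "-1" x] by auto
    finally show "inv\<^bsub>add_monoid (\<O> :: 'a ring)\<^esub> x \<in> I"
      using a_inv_OK[of x] x assms(1) by (auto simp: a_inv_def)
  qed (use assms in auto)
next
  fix a x :: 'a assume "a \<in> I" "x \<in> carrier \<O>"
  thus "x \<otimes>\<^bsub>\<O>\<^esub> a \<in> I" "a \<otimes>\<^bsub>\<O>\<^esub> x \<in> I"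
    using assms(4)[of x a] by (simp_all add: mult.commute)
qed

lemma ideal_OK_D:
  assumes "ideal I (\<O> :: 'a ring)"
  shows "I \<subseteq> OK" "0 \<in> I" "\<And>x y. x \<in> I \<Longrightarrow> y \<in> I \<Longrightarrow> x + y \<in> I"
    "\<And>r x. r \<in> OK \<Longrightarrow> x \<in> I \<Longrightarrow> r * x \<in> I" "\<And>x y. x \<in> I \<Longrightarrow> y \<in> I \<Longrightarrow> x - y \<in> I"
proof -
  interpret I: ideal I \<O> by (rule assms)
  show sub: "I \<subseteq> OK" using I.a_subset by simp
  show "0 \<in> I" using I.zero_closed by simp
  show add: "x + y \<in> I" if "x \<in> I" "y \<in> I" for x y using I.a_closed that by simp
  show mult: "r * x \<in> I" if "r \<in> OK" "x \<in> I" for r x using I.I_l_closed that by simp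
  show "x - y \<in> I" if "x \<in> I" "y \<in> I" for x y
    using add[OF that(1) mult[of "-1" y]] that by simp
qed

lemma prod_ideal_least:
  assumes "ideal K (\<O> :: 'a ring)" "\<And>i j. i \<in> I \<Longrightarrow> j \<in> J \<Longrightarrow> i * j \<in> K"
  shows "I \<star> J \<subseteq> K"
proof
  fix x assume "x \<in> I \<star> J"
  thus "x \<in> K" by induction (use assms ideal_OK_D(3) in auto)
qed

lemma prod_ideal_mem: "i \<in> I \<Longrightarrow> j \<in> J \<Longrightarrow> i * j \<in> I \<star> J"
  using ideal_prod.prod[of i I j J "\<O> :: 'a ring"] by simp

lemma prod_ideal_ideal: "ideal I (\<O> :: 'a ring) \<Longrightarrow> ideal J (\<O> :: 'a ring) \<Longrightarrow> ideal (I \<star> J) (\<O> :: 'a ring)"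
  by (rule O.ideal_prod_is_ideal)

lemma prod_ideal_mono:
  assumes "ideal I' (\<O> :: 'a ring)" "ideal J' (\<O> :: 'a ring)" "I \<subseteq> I'" "J \<subseteq> J'"
  shows "I \<star> J \<subseteq> I' \<star> J'"
  using assms by (intro prod_ideal_least prod_ideal_ideal) (auto intro: prod_ideal_mem)

lemma ideal_OK: "ideal OK (\<O> :: 'a ring)"
  using O.oneideal by simp

lemma OK_if_one: "ideal I (\<O> :: 'a ring) \<Longrightarrow> 1 \<in> I \<Longrightarrow> I = OK"
  using ideal_OK_D(1)[of I] ideal_OK_D(4)[of I _ 1] by auto

lemma principal_ideal: "PIdl\<^bsub>\<O>\<^esub> x = (\<lambda>r. x * r) ` OK" for x :: 'a
  by (auto simp: cgenideal_def mult.commute)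

lemma ideal_principal: "x \<in> OK \<Longrightarrow> ideal (PIdl\<^bsub>\<O>\<^esub> x) (\<O> :: 'a ring)" for x :: 'a
  by (rule O.cgenideal_ideal) simp

lemma prod_principal:
  assumes I: "ideal I (\<O> :: 'a ring)" and x: "x \<in> OK"
  shows "PIdl\<^bsub>\<O>\<^esub> x \<star> I = (\<lambda>r. x * r) ` I"
proof
  have "ideal ((\<lambda>r. x * r) ` I) (\<O> :: 'a ring)"
  proof (rule ideal_OK_I)
    show "(\<lambda>r. x * r) ` I \<subseteq> OK" using ideal_OK_D(1)[OF I] x OK_closed(3) by blast
    show "0 \<in> (\<lambda>r. x * r) ` I" using ideal_OK_D(2)[OF I] by force
    fix a b assume "a \<in> (\<lambda>r. x * r) ` I" "b \<in> (\<lambda>r. x * r) ` I"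
    thus "a + b \<in> (\<lambda>r. x * r) ` I" using ideal_OK_D(3)[OF I] by (auto simp: distrib_left[symmetric])
  next
    fix r a assume "r \<in> OK" "a \<in> (\<lambda>r. x * r) ` I"
    thus "r * a \<in> (\<lambda>r. x * r) ` I" using ideal_OK_D(4)[OF I] by (auto simp: mult.left_commute)
  qed
  thus "PIdl\<^bsub>\<O>\<^esub> x \<star> I \<subseteq> (\<lambda>r. x * r) ` I"
  proof (rule prod_ideal_least)
    fix i j assume "i \<in> PIdl\<^bsub>\<O>\<^esub> x" "j \<in> I"
    thus "i * j \<in> (\<lambda>r. x * r) ` I" using ideal_OK_D(4)[OF I] by (auto simp: principal_ideal mult.assoc)
  qed
  have "x \<in> PIdl\<^bsub>\<O>\<^esub> x" unfolding principal_ideal by (rule image_eqI[of _ _ 1]) auto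
  thus "(\<lambda>r. x * r) ` I \<subseteq> PIdl\<^bsub>\<O>\<^esub> x \<star> I" by (auto intro: prod_ideal_mem)
qed

definition ideal_adjoin :: "'a set \<Rightarrow> 'a \<Rightarrow> 'a set" where
  "ideal_adjoin I x = {i + r * x | i r. i \<in> I \<and> r \<in> OK}"

lemma ideal_adjoin_props:
  assumes I: "ideal I (\<O> :: 'a ring)" and x: "x \<in> OK"
  shows "ideal (ideal_adjoin I x) (\<O> :: 'a ring)" "I \<subseteq> ideal_adjoin I x" "x \<in> ideal_adjoin I x"
proof -
  note D = ideal_OK_D[OF I]
  have memI: "i + r * x \<in> ideal_adjoin I x" if "i \<in> I" "r \<in> OK" for i r
    using that unfolding ideal_adjoin_def by blast
  show "I \<subseteq> ideal_adjoin I x" using memI[of _ 0] by auto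
  show "x \<in> ideal_adjoin I x" using memI[OF D(2), of 1] by simp
  show "ideal (ideal_adjoin I x) (\<O> :: 'a ring)"
  proof (rule ideal_OK_I)
    show "ideal_adjoin I x \<subseteq> OK"
      unfolding ideal_adjoin_def using D(1) OK_closed(1,3) x by blast
    show "0 \<in> ideal_adjoin I x" using memI[OF D(2), of 0] by simp
    fix a b assume "a \<in> ideal_adjoin I x" "b \<in> ideal_adjoin I x"
    then obtain i r i' r' where "a = i + r * x" "i \<in> I" "r \<in> OK" "b = i' + r' * x" "i' \<in> I" "r' \<in> OK"
      unfolding ideal_adjoin_def by blast
    thus "a + b \<in> ideal_adjoin I x"
      using memI[of "i + i'" "r + r'"] D(3) OK_closed(1)[of r r'] by (simp add: algebra_simps)
  next
    fix s a assume "s \<in> OK" "a \<in> ideal_adjoin I x"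
    then obtain i r where "a = i + r * x" "i \<in> I" "r \<in> OK"
      unfolding ideal_adjoin_def by blast
    hence "s * i + s * r * x \<in> ideal_adjoin I x"
      using \<open>s \<in> OK\<close> D(4) OK_closed(3) by (intro memI) blast+
    moreover have "s * a = s * i + s * r * x" by (simp add: \<open>a = i + r * x\<close> algebra_simps)
    ultimately show "s * a \<in> ideal_adjoin I x" by simp
  qed
qed

text \<open>Read off from the first row of the matrix of multiplication by \<open>x\<close>.\<close>

lemma integer_combination:
  assumes "x \<in> OK"
  obtains c where "x = (\<Sum>j<degree f. of_int (c j) * \<beta> ^ j)"
proof -
  obtain h where h: "x = ipoly h \<beta>" using assms by (auto simp: algebraic_int_iff)
  obtain u where "(\<Sum>j<degree f. of_int (poly_companion f h $$ (0, j)) * \<beta> ^ j) = ipoly h \<beta> * \<beta> ^ 0 + ipoly f \<beta> * u"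
    using poly_companion_row[OF monic degree_pos] by blast
  thus ?thesis using that[of "\<lambda>j. poly_companion f h $$ (0, j)"] by (simp add: h ipoly_f)
qed

lemma finite_residues:
  assumes "p > 0"
  obtains Box :: "'a set" where "finite Box" "Box \<subseteq> OK"
    "\<And>x. x \<in> OK \<Longrightarrow> \<exists>r\<in>Box. \<exists>y\<in>OK. x = r + of_nat p * y"
proof
  define val where "val c = (\<Sum>j<degree f. of_int (c j) * \<beta> ^ j)" for c :: "nat \<Rightarrow> int"
  have val: "val c \<in> OK" for c
  proof -
    have "val c = ipoly (\<Sum>j<degree f. monom (c j) j) \<beta>"
      by (simp add: val_def of_int_poly_hom.hom_sum poly_sum map_poly_monom poly_monom)
    thus ?thesis using algebraic_int_ipoly by simp
  qed
  define Box where "Box = val ` ({..<degree f} \<rightarrow>\<^sub>E {0..<int p})"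
  show "finite Box" by (auto simp: Box_def intro!: finite_PiE)
  show "Box \<subseteq> OK" using val by (auto simp: Box_def)
  fix x :: 'a assume "x \<in> OK"
  then obtain c where c: "x = val c" unfolding val_def by (rule integer_combination)
  define r where "r = (\<lambda>j\<in>{..<degree f}. c j mod int p)"
  have "r \<in> {..<degree f} \<rightarrow>\<^sub>E {0..<int p}" using assms by (auto simp: r_def)
  hence "val r \<in> Box" by (simp add: Box_def)
  moreover have "x = val r + of_nat p * val (\<lambda>j. c j div int p)"
  proof -
    have "of_int (c j) = (of_int (c j mod int p) + of_nat p * of_int (c j div int p) :: 'a)" for j
    proof -
      have "of_int (c j) = (of_int (c j mod int p + int p * (c j div int p)) :: 'a)" by simp
      thus ?thesis by (simp only: of_int_add of_int_mult of_int_of_nat_eq)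
    qed
    hence "x = (\<Sum>j<degree f. (of_int (c j mod int p) + of_nat p * of_int (c j div int p)) * \<beta> ^ j)"
      unfolding c val_def by (intro sum.cong refl) (simp only:)
    also have "\<dots> = val r + of_nat p * val (\<lambda>j. c j div int p)"
      by (simp add: val_def r_def distrib_right sum.distrib sum_distrib_left mult.assoc)
    finally show ?thesis .
  qed
  ultimately show "\<exists>r\<in>Box. \<exists>y\<in>OK. x = r + of_nat p * y" using val by blast
qed

lemma congruent_pair_in_sequence:
  fixes s :: "nat \<Rightarrow> 'a"
  assumes "p > 0" "\<And>n. s n \<in> OK"
  obtains i j y where "i < j" "y \<in> OK" "s j - s i = of_nat p * y"
proof -
  obtain Box :: "'a set" where Box: "finite Box" "\<And>x. x \<in> OK \<Longrightarrow> \<exists>r\<in>Box. \<exists>y\<in>OK. x = r + of_nat p * y"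
    using finite_residues[OF assms(1)] by metis
  have "\<forall>n. \<exists>r y. r \<in> Box \<and> y \<in> OK \<and> s n = r + of_nat p * y" using Box(2) assms(2) by blast
  then obtain r y where ry: "\<And>n. r n \<in> Box" "\<And>n. y n \<in> OK" "\<And>n. s n = r n + of_nat p * y n"
    by metis
  have "\<not> inj r"
  proof
    assume "inj r"
    moreover have "finite (range r)" using ry(1) Box(1) by (meson finite_subset image_subsetI)
    ultimately show False using finite_imageD by blast
  qed
  then obtain i j where "r i = r j" "i \<noteq> j" by (auto simp: inj_def)
  then obtain i j where ij: "r i = r j" "i < j" by (metis linorder_neqE_nat)
  show ?thesis
  proof (rule that[OF ij(2)])
    show "y j - y i \<in> OK" using ry(2) OK_closed(2) by blast
    show "s j - s i = of_nat p * (y j - y i)" using ij(1) by (simp add: ry(3) algebra_simps)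
  qed
qed

text \<open>By pigeonhole two powers of \<open>x\<close> differ by an integral element, so \<open>x\<close> is a root of a monic integer
polynomial up to an integral constant. This replaces the determinant trick for finitely generated modules.\<close>

lemma bounded_denominator_imp_integral:
  assumes p: "p > 0" and "\<And>n. of_nat p * x ^ n \<in> OK"
  shows "x \<in> OK"
proof -
  obtain i j y where ij: "i < j" and y: "y \<in> OK" and eq: "of_nat p * x ^ j - of_nat p * x ^ i = of_nat p * y"
    using congruent_pair_in_sequence[OF p, of "\<lambda>n. of_nat p * x ^ n"] assms(2) by metis
  have "of_nat p * (x ^ j - x ^ i) = of_nat p * y" using eq by (simp add: algebra_simps)
  hence xy: "x ^ j - x ^ i = y" using p by simp
  have deg: "degree (monom 1 j - monom 1 i :: 'a poly) = j"
    using ij degree_add_eq_left[of "- monom 1 i :: 'a poly" "monom 1 j"] by (simp add: degree_monom_eq)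
  have "algebraic_int x"
  proof (rule algebraic_int_root)
    show "algebraic_int y" using y by simp
    show "poly (monom 1 j - monom 1 i) x = y" by (simp add: poly_monom xy)
    show "lead_coeff (monom 1 j - monom 1 i :: 'a poly) = 1" using ij by (simp add: deg)
    show "degree (monom 1 j - monom 1 i :: 'a poly) > 0" using ij by (simp add: deg)
  qed (auto simp: coeff_monom)
  thus ?thesis by simp
qed

text \<open>The multiplier ring of an ideal that contains \<open>p\<close> is the ring of integers. All failures of an ideal to be
invertible are refuted by this.\<close>

lemma multiplier_is_integral:
  assumes p: "p > 0" and I: "ideal I (\<O> :: 'a ring)" "of_nat p \<in> I"
    and x: "\<And>i. i \<in> I \<Longrightarrow> x * i \<in> I"
  shows "x \<in> OK"
proof (rule bounded_denominator_imp_integral[OF p])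
  fix n
  have "x ^ n * of_nat p \<in> I" by (induction n) (use I x in \<open>auto simp: mult.assoc\<close>)
  thus "of_nat p * x ^ n \<in> OK" using ideal_OK_D(1)[OF I(1)] by (auto simp: mult.commute)
qed

text \<open>The ascending chain condition above \<open>(p)\<close>: such an ideal is determined by its intersection with a finite
system of residues modulo \<open>p\<close>.\<close>

lemma ideal_ascending_induct [consumes 3, case_names step]:
  assumes p: "p > 0" and "ideal I (\<O> :: 'a ring)" "of_nat p \<in> I"
    and step: "\<And>I. ideal I (\<O> :: 'a ring) \<Longrightarrow> of_nat p \<in> I \<Longrightarrow>
      (\<And>J. ideal J (\<O> :: 'a ring) \<Longrightarrow> I \<subset> J \<Longrightarrow> P J) \<Longrightarrow> P I"
  shows "P I"
proof -
  obtain Box :: "'a set" where Box: "finite Box" "\<And>x. x \<in> OK \<Longrightarrow> \<exists>r\<in>Box. \<exists>y\<in>OK. x = r + of_nat p * y"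
    using finite_residues[OF p] by metis
  have less: "card (Box - J) < card (Box - I)"
    if I: "ideal I (\<O> :: 'a ring)" "of_nat p \<in> I" and J: "ideal J (\<O> :: 'a ring)" "I \<subset> J" for I J
  proof -
    obtain x where x: "x \<in> J" "x \<notin> I" using J by blast
    then obtain r y where ry: "r \<in> Box" "y \<in> OK" "x = r + of_nat p * y"
      using Box(2)[of x] ideal_OK_D(1)[OF J(1)] by blast
    have py: "of_nat p * y \<in> I" using ideal_OK_D(4)[OF I(1) ry(2) I(2)] by (simp add: mult.commute)
    have "r \<in> J" using ideal_OK_D(5)[OF J(1) x(1), of "of_nat p * y"] py J(2) ry(3) by auto
    moreover have "r \<notin> I" using ideal_OK_D(3)[OF I(1) _ py, of r] x(2) ry(3) by auto
    ultimately have "Box - J \<subset> Box - I" using ry(1) J(2) by blast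
    thus ?thesis using Box(1) by (intro psubset_card_mono) auto
  qed
  show ?thesis
    using assms(2,3)
  proof (induction "card (Box - I)" arbitrary: I rule: less_induct)
    case less: (less I)
    show ?case
    proof (rule step[OF less.prems])
      fix J :: "'a set" assume "ideal J \<O>" "I \<subset> J"
      thus "P J" using less.hyps[of J] \<open>\<And>I J. \<lbrakk>ideal I \<O>; of_nat p \<in> I; ideal J \<O>; I \<subset> J\<rbrakk> \<Longrightarrow> card (Box - J) < card (Box - I)\<close> less.prems by blast
    qed
  qed
qed

definition prime_over :: "nat \<Rightarrow> 'a set \<Rightarrow> bool" where
  "prime_over p M \<longleftrightarrow> primeideal M (\<O> :: 'a ring) \<and> of_nat p \<in> M"

lemma prime_over_D:
  assumes "prime_over p M"
  shows "ideal M (\<O> :: 'a ring)" "of_nat p \<in> M" "1 \<notin> M"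
    "\<And>x y. x \<in> OK \<Longrightarrow> y \<in> OK \<Longrightarrow> x * y \<in> M \<Longrightarrow> x \<in> M \<or> y \<in> M"
proof -
  interpret M: primeideal M \<O> using assms by (simp add: prime_over_def)
  show id: "ideal M (\<O> :: 'a ring)" by (rule M.ideal_axioms)
  show "of_nat p \<in> M" using assms by (simp add: prime_over_def)
  show "1 \<notin> M" using OK_if_one[OF id] M.I_notcarr by auto
  show "\<And>x y. x \<in> OK \<Longrightarrow> y \<in> OK \<Longrightarrow> x * y \<in> M \<Longrightarrow> x \<in> M \<or> y \<in> M"
    using M.I_prime by simp
qed

lemma not_prime_witness:
  assumes "ideal I (\<O> :: 'a ring)" "I \<noteq> OK" "\<not> primeideal I (\<O> :: 'a ring)"
  obtains x y where "x \<in> OK" "y \<in> OK" "x * y \<in> I" "x \<notin> I" "y \<notin> I"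
proof -
  have "\<not> (\<forall>x y. x \<in> OK \<longrightarrow> y \<in> OK \<longrightarrow> x * y \<in> I \<longrightarrow> x \<in> I \<or> y \<in> I)"
  proof
    assume *: "\<forall>x y. x \<in> OK \<longrightarrow> y \<in> OK \<longrightarrow> x * y \<in> I \<longrightarrow> x \<in> I \<or> y \<in> I"
    have "primeideal I (\<O> :: 'a ring)"
      by (rule primeidealI[OF assms(1) cring_OK]) (use * assms(2) in auto)
    thus False using assms(3) by blast
  qed
  thus ?thesis using that by blast
qed

text \<open>Powers of \<open>x\<close> repeat modulo \<open>p\<close>, so some positive power of \<open>x\<close> is 1 modulo \<open>M\<close>.\<close>

lemma prime_over_inverse_mod:
  assumes p: "p > 0" and M: "prime_over p M" and x: "x \<in> OK" "x \<notin> M"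
  obtains y where "y \<in> OK" "x * y - 1 \<in> M"
proof -
  note D = prime_over_D[OF M]
  obtain i j z where ij: "i < j" "z \<in> OK" "x ^ j - x ^ i = of_nat p * z"
    using congruent_pair_in_sequence[OF p, of "\<lambda>n. x ^ n"] OK_power[OF x(1)] by metis
  have xn: "x ^ n \<notin> M" for n
  proof (induction n)
    case 0 show ?case using D(3) by simp
  next
    case (Suc n) thus ?case using D(4)[of x "x ^ n"] x OK_power[of x n] by auto
  qed
  have "x ^ i * (x ^ (j - i) - 1) = x ^ j - x ^ i"
    using ij(1) by (simp add: algebra_simps power_add[symmetric])
  also have "\<dots> \<in> M" using ideal_OK_D(4)[OF D(1) ij(2) D(2)] by (simp add: ij(3) mult.commute)
  finally have "x ^ (j - i) - 1 \<in> M"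
    using D(4)[of "x ^ i" "x ^ (j - i) - 1"] xn[of i] OK_power[OF x(1)] OK_closed(2)[of "x ^ (j - i)" 1] by auto
  moreover have "x ^ (j - i) = x * x ^ (j - i - 1)" using ij(1) by (simp add: power_eq_if)
  ultimately show ?thesis using that[of "x ^ (j - i - 1)"] OK_power[OF x(1)] by simp
qed

lemma prime_over_maximal:
  assumes p: "p > 0" and M: "prime_over p M" and J: "ideal J (\<O> :: 'a ring)" "M \<subseteq> J" "1 \<notin> J"
  shows "J = M"
proof (rule ccontr)
  assume "J \<noteq> M"
  then obtain x where x: "x \<in> J" "x \<notin> M" using J by blast
  hence "x \<in> OK" using ideal_OK_D(1)[OF J(1)] by blast
  then obtain y where y: "y \<in> OK" "x * y - 1 \<in> M" using prime_over_inverse_mod[OF p M] x(2) by blast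
  have "y * x - (x * y - 1) \<in> J"
    using ideal_OK_D(4,5)[OF J(1)] x(1) y J(2) by blast
  thus False using J(3) by (simp add: mult.commute)
qed

lemma prime_over_eq:
  assumes "p > 0" "prime_over p M" "prime_over p M'" "M \<subseteq> M'"
  shows "M' = M"
  using prime_over_maximal[OF assms(1,2) prime_over_D(1)[OF assms(3)] assms(4) prime_over_D(3)[OF assms(3)]] .

section \<open>Factorization into prime ideals\<close>

interpretation G: comm_monoid "ideals_set (\<O> :: 'a ring)" by (rule O.ideals_set_is_comm_monoid)

lemma ideals_set_simps [simp]:
  "carrier (ideals_set (\<O> :: 'a ring)) = {I. ideal I \<O>}"
  "mult (ideals_set (\<O> :: 'a ring)) = ideal_prod \<O>" "one (ideals_set (\<O> :: 'a ring)) = OK"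
  by (simp_all add: ideals_set_def)

lemma prod_OK: "ideal I (\<O> :: 'a ring) \<Longrightarrow> I \<star> OK = I" "ideal I (\<O> :: 'a ring) \<Longrightarrow> OK \<star> I = I"
  using O.ideal_prod_one[of I] O.ideal_prod_commute[OF _ ideal_OK, of I] by simp_all

lemma prod_assoc:
  "ideal I (\<O> :: 'a ring) \<Longrightarrow> ideal J (\<O> :: 'a ring) \<Longrightarrow> ideal K (\<O> :: 'a ring) \<Longrightarrow> I \<star> J \<star> K = I \<star> (J \<star> K)"
  by (rule O.ideal_prod_assoc)

lemma prod_comm: "ideal I (\<O> :: 'a ring) \<Longrightarrow> ideal J (\<O> :: 'a ring) \<Longrightarrow> I \<star> J = J \<star> I"
  by (rule O.ideal_prod_commute)

lemma prod_subset_left: "ideal I (\<O> :: 'a ring) \<Longrightarrow> ideal J (\<O> :: 'a ring) \<Longrightarrow> I \<star> J \<subseteq> I"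
  using O.ideal_prod_inter by blast

abbreviation prods :: "'a set list \<Rightarrow> 'a set" where
  "prods Ms \<equiv> foldr (ideal_prod \<O>) Ms OK"

abbreviation primes_over :: "nat \<Rightarrow> 'a set list \<Rightarrow> bool" where
  "primes_over p Ms \<equiv> (\<forall>M\<in>set Ms. prime_over p M)"

lemma prods_ideal: "primes_over p Ms \<Longrightarrow> ideal (prods Ms) (\<O> :: 'a ring)"
  by (induction Ms) (auto intro: prod_ideal_ideal ideal_OK prime_over_D(1))

lemma prods_append:
  "primes_over p Ms \<Longrightarrow> primes_over p Ms' \<Longrightarrow> prods (Ms @ Ms') = prods Ms \<star> prods Ms'"
proof (induction Ms)
  case Nil
  thus ?case using prod_OK(2)[OF prods_ideal] by auto
next
  case (Cons M Ms)
  have "ideal M (\<O> :: 'a ring)" "primes_over p Ms" using Cons.prems(1) prime_over_D(1) by auto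
  thus ?case using Cons.IH Cons.prems(2) prod_assoc[OF _ prods_ideal prods_ideal] by auto
qed

lemma prods_remove1:
  assumes "primes_over p Ms" "M \<in> set Ms"
  shows "prods Ms = M \<star> prods (remove1 M Ms)"
proof -
  obtain As Bs where Ms: "Ms = As @ M # Bs" "M \<notin> set As" using assms(2) by (metis split_list_first)
  have P: "primes_over p As" "primes_over p Bs" "prime_over p M" using assms(1) by (auto simp: Ms(1))
  note I = prods_ideal[OF P(1)] prods_ideal[OF P(2)] prime_over_D(1)[OF P(3)]
  have rem: "remove1 M Ms = As @ Bs" using Ms by (simp add: remove1_append)
  have "prods Ms = prods As \<star> (M \<star> prods Bs)"
    unfolding Ms(1) using prods_append[OF P(1), of "M # Bs"] P by simp
  also have "\<dots> = M \<star> (prods As \<star> prods Bs)"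
    using I prod_assoc[of "prods As" M "prods Bs"] prod_assoc[of M "prods As" "prods Bs"]
      prod_comm[of "prods As" M] by simp
  also have "prods As \<star> prods Bs = prods (remove1 M Ms)"
    unfolding rem using prods_append[OF P(1,2)] by simp
  finally show ?thesis .
qed

lemma prime_over_contains_prod:
  assumes M: "prime_over p M" and IJ: "ideal I (\<O> :: 'a ring)" "ideal J (\<O> :: 'a ring)" "I \<star> J \<subseteq> M"
  shows "I \<subseteq> M \<or> J \<subseteq> M"
  using O.primeideal_divides_ideal_prod[OF _ IJ] M by (simp add: prime_over_def)

lemma prods_subset_prime:
  assumes "p > 0" "prime_over p M" "primes_over p Ms" "prods Ms \<subseteq> M"
  shows "M \<in> set Ms"
  using assms(3,4)
proof (induction Ms)
  case Nil
  hence "1 \<in> M" by auto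
  thus ?case using prime_over_D(3)[OF assms(2)] by blast
next
  case (Cons P Ms)
  hence P: "prime_over p P" "primes_over p Ms" by auto
  have "P \<subseteq> M \<or> prods Ms \<subseteq> M"
    using prime_over_contains_prod[OF assms(2) prime_over_D(1)[OF P(1)] prods_ideal[OF P(2)]] Cons.prems(2) by simp
  thus ?case using prime_over_eq[OF assms(1) P(1) assms(2)] Cons.IH[OF P(2)] by auto
qed

text \<open>An ideal that is neither prime nor everything contains the product of two strictly larger ideals.\<close>

lemma ideal_contains_prods:
  assumes p: "p > 0" and I: "ideal I (\<O> :: 'a ring)" "of_nat p \<in> I"
  shows "\<exists>Ms. primes_over p Ms \<and> prods Ms \<subseteq> I"
  using p I
proof (induction rule: ideal_ascending_induct)
  case (step I)
  show ?case
  proof (cases "I = OK \<or> primeideal I (\<O> :: 'a ring)")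
    case True
    thus ?thesis
    proof
      assume "I = OK" thus ?thesis by (intro exI[of _ "[]"]) simp
    next
      assume "primeideal I (\<O> :: 'a ring)"
      thus ?thesis using step.hyps(1,2) by (intro exI[of _ "[I]"]) (simp add: prime_over_def prod_OK)
    qed
  next
    case False
    then obtain x y where xy: "x \<in> OK" "y \<in> OK" "x * y \<in> I" "x \<notin> I" "y \<notin> I"
      using not_prime_witness[OF step.hyps(1)] by blast
    note X = ideal_adjoin_props[OF step.hyps(1) xy(1)] and Y = ideal_adjoin_props[OF step.hyps(1) xy(2)]
    obtain Ms Ms' where Ms: "primes_over p Ms" "prods Ms \<subseteq> ideal_adjoin I x"
      and Ms': "primes_over p Ms'" "prods Ms' \<subseteq> ideal_adjoin I y"
      using step.IH[OF X(1)] step.IH[OF Y(1)] X Y xy(4,5) by blast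
    have "prods (Ms @ Ms') \<subseteq> ideal_adjoin I x \<star> ideal_adjoin I y"
      unfolding prods_append[OF Ms(1) Ms'(1)] by (rule prod_ideal_mono[OF X(1) Y(1) Ms(2) Ms'(2)])
    also have "\<dots> \<subseteq> I"
    proof (rule prod_ideal_least[OF step.hyps(1)])
      fix a b assume "a \<in> ideal_adjoin I x" "b \<in> ideal_adjoin I y"
      then obtain i r j s where ab: "a = i + r * x" "i \<in> I" "r \<in> OK" "b = j + s * y" "j \<in> I" "s \<in> OK"
        unfolding ideal_adjoin_def by blast
      note D = ideal_OK_D[OF step.hyps(1)]
      have "b \<in> OK" using \<open>b \<in> ideal_adjoin I y\<close> ideal_OK_D(1)[OF Y(1)] by blast
      hence "b * i + (r * x * j + r * s * (x * y)) \<in> I"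
        by (intro D(3) D(4)[OF _ ab(2)] D(4)[OF _ ab(5)] D(4)[OF _ xy(3)] OK_closed(3) ab(3,6) xy(1))
      moreover have "a * b = b * i + (r * x * j + r * s * (x * y))" by (simp add: ab(1,4) algebra_simps)
      ultimately show "a * b \<in> I" by simp
    qed
    finally show ?thesis using Ms(1) Ms'(1) by (intro exI[of _ "Ms @ Ms'"]) auto
  qed
qed

text \<open>Take a shortest product of primes inside \<open>(p)\<close>. The prime \<open>M\<close> is one of its factors, and the product of the
others contains some \<open>b\<close> outside \<open>(p)\<close>. Then \<open>J\<close> is \<open>(p, b)\<close>: if \<open>M J\<close> were not all of \<open>(p)\<close>, maximality of
\<open>M\<close> would make \<open>b / p\<close> a multiplier of \<open>M\<close>.\<close>

lemma prime_over_invertible: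
  assumes p: "p > 0" and M: "prime_over p M"
  obtains J b where "ideal J (\<O> :: 'a ring)" "of_nat p \<in> J" "b \<in> J" "b \<notin> PIdl\<^bsub>\<O>\<^esub> (of_nat p)"
    "M \<star> J = PIdl\<^bsub>\<O>\<^esub> (of_nat p)"
proof -
  define pO where "pO = (PIdl\<^bsub>\<O>\<^esub> (of_nat p) :: 'a set)"
  note MD = prime_over_D[OF M]
  have pO: "ideal pO (\<O> :: 'a ring)" unfolding pO_def by (rule ideal_principal[OF OK_of_nat])
  have pO_iff: "x \<in> pO \<longleftrightarrow> (\<exists>r\<in>OK. x = of_nat p * r)" for x unfolding pO_def principal_ideal by blast
  have p_pO: "of_nat p \<in> pO" unfolding pO_iff by (rule bexI[of _ 1]) auto
  have pO_least: "pO \<subseteq> I" if I: "ideal I (\<O> :: 'a ring)" "of_nat p \<in> I" for I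
  proof
    fix x assume "x \<in> pO"
    then obtain r where "r \<in> OK" "x = of_nat p * r" using pO_iff by blast
    thus "x \<in> I" using ideal_OK_D(4)[OF I(1) _ I(2), of r] by (simp add: mult.commute)
  qed
  have pO_M: "pO \<subseteq> M" by (rule pO_least[OF MD(1,2)])
  define good where "good Ms \<longleftrightarrow> primes_over p Ms \<and> prods Ms \<subseteq> pO" for Ms
  obtain Ms0 where "good Ms0" using ideal_contains_prods[OF p pO p_pO] by (auto simp: good_def)
  then obtain Ms where Ms: "good Ms" and min: "\<And>Ms'. good Ms' \<Longrightarrow> length Ms \<le> length Ms'"
    using ex_has_least_nat[of good Ms0 length] by blast
  have MMs: "M \<in> set Ms"
    using Ms pO_M unfolding good_def by (intro prods_subset_prime[OF p M]) blast+
  define Ms' where "Ms' = remove1 M Ms"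
  have P': "primes_over p Ms'" using Ms using set_remove1_subset[of M Ms] by (auto simp: good_def Ms'_def)
  have "length Ms' < length Ms" using MMs length_pos_if_in_set[OF MMs] by (simp add: Ms'_def length_remove1 del: length_greater_0_conv)
  hence "\<not> good Ms'" using min[of Ms'] by linarith
  then obtain b where b: "b \<in> prods Ms'" "b \<notin> pO" using P' by (auto simp: good_def)
  have bOK: "b \<in> OK" using b(1) ideal_OK_D(1)[OF prods_ideal[OF P']] by blast
  have bM: "m * b \<in> pO" if "m \<in> M" for m
    using prod_ideal_mem[OF that b(1)] prods_remove1[where p = p and Ms = Ms and M = M] Ms MMs by (auto simp: good_def Ms'_def)
  define J where "J = ideal_adjoin pO b"
  have J: "ideal J (\<O> :: 'a ring)" "pO \<subseteq> J" "b \<in> J" unfolding J_def using ideal_adjoin_props[OF pO bOK] by auto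
  have MJ: "ideal (M \<star> J) (\<O> :: 'a ring)" by (rule prod_ideal_ideal[OF MD(1) J(1)])
  have sub: "M \<star> J \<subseteq> pO"
  proof (rule prod_ideal_least[OF pO])
    fix m j assume m: "m \<in> M" and "j \<in> J"
    then obtain i r where j: "j = i + r * b" "i \<in> pO" "r \<in> OK" unfolding J_def ideal_adjoin_def by blast
    have "m * i + r * (m * b) \<in> pO"
      using m j bM[OF m] ideal_OK_D(3,4)[OF pO] ideal_OK_D(1)[OF MD(1)] by blast
    thus "m * j \<in> pO" by (simp add: j algebra_simps)
  qed
  \<comment> \<open>The goal is \<open>1 \<in> X\<close>; the ideal \<open>X\<close> contains \<open>M\<close>, so otherwise it equals \<open>M\<close>.\<close>
  define X where "X = {x \<in> OK. of_nat p * x \<in> M \<star> J}"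
  have X: "ideal X (\<O> :: 'a ring)"
  proof (rule ideal_OK_I)
    fix r x assume rx: "r \<in> OK" "x \<in> X"
    have "r * (of_nat p * x) \<in> M \<star> J" using rx by (intro ideal_OK_D(4)[OF MJ, of r "of_nat p * x"]) (auto simp: X_def)
    thus "r * x \<in> X" using rx OK_closed(3)[of r x] by (auto simp: X_def algebra_simps)
  qed (use ideal_OK_D(2,3)[OF MJ] OK_closed(1) in \<open>auto simp: X_def distrib_left\<close>)
  have MX: "M \<subseteq> X"
    using prod_ideal_mem[of _ M "of_nat p" J] p_pO J(2) ideal_OK_D(1)[OF MD(1)]
    by (auto simp: X_def mult.commute)
  have "1 \<in> X"
  proof (rule ccontr)
    assume "1 \<notin> X"
    hence XM: "X = M" by (rule prime_over_maximal[OF p M X MX])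
    have "b / of_nat p \<in> OK"
    proof (rule multiplier_is_integral[OF p MD(1,2)])
      fix m assume m: "m \<in> M"
      obtain x where x: "x \<in> OK" "m * b = of_nat p * x" using bM[OF m] pO_iff by blast
      have "of_nat p * x \<in> M \<star> J" unfolding x(2)[symmetric] by (rule prod_ideal_mem[OF m J(3)])
      hence "x \<in> M" using x(1) XM by (auto simp: X_def)
      moreover have "b / of_nat p * m = x" using x(2) p by (simp add: field_simps)
      ultimately show "b / of_nat p * m \<in> M" by simp
    qed
    hence "of_nat p * (b / of_nat p) \<in> pO" unfolding pO_iff by blast
    thus False using b(2) p by simp
  qed
  hence "of_nat p \<in> M \<star> J" by (simp add: X_def)
  hence "pO \<subseteq> M \<star> J" by (rule pO_least[OF MJ])
  with sub have "M \<star> J = pO" by blast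
  thus ?thesis using that[of J b] J b(2) p_pO by (auto simp: pO_def)
qed

text \<open>Multiply by the inverse up to \<open>p\<close> of \<open>M\<close>.\<close>

lemma prime_over_cancel:
  assumes p: "p > 0" and M: "prime_over p M" and X: "ideal X (\<O> :: 'a ring)" and Y: "ideal Y (\<O> :: 'a ring)"
    and sub: "M \<star> X \<subseteq> M \<star> Y"
  shows "X \<subseteq> Y"
proof -
  obtain J where J: "ideal J (\<O> :: 'a ring)" "M \<star> J = PIdl\<^bsub>\<O>\<^esub> (of_nat p)"
    using prime_over_invertible[OF p M] by metis
  note I = J(1) prime_over_D(1)[OF M]
  have JMZ: "J \<star> (M \<star> Z) = (\<lambda>r. of_nat p * r) ` Z" if Z: "ideal Z (\<O> :: 'a ring)" for Z
  proof -
    have "J \<star> (M \<star> Z) = M \<star> J \<star> Z" using prod_assoc[OF I Z] prod_comm[OF I] by simp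
    also have "\<dots> = (\<lambda>r. of_nat p * r) ` Z" unfolding J(2) by (rule prod_principal[OF Z OK_of_nat])
    finally show ?thesis .
  qed
  have "J \<star> (M \<star> X) \<subseteq> J \<star> (M \<star> Y)"
    by (rule prod_ideal_mono[OF J(1) _ _ sub]) (use prod_ideal_ideal[OF I(2) Y] in auto)
  hence "(\<lambda>r. of_nat p * r) ` X \<subseteq> (\<lambda>r. of_nat p * r) ` Y" using JMZ[OF X] JMZ[OF Y] by simp
  thus ?thesis using p by (auto simp: image_subset_iff image_iff)
qed

text \<open>A proper ideal that is not prime can be enlarged by one of the two factors violating primality, and
it remains proper.\<close>

lemma proper_ideal_subset_prime:
  assumes p: "p > 0" and I: "ideal I (\<O> :: 'a ring)" "of_nat p \<in> I"
  shows "I \<noteq> OK \<longrightarrow> (\<exists>M. prime_over p M \<and> I \<subseteq> M)"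
  using p I
proof (induction rule: ideal_ascending_induct)
  case (step I)
  show ?case
  proof (intro impI, cases "primeideal I (\<O> :: 'a ring)")
    case True
    thus "\<exists>M. prime_over p M \<and> I \<subseteq> M" using step.hyps(2) by (auto simp: prime_over_def)
  next
    case False
    assume "I \<noteq> OK"
    then obtain x y where xy: "x \<in> OK" "y \<in> OK" "x * y \<in> I" "x \<notin> I" "y \<notin> I"
      using not_prime_witness[OF step.hyps(1)] False by blast
    note X = ideal_adjoin_props[OF step.hyps(1) xy(1)] and D = ideal_OK_D[OF step.hyps(1)]
    have "ideal_adjoin I x \<noteq> OK"
    proof
      assume "ideal_adjoin I x = OK"
      hence "1 \<in> ideal_adjoin I x" by simp
      then obtain i r where ir: "1 = i + r * x" "i \<in> I" "r \<in> OK" unfolding ideal_adjoin_def by blast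
      have "y * i + r * (x * y) \<in> I" using ir xy D(3,4) by blast
      moreover have "y * i + r * (x * y) = y * (i + r * x)" by (simp add: algebra_simps)
      ultimately show False using xy(5) ir(1) by simp
    qed
    thus "\<exists>M. prime_over p M \<and> I \<subseteq> M" using step.IH[OF X(1)] X(2,3) xy(4) by blast
  qed
qed

text \<open>With \<open>M\<close> a prime above \<open>I\<close> and \<open>M J = (p)\<close>, the ideal \<open>I' = I J / p\<close> satisfies \<open>I = M I'\<close>. It is strictly
larger than \<open>I\<close>, since otherwise an element of \<open>J\<close> outside \<open>(p)\<close> would give a multiplier of \<open>I\<close> that is not integral.\<close>

lemma ideal_factorization_exists:
  assumes p: "p > 0" and I: "ideal I (\<O> :: 'a ring)" "of_nat p \<in> I"
  shows "\<exists>Ms. primes_over p Ms \<and> I = prods Ms"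
  using p I
proof (induction rule: ideal_ascending_induct)
  case (step I)
  show ?case
  proof (cases "I = OK")
    case True thus ?thesis by (intro exI[of _ "[]"]) simp
  next
    case False
    then obtain M where M: "prime_over p M" "I \<subseteq> M"
      using proper_ideal_subset_prime[OF p step.hyps(1,2)] by blast
    note MD = prime_over_D[OF M(1)]
    obtain J b where J: "ideal J (\<O> :: 'a ring)" "of_nat p \<in> J" "b \<in> J" "b \<notin> PIdl\<^bsub>\<O>\<^esub> (of_nat p)"
      and MJ: "M \<star> J = PIdl\<^bsub>\<O>\<^esub> (of_nat p)"
      by (rule prime_over_invertible[OF p M(1)]) blast
    note ID = ideal_OK_D[OF step.hyps(1)]
    define I' where "I' = {x \<in> OK. of_nat p * x \<in> I \<star> J}"
    have IJ: "ideal (I \<star> J) (\<O> :: 'a ring)" by (rule prod_ideal_ideal[OF step.hyps(1) J(1)])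
    have I': "ideal I' (\<O> :: 'a ring)"
    proof (rule ideal_OK_I)
      fix r x assume rx: "r \<in> OK" "x \<in> I'"
      have "r * (of_nat p * x) \<in> I \<star> J" using rx by (intro ideal_OK_D(4)[OF IJ, of r "of_nat p * x"]) (auto simp: I'_def)
      thus "r * x \<in> I'" using rx OK_closed(3)[of r x] by (auto simp: I'_def algebra_simps)
    qed (use ideal_OK_D(2,3)[OF IJ] OK_closed(1) in \<open>auto simp: I'_def distrib_left\<close>)
    have pI': "(\<lambda>r. of_nat p * r) ` I' = I \<star> J"
    proof
      show "(\<lambda>r. of_nat p * r) ` I' \<subseteq> I \<star> J" by (auto simp: I'_def)
      have "I \<star> J \<subseteq> M \<star> J" by (rule prod_ideal_mono[OF MD(1) J(1) M(2)]) simp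
      hence sub: "I \<star> J \<subseteq> (\<lambda>r. of_nat p * r) ` OK" unfolding MJ principal_ideal .
      show "I \<star> J \<subseteq> (\<lambda>r. of_nat p * r) ` I'"
      proof
        fix z assume z: "z \<in> I \<star> J"
        then obtain r where "r \<in> OK" "z = of_nat p * r" using sub by blast
        thus "z \<in> (\<lambda>r. of_nat p * r) ` I'" using z by (intro image_eqI[of _ _ r]) (auto simp: I'_def)
      qed
    qed
    have eq: "I = M \<star> I'"
    proof -
      have "(\<lambda>r. of_nat p * r) ` (M \<star> I') = PIdl\<^bsub>\<O>\<^esub> (of_nat p) \<star> (M \<star> I')"
        by (rule prod_principal[OF prod_ideal_ideal[OF MD(1) I'] OK_of_nat, symmetric])
      also have "\<dots> = M \<star> (PIdl\<^bsub>\<O>\<^esub> (of_nat p) \<star> I')"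
        using prod_assoc[OF ideal_principal[OF OK_of_nat] MD(1) I', of p]
          prod_assoc[OF MD(1) ideal_principal[OF OK_of_nat] I', of p]
          prod_comm[OF MD(1) ideal_principal[OF OK_of_nat], of p] by simp
      also have "PIdl\<^bsub>\<O>\<^esub> (of_nat p) \<star> I' = I \<star> J"
        using prod_principal[OF I' OK_of_nat] pI' by simp
      also have "M \<star> (I \<star> J) = M \<star> J \<star> I"
        using prod_comm[OF step.hyps(1) J(1)] prod_assoc[OF MD(1) J(1) step.hyps(1)] by simp
      also have "\<dots> = (\<lambda>r. of_nat p * r) ` I"
        unfolding MJ by (rule prod_principal[OF step.hyps(1) OK_of_nat])
      finally have "(\<lambda>r. of_nat p * r) ` (M \<star> I') = (\<lambda>r. of_nat p * r) ` I" .
      moreover have "inj ((\<lambda>r. of_nat p * r) :: 'a \<Rightarrow> 'a)" using p by (intro injI) simp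
      ultimately show ?thesis by (simp add: inj_image_eq_iff)
    qed
    have "I \<subseteq> I'"
      using eq prod_subset_left[OF I' MD(1)] prod_comm[OF MD(1) I'] by simp
    moreover have "I \<noteq> I'"
    proof
      assume II': "I = I'"
      have "b / of_nat p \<in> OK"
      proof (rule multiplier_is_integral[OF p step.hyps(1,2)])
        fix i assume i: "i \<in> I"
        hence "i * b \<in> (\<lambda>r. of_nat p * r) ` I'" unfolding pI' by (rule prod_ideal_mem[OF _ J(3)])
        then obtain x where "x \<in> I" "i * b = of_nat p * x" using II' by blast
        moreover from this have "b / of_nat p * i = x" using p by (simp add: field_simps)
        ultimately show "b / of_nat p * i \<in> I" by simp
      qed
      hence "of_nat p * (b / of_nat p) \<in> PIdl\<^bsub>\<O>\<^esub> (of_nat p)" unfolding principal_ideal by blast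
      thus False using J(4) p by simp
    qed
    ultimately obtain Ms where "primes_over p Ms" "I' = prods Ms" using step.IH[OF I'] by blast
    thus ?thesis using M(1) eq by (intro exI[of _ "M # Ms"]) auto
  qed
qed

lemma ideal_pow: "ideal P (\<O> :: 'a ring) \<Longrightarrow> ideal (P [^]\<^bsub>ideals_set \<O>\<^esub> (n::nat)) (\<O> :: 'a ring)"
  using G.nat_pow_closed[of P n] by simp

lemma pow_Suc: "ideal P (\<O> :: 'a ring) \<Longrightarrow> P [^]\<^bsub>ideals_set \<O>\<^esub> Suc n = P \<star> P [^]\<^bsub>ideals_set \<O>\<^esub> n"
  using prod_comm[of P "P [^]\<^bsub>ideals_set \<O>\<^esub> n"] ideal_pow[of P n] by simp

lemma pow_subset_prime:
  assumes "p > 0" "prime_over p M" "prime_over p P" "P [^]\<^bsub>ideals_set \<O>\<^esub> (n::nat) \<subseteq> M"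
  shows "P = M"
  using assms(4)
proof (induction n)
  case 0
  hence "1 \<in> M" by auto
  thus ?case using prime_over_D(3)[OF assms(2)] by blast
next
  case (Suc n)
  note P = prime_over_D(1)[OF assms(3)]
  have "P \<subseteq> M \<or> P [^]\<^bsub>ideals_set \<O>\<^esub> n \<subseteq> M"
    using prime_over_contains_prod[OF assms(2) P ideal_pow[OF P]] Suc.prems pow_Suc[OF P] by simp
  thus ?case using Suc.IH prime_over_eq[OF assms(1,3,2)] by blast
qed

lemma finprod_pow_subset_prime:
  assumes p: "p > 0" and M: "prime_over p M" and A: "finite A" "\<And>P. P \<in> A \<Longrightarrow> prime_over p P"
    and sub: "finprod (ideals_set \<O>) (\<lambda>P. P [^]\<^bsub>ideals_set \<O>\<^esub> (e P :: nat)) A \<subseteq> M"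
  shows "M \<in> A"
  using A sub
proof (induction A rule: finite_induct)
  case empty
  hence "1 \<in> M" by auto
  thus ?case using prime_over_D(3)[OF M] by blast
next
  case (insert P A)
  have P: "prime_over p P" "ideal P (\<O> :: 'a ring)" using insert.prems(1) prime_over_D(1) by auto
  have carr: "(\<lambda>P. P [^]\<^bsub>ideals_set \<O>\<^esub> (e P :: nat)) \<in> A \<rightarrow> {I. ideal I (\<O> :: 'a ring)}"
    using insert.prems(1) prime_over_D(1) ideal_pow by blast
  let ?F = "finprod (ideals_set \<O>) (\<lambda>P. P [^]\<^bsub>ideals_set \<O>\<^esub> (e P :: nat)) A"
  have F: "ideal ?F (\<O> :: 'a ring)" using G.finprod_closed[of _ A] carr by simp
  have "finprod (ideals_set \<O>) (\<lambda>P. P [^]\<^bsub>ideals_set \<O>\<^esub> (e P :: nat)) (insert P A) = P [^]\<^bsub>ideals_set \<O>\<^esub> e P \<star> ?F"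
    using G.finprod_insert[OF insert.hyps(1,2)] carr ideal_pow[OF P(2)] by simp
  hence "P [^]\<^bsub>ideals_set \<O>\<^esub> e P \<subseteq> M \<or> ?F \<subseteq> M"
    using prime_over_contains_prod[OF M ideal_pow[OF P(2)] F] insert.prems(2) by simp
  thus ?case using pow_subset_prime[OF p M P(1)] insert.IH insert.prems(1) by blast
qed

lemma prime_over_if_exponent_nonzero:
  assumes p: "p > 0" and fact: "is_prime_ideal_factorization (PIdl\<^bsub>\<O>\<^esub> (of_nat p) :: 'a set) e"
    and P: "e P \<noteq> 0"
  shows "prime_over p P"
proof -
  define A where "A = {P. e P \<noteq> 0}"
  let ?pow = "\<lambda>P. P [^]\<^bsub>ideals_set \<O>\<^esub> (e P :: nat)"
  let ?F = "finprod (ideals_set \<O>) ?pow (A - {P})"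
  have A: "finite A" "\<And>P. P \<in> A \<Longrightarrow> primeideal P (\<O> :: 'a ring)"
    and eq: "PIdl\<^bsub>\<O>\<^esub> (of_nat p) = finprod (ideals_set \<O>) ?pow A" and PA: "P \<in> A"
    using fact P by (auto simp: is_prime_ideal_factorization_def A_def)
  have idA: "ideal P (\<O> :: 'a ring)" if "P \<in> A" for P
    using A(2)[OF that] by (rule primeideal.axioms(1))
  have carr: "?pow \<in> A - {P} \<rightarrow> {I. ideal I (\<O> :: 'a ring)}" using idA ideal_pow by blast
  have F: "ideal ?F (\<O> :: 'a ring)" using G.finprod_closed[of _ "A - {P}"] carr by simp
  have "PIdl\<^bsub>\<O>\<^esub> (of_nat p) = finprod (ideals_set \<O>) ?pow (insert P (A - {P}))"
    using eq PA by (simp add: insert_absorb)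
  also have "\<dots> = ?pow P \<star> ?F"
    using G.finprod_insert[of "A - {P}" P ?pow] A(1) carr ideal_pow[OF idA[OF PA]] by simp
  also have "\<dots> \<subseteq> ?pow P" by (rule prod_subset_left[OF ideal_pow[OF idA[OF PA]] F])
  also have "\<dots> \<subseteq> P"
    using P pow_Suc[OF idA[OF PA]] prod_subset_left[OF idA[OF PA] ideal_pow[OF idA[OF PA]]] by (cases "e P") auto
  finally have "PIdl\<^bsub>\<O>\<^esub> (of_nat p) \<subseteq> P" .
  moreover have "of_nat p \<in> (PIdl\<^bsub>\<O>\<^esub> (of_nat p) :: 'a set)"
    unfolding principal_ideal by (rule image_eqI[of _ _ 1]) auto
  ultimately show ?thesis using A(2)[OF PA] by (auto simp: prime_over_def)
qed

text \<open>The exponent of \<open>M\<close> is the largest \<open>n\<close> such that \<open>M ^ n\<close> contains \<open>(p)\<close>, in every factorization.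
This gives uniqueness of the factorization and at the same time a way to compute the valuation.\<close>

lemma prime_ideal_factorization_exponent:
  assumes p: "p > 0" and fact: "is_prime_ideal_factorization (PIdl\<^bsub>\<O>\<^esub> (of_nat p) :: 'a set) e"
    and M: "prime_over p M"
  shows "PIdl\<^bsub>\<O>\<^esub> (of_nat p) \<subseteq> M [^]\<^bsub>ideals_set \<O>\<^esub> n \<longleftrightarrow> n \<le> e M"
proof -
  define pO where "pO = (PIdl\<^bsub>\<O>\<^esub> (of_nat p) :: 'a set)"
  define A where "A = {P. e P \<noteq> 0}"
  let ?pow = "\<lambda>P. P [^]\<^bsub>ideals_set \<O>\<^esub> (e P :: nat)"
  have A: "finite A" "\<And>P. P \<in> A \<Longrightarrow> primeideal P (\<O> :: 'a ring)" and eq: "pO = finprod (ideals_set \<O>) ?pow A"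
    using fact by (auto simp: is_prime_ideal_factorization_def A_def pO_def)
  have idA: "ideal P (\<O> :: 'a ring)" if "P \<in> A" for P
    using A(2)[OF that] by (rule primeideal.axioms(1))
  have MD: "ideal M (\<O> :: 'a ring)" by (rule prime_over_D(1)[OF M])
  have factor: "pO = ?pow P \<star> finprod (ideals_set \<O>) ?pow (A - {P}) \<and> ideal (finprod (ideals_set \<O>) ?pow (A - {P})) (\<O> :: 'a ring)"
    if P: "ideal P (\<O> :: 'a ring)" for P
  proof -
    have carr: "?pow \<in> A - {P} \<rightarrow> {I. ideal I (\<O> :: 'a ring)}" using idA ideal_pow by blast
    have F: "ideal (finprod (ideals_set \<O>) ?pow (A - {P})) (\<O> :: 'a ring)"
      using G.finprod_closed[of _ "A - {P}"] carr by simp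
    show ?thesis
    proof (cases "P \<in> A")
      case True
      have "pO = finprod (ideals_set \<O>) ?pow (insert P (A - {P}))"
        using eq True by (simp add: insert_absorb)
      also have "\<dots> = ?pow P \<star> finprod (ideals_set \<O>) ?pow (A - {P})"
        using G.finprod_insert[of "A - {P}" P ?pow] A(1) carr ideal_pow[OF P] by simp
      finally show ?thesis using F by blast
    next
      case False
      hence "A - {P} = A" "e P = 0" by (auto simp: A_def)
      thus ?thesis using F eq prod_OK(2)[OF F] by simp
    qed
  qed
  have over: "prime_over p P" if "P \<in> A" for P
    using prime_over_if_exponent_nonzero[OF p fact] that by (simp add: A_def)
  define Q where "Q = finprod (ideals_set \<O>) ?pow (A - {M})"
  have Q: "pO = ?pow M \<star> Q" "ideal Q (\<O> :: 'a ring)" using factor[OF MD] by (simp_all add: Q_def)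
  have QM: "\<not> Q \<subseteq> M"
    unfolding Q_def using finprod_pow_subset_prime[OF p M, of "A - {M}" e] A(1) over by blast
  have split: "M [^]\<^bsub>ideals_set \<O>\<^esub> (k + n) = M [^]\<^bsub>ideals_set \<O>\<^esub> k \<star> M [^]\<^bsub>ideals_set \<O>\<^esub> n" for k n :: nat
    using G.nat_pow_mult[of M k n] MD by simp
  have cancel: "X \<subseteq> Y" if "ideal X (\<O> :: 'a ring)" "ideal Y (\<O> :: 'a ring)"
    "M [^]\<^bsub>ideals_set \<O>\<^esub> k \<star> X \<subseteq> M [^]\<^bsub>ideals_set \<O>\<^esub> k \<star> Y" for k :: nat and X Y
    using that
  proof (induction k)
    case 0 thus ?case using prod_OK(2) by simp
  next
    case (Suc k)
    have eq: "M [^]\<^bsub>ideals_set \<O>\<^esub> Suc k \<star> Z = M \<star> (M [^]\<^bsub>ideals_set \<O>\<^esub> k \<star> Z)"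
      if "ideal Z (\<O> :: 'a ring)" for Z
      unfolding pow_Suc[OF MD] by (rule prod_assoc[OF MD ideal_pow[OF MD] that])
    have "M \<star> (M [^]\<^bsub>ideals_set \<O>\<^esub> k \<star> X) \<subseteq> M \<star> (M [^]\<^bsub>ideals_set \<O>\<^esub> k \<star> Y)"
      using Suc.prems(3) unfolding eq[OF Suc.prems(1)] eq[OF Suc.prems(2)] .
    hence "M [^]\<^bsub>ideals_set \<O>\<^esub> k \<star> X \<subseteq> M [^]\<^bsub>ideals_set \<O>\<^esub> k \<star> Y"
      by (rule prime_over_cancel[OF p M prod_ideal_ideal[OF ideal_pow[OF MD] Suc.prems(1)]
          prod_ideal_ideal[OF ideal_pow[OF MD] Suc.prems(2)]])
    thus ?case by (rule Suc.IH[OF Suc.prems(1,2)])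
  qed
  have "pO \<subseteq> M [^]\<^bsub>ideals_set \<O>\<^esub> n \<longleftrightarrow> n \<le> e M"
  proof
    assume sub: "pO \<subseteq> M [^]\<^bsub>ideals_set \<O>\<^esub> n"
    show "n \<le> e M"
    proof (rule ccontr)
      assume "\<not> n \<le> e M"
      then obtain m where "n = Suc (e M + m)" using less_imp_Suc_add[of "e M" n] by auto
      hence m: "n = e M + Suc m" by simp
      have "?pow M \<star> Q \<subseteq> ?pow M \<star> M [^]\<^bsub>ideals_set \<O>\<^esub> Suc m"
        using sub unfolding Q(1) m split .
      hence "Q \<subseteq> M [^]\<^bsub>ideals_set \<O>\<^esub> Suc m" by (rule cancel[OF Q(2) ideal_pow[OF MD]])
      also have "\<dots> \<subseteq> M" unfolding pow_Suc[OF MD] by (rule prod_subset_left[OF MD ideal_pow[OF MD]])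
      finally show False using QM by blast
    qed
  next
    assume "n \<le> e M"
    then obtain m where m: "e M = n + m" using le_Suc_ex by blast
    have "pO \<subseteq> ?pow M" unfolding Q(1) by (rule prod_subset_left[OF ideal_pow[OF MD] Q(2)])
    also have "\<dots> \<subseteq> M [^]\<^bsub>ideals_set \<O>\<^esub> n"
      unfolding m split by (rule prod_subset_left[OF ideal_pow[OF MD] ideal_pow[OF MD]])
    finally show "pO \<subseteq> M [^]\<^bsub>ideals_set \<O>\<^esub> n" .
  qed
  thus ?thesis by (simp add: pO_def)
qed

section \<open>The primes dividing the generator\<close>

lemma dvd_coeff_0_diff:
  assumes "ipoly h \<beta> = ipoly h' \<beta>" "m dvd coeff f 0"
  shows "m dvd coeff h 0 \<longleftrightarrow> m dvd coeff h' 0"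
proof -
  obtain g where "h - h' = f * g" using assms(1) by (auto simp: ipoly_eq_iff elim: dvdE)
  hence "coeff (h - h') 0 = coeff f 0 * coeff g 0" by (simp only: coeff_mult_0)
  hence "coeff h 0 = coeff h' 0 + coeff f 0 * coeff g 0" by simp
  moreover have "m dvd coeff f 0 * coeff g 0" using assms(2) by simp
  ultimately show ?thesis by (simp only: dvd_add_left_iff)
qed

text \<open>The ideal generated by \<open>p\<close> and \<open>\<beta>\<close>, as the set of elements whose polynomial has constant coefficient 0
modulo \<open>p\<close>.\<close>

definition residue_ideal :: "nat \<Rightarrow> 'a set" where
  "residue_ideal p = {x. \<exists>h. x = ipoly h \<beta> \<and> int p dvd coeff h 0}"

lemma ipoly_mem_residue_ideal:
  assumes "int p dvd coeff f 0"
  shows "ipoly h \<beta> \<in> residue_ideal p \<longleftrightarrow> int p dvd coeff h 0"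
proof
  assume "ipoly h \<beta> \<in> residue_ideal p"
  then obtain h' where "ipoly h \<beta> = ipoly h' \<beta>" "int p dvd coeff h' 0"
    unfolding residue_ideal_def by blast
  thus "int p dvd coeff h 0" using dvd_coeff_0_diff[of h h' "int p"] assms by blast
next
  assume "int p dvd coeff h 0"
  thus "ipoly h \<beta> \<in> residue_ideal p" unfolding residue_ideal_def by blast
qed

lemma of_nat_mem_residue_ideal:
  assumes "int p dvd coeff f 0"
  shows "of_nat n \<in> residue_ideal p \<longleftrightarrow> p dvd n"
  using ipoly_mem_residue_ideal[OF assms, of "[:int n:]"] by (simp add: ipoly_simps)

lemma generator_mem_residue_ideal: "\<beta> \<in> residue_ideal p"
  unfolding residue_ideal_def by (rule CollectI, rule exI[of _ "[:0, 1:]"]) (simp add: ipoly_simps)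

lemma ideal_residue_ideal: "ideal (residue_ideal p) (\<O> :: 'a ring)"
proof (rule ideal_OK_I)
  show "residue_ideal p \<subseteq> OK" using algebraic_int_ipoly by (auto simp: residue_ideal_def)
  show "0 \<in> residue_ideal p"
    unfolding residue_ideal_def by (rule CollectI, rule exI[of _ 0]) simp
  fix x y assume "x \<in> residue_ideal p" "y \<in> residue_ideal p"
  then obtain g h where "x = ipoly g \<beta>" "y = ipoly h \<beta>" "int p dvd coeff g 0" "int p dvd coeff h 0"
    by (auto simp: residue_ideal_def)
  thus "x + y \<in> residue_ideal p"
    unfolding residue_ideal_def by (intro CollectI exI[of _ "g + h"]) (simp add: ipoly_simps)
next
  fix r x assume "r \<in> OK" "x \<in> residue_ideal p"
  then obtain g h where "r = ipoly g \<beta>" "x = ipoly h \<beta>" "int p dvd coeff h 0"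
    by (auto simp: residue_ideal_def algebraic_int_iff)
  thus "r * x \<in> residue_ideal p"
    unfolding residue_ideal_def by (intro CollectI exI[of _ "g * h"]) (simp add: ipoly_simps coeff_mult_0)
qed

lemma prime_over_residue_ideal:
  assumes p: "prime p" and f0: "int p dvd coeff f 0"
  shows "prime_over p (residue_ideal p)"
  unfolding prime_over_def
proof
  show "primeideal (residue_ideal p) (\<O> :: 'a ring)"
  proof (rule primeidealI[OF ideal_residue_ideal cring_OK])
    have "1 \<notin> residue_ideal p"
      using of_nat_mem_residue_ideal[OF f0, of 1] p by auto
    thus "carrier \<O> \<noteq> residue_ideal p" by auto
    fix x y assume "x \<in> carrier \<O>" "y \<in> carrier \<O>" and xy: "x \<otimes>\<^bsub>\<O>\<^esub> y \<in> residue_ideal p"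
    then obtain g h where gh: "x = ipoly g \<beta>" "y = ipoly h \<beta>" by (auto simp: algebraic_int_iff)
    have "ipoly (g * h) \<beta> \<in> residue_ideal p" using xy by (simp add: gh ipoly_simps)
    hence "int p dvd coeff g 0 * coeff h 0"
      by (simp only: ipoly_mem_residue_ideal[OF f0] coeff_mult_0)
    thus "x \<in> residue_ideal p \<or> y \<in> residue_ideal p"
      using p by (simp add: gh ipoly_mem_residue_ideal[OF f0] prime_dvd_mult_iff)
  qed
  show "of_nat p \<in> residue_ideal p" by (simp add: of_nat_mem_residue_ideal[OF f0])
qed

lemma constant_coeff_split:
  obtains g where "of_int (coeff f 0) + of_int (coeff f 1) * \<beta> + \<beta> * (\<beta> * ipoly g \<beta>) = 0"
proof -
  obtain a f' where f': "f = pCons a f'" by (cases f)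
  obtain c g where g: "f' = pCons c g" by (cases f')
  have "of_int (coeff f 0) + of_int (coeff f 1) * \<beta> + \<beta> * (\<beta> * ipoly g \<beta>) = 0"
    using ipoly_f by (simp add: f' g ipoly_simps algebra_simps)
  thus ?thesis by (rule that)
qed

text \<open>Integral closedness of \<open>\<int>[\<beta>]\<close> at \<open>(p, \<beta>)\<close>. Let \<open>\<theta> = h1(\<beta>) / p\<close> where \<open>f = coeff f 0 + X * h1\<close>. If \<open>p\<close>
divided the linear coefficient and \<open>p\<^sup>2\<close> the constant one, then \<open>\<theta>\<close> would satisfy a monic quadratic equation
over \<open>\<int>[\<beta>]\<close>. But \<open>\<theta>\<close> is not in \<open>\<int>[\<beta>]\<close>, as \<open>h1\<close> is monic of degree less than that of \<open>f\<close>.\<close>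

lemma square_not_dvd_coeff_0:
  assumes p: "prime p" and f1: "int p dvd coeff f 1"
  shows "\<not> int p ^ 2 dvd coeff f 0"
proof
  assume f0: "int p ^ 2 dvd coeff f 0"
  obtain h1 where h1: "f = pCons (coeff f 0) h1" by (metis coeff_pCons_0 pCons_cases)
  obtain h2 where h2: "h1 = pCons (coeff f 1) h2" by (metis One_nat_def coeff_pCons_0 coeff_pCons_Suc h1 pCons_cases)
  have p0: "p > 0" using p by (simp add: prime_gt_0_nat)
  obtain s where s: "coeff f 1 = int p * s" using f1 by (elim dvdE)
  obtain t where t: "coeff f 0 = int p ^ 2 * t" using f0 by (elim dvdE)
  define \<theta> where "\<theta> = ipoly h1 \<beta> / of_nat p"
  have "of_int (coeff f 0) + \<beta> * ipoly h1 \<beta> = 0"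
    using ipoly_f by (subst (asm) h1) (simp add: ipoly_simps)
  hence \<beta>\<theta>: "\<beta> * \<theta> = - (of_nat p * of_int t)"
    using p0 by (simp add: \<theta>_def t field_simps power2_eq_square eq_neg_iff_add_eq_0)
  have p\<theta>: "of_nat p * \<theta> = of_nat p * of_int s + \<beta> * ipoly h2 \<beta>"
  proof -
    have "of_nat p * \<theta> = ipoly h1 \<beta>" using p0 by (simp add: \<theta>_def)
    also have "\<dots> = of_int (coeff f 1) + \<beta> * ipoly h2 \<beta>" by (subst h2) (simp only: ipoly_simps)
    finally show ?thesis unfolding s by simp
  qed
  have "of_nat p * (\<theta> * \<theta>) = \<theta> * (of_nat p * \<theta>)" by (simp only: mult.left_commute)
  also have "\<dots> = of_nat p * (of_int s * \<theta>) + (\<beta> * \<theta>) * ipoly h2 \<beta>"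
    unfolding p\<theta> by (simp add: algebra_simps)
  also have "\<dots> = of_nat p * (of_int s * \<theta> - of_int t * ipoly h2 \<beta>)"
    unfolding \<beta>\<theta> by (simp add: algebra_simps)
  finally have quadratic: "\<theta> * \<theta> = of_int s * \<theta> - of_int t * ipoly h2 \<beta>" using p0 by simp
  have span: "\<exists>a b. \<theta> ^ n = ipoly a \<beta> + ipoly b \<beta> * \<theta>" for n
  proof (induction n)
    case 0
    show ?case by (rule exI[of _ 1], rule exI[of _ 0]) simp
  next
    case (Suc n)
    then obtain a b where ab: "\<theta> ^ n = ipoly a \<beta> + ipoly b \<beta> * \<theta>" by blast
    have "\<theta> ^ Suc n = ipoly a \<beta> * \<theta> + ipoly b \<beta> * (\<theta> * \<theta>)" by (simp add: ab algebra_simps)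
    also have "\<dots> = ipoly (- (Polynomial.smult t (b * h2))) \<beta> + ipoly (a + Polynomial.smult s b) \<beta> * \<theta>"
      unfolding quadratic by (simp add: ipoly_simps algebra_simps)
    finally show ?case by blast
  qed
  have "\<theta> \<in> OK"
  proof (rule bounded_denominator_imp_integral[OF p0])
    fix n
    obtain a b where ab: "\<theta> ^ n = ipoly a \<beta> + ipoly b \<beta> * \<theta>" using span by blast
    have "of_nat p * \<theta> ^ n = of_int (int p) * ipoly a \<beta> + ipoly b \<beta> * (of_nat p * \<theta>)"
      unfolding ab by (simp add: algebra_simps)
    also have "of_nat p * \<theta> = ipoly h1 \<beta>" using p0 by (simp add: \<theta>_def)
    also have "of_int (int p) * ipoly a \<beta> + ipoly b \<beta> * ipoly h1 \<beta> = ipoly (Polynomial.smult (int p) a + b * h1) \<beta>" by (simp only: ipoly_simps)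
    finally show "of_nat p * \<theta> ^ n \<in> OK" using algebraic_int_ipoly by simp
  qed
  then obtain c where c: "\<theta> = (\<Sum>j<degree f. of_int (c j) * \<beta> ^ j)" by (rule integer_combination)
  define u where "u = (\<Sum>j<degree f. monom (c j) j)"
  have u: "\<theta> = ipoly u \<beta>"
    by (simp add: c u_def of_int_poly_hom.hom_sum poly_sum map_poly_monom poly_monom)
  have degh1: "degree f = Suc (degree h1)"
    using degree_pos by (subst h1, subst (asm) h1) (auto simp: degree_pCons_eq_if split: if_splits)
  have "ipoly h1 \<beta> = ipoly (Polynomial.smult (int p) u) \<beta>"
    using p0 by (simp add: ipoly_simps u[symmetric] \<theta>_def)
  hence dvd: "f dvd h1 - Polynomial.smult (int p) u" by (simp only: ipoly_eq_iff)
  have "degree u < degree f"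
    using degree_pos by (intro degree_lessI) (auto simp: u_def coeff_sum)
  hence "degree (h1 - Polynomial.smult (int p) u) < degree f"
    using degh1 by (intro degree_diff_less) auto
  hence "h1 - Polynomial.smult (int p) u = 0" using dvd by (auto dest: dvd_imp_degree_le)
  hence "coeff h1 (degree h1) = int p * coeff u (degree h1)" by (metis coeff_smult eq_iff_diff_eq_0)
  moreover have "coeff h1 (degree h1) = 1"
    using monic degh1 h1 by (metis coeff_pCons_Suc)
  ultimately have "int p dvd 1" by (metis dvd_triv_left)
  thus False using p by auto
qed

lemma mem_if_coprime_multiples:
  assumes K: "ideal K (\<O> :: 'a ring)" and "coprime m n"
    and "of_int m * x \<in> K" "of_int n * x \<in> K"
  shows "x \<in> K"
proof -
  obtain u v where uv: "u * m + v * n = 1" using bezout_int[of m n] assms(2) by auto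
  have "of_int u * (of_int m * x) + of_int v * (of_int n * x) \<in> K"
    by (intro ideal_OK_D(3,4)[OF K] OK_of_int assms)
  moreover have "of_int u * (of_int m * x) + of_int v * (of_int n * x) = of_int (u * m + v * n) * x"
    by (simp add: algebra_simps)
  ultimately show ?thesis by (simp add: uv)
qed

text \<open>Let \<open>J\<close> be the set of multipliers from \<open>P = (p, \<beta>)\<close> into \<open>(\<beta>)\<close>, and write \<open>coeff f 0 = p * c\<close>. Then \<open>J\<close>
contains \<open>\<beta>\<close> and \<open>c\<close>, and the relation \<open>f(\<beta>) = 0\<close> shows that \<open>P J\<close> contains \<open>\<beta>\<close> times each of \<open>p\<close>, \<open>c\<close>
and \<open>coeff f 1\<close>. These three integers have no common prime factor by \<open>square_not_dvd_coeff_0\<close>.\<close>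

lemma residue_ideal_divides_generator:
  assumes p: "prime p" and f0: "int p dvd coeff f 0"
  shows "ideal_divides_elem (residue_ideal p) \<beta>"
proof -
  let ?P = "residue_ideal p"
  have P: "ideal ?P (\<O> :: 'a ring)" by (rule ideal_residue_ideal)
  have \<beta>OK: "\<beta> \<in> OK" using generator_mem_residue_ideal ideal_OK_D(1)[OF P] by blast
  define B where "B = (PIdl\<^bsub>\<O>\<^esub> \<beta> :: 'a set)"
  have B: "ideal B (\<O> :: 'a ring)" unfolding B_def by (rule ideal_principal[OF \<beta>OK])
  note BD = ideal_OK_D[OF B]
  have memB: "\<beta> * r \<in> B" if "r \<in> OK" for r unfolding B_def principal_ideal using that by blast
  define J where "J = {x \<in> OK. \<forall>y\<in>?P. x * y \<in> B}"
  have J: "ideal J (\<O> :: 'a ring)"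
  proof (rule ideal_OK_I)
    show "J \<subseteq> OK" "0 \<in> J" using BD(2) by (auto simp: J_def)
    show "x + y \<in> J" if "x \<in> J" "y \<in> J" for x y
      using that BD(3) OK_closed(1)[of x y] by (auto simp: J_def distrib_right)
    show "r * x \<in> J" if "r \<in> OK" "x \<in> J" for r x
      using that BD(4) OK_closed(3)[of r x] by (auto simp: J_def mult.assoc)
  qed
  obtain c where c: "coeff f 0 = int p * c" using f0 by (elim dvdE)
  obtain g where g: "of_int (coeff f 0) + of_int (coeff f 1) * \<beta> + \<beta> * (\<beta> * ipoly g \<beta>) = 0"
    by (rule constant_coeff_split)
  have gOK: "ipoly g \<beta> \<in> OK" using algebraic_int_ipoly by simp
  have f0B: "of_int (coeff f 0) \<in> B"
  proof -
    have "of_int (coeff f 0) = \<beta> * (- of_int (coeff f 1) - \<beta> * ipoly g \<beta>)"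
      using g by (simp add: algebra_simps eq_neg_iff_add_eq_0)
    moreover have "- of_int (coeff f 1) - \<beta> * ipoly g \<beta> \<in> OK"
      using OK_closed(2)[OF OK_of_int[of "- coeff f 1"] OK_closed(3)[OF \<beta>OK gOK]] by simp
    ultimately show ?thesis using memB by simp
  qed
  have cJ: "of_int c \<in> J"
    unfolding J_def
  proof (intro CollectI conjI ballI)
    fix y assume "y \<in> ?P"
    then obtain h where h: "y = ipoly h \<beta>" "int p dvd coeff h 0" by (auto simp: residue_ideal_def)
    obtain a h' where ah: "h = pCons a h'" by (cases h)
    obtain m where m: "a = int p * m" using h(2) by (auto simp: ah elim: dvdE)
    have "of_int m * of_int (coeff f 0) + of_int c * (\<beta> * ipoly h' \<beta>) \<in> B"
      using algebraic_int_ipoly by (intro BD(3) BD(4) OK_of_int f0B memB) simp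
    also have "of_int m * of_int (coeff f 0) + of_int c * (\<beta> * ipoly h' \<beta>) = of_int c * y"
      by (simp add: h(1) ah m c ipoly_simps algebra_simps)
    finally show "of_int c * y \<in> B" .
  qed (use OK_of_int[of c] in simp)
  have \<beta>J: "\<beta> \<in> J" using \<beta>OK memB ideal_OK_D(1)[OF P] by (auto simp: J_def)
  have pP: "of_nat p \<in> ?P" and \<beta>P: "\<beta> \<in> ?P"
    by (simp_all add: of_nat_mem_residue_ideal[OF f0] generator_mem_residue_ideal)
  have PJ: "ideal (?P \<star> J) (\<O> :: 'a ring)" by (rule prod_ideal_ideal[OF P J])
  have p\<beta>: "of_int (int p) * \<beta> \<in> ?P \<star> J" using prod_ideal_mem[OF pP \<beta>J] by simp
  have c\<beta>: "of_int c * \<beta> \<in> ?P \<star> J" using prod_ideal_mem[OF \<beta>P cJ] by (simp add: mult.commute)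
  have f1\<beta>: "of_int (coeff f 1) * \<beta> \<in> ?P \<star> J"
  proof -
    have "- of_int (int p * c) - ipoly g \<beta> * (\<beta> * \<beta>) \<in> ?P \<star> J"
      using ideal_OK_D(5)[OF PJ ideal_OK_D(4)[OF PJ OK_of_int[of "-1"] prod_ideal_mem[OF pP cJ]]
          ideal_OK_D(4)[OF PJ gOK prod_ideal_mem[OF \<beta>P \<beta>J]]] by simp
    also have "- of_int (int p * c) - ipoly g \<beta> * (\<beta> * \<beta>) = of_int (coeff f 1) * \<beta>
        - (of_int (coeff f 0) + of_int (coeff f 1) * \<beta> + \<beta> * (\<beta> * ipoly g \<beta>))"
      unfolding c by (simp add: algebra_simps)
    also have "\<dots> = of_int (coeff f 1) * \<beta>" unfolding g by simp
    finally show ?thesis .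
  qed
  have "\<beta> \<in> ?P \<star> J"
  proof (cases "int p dvd c")
    case False
    hence "coprime (int p) c" using p by (intro prime_imp_coprime) auto
    thus ?thesis using mem_if_coprime_multiples[OF PJ _ p\<beta> c\<beta>] by blast
  next
    case True
    hence "int p ^ 2 dvd coeff f 0" unfolding c power2_eq_square by (intro mult_dvd_mono) auto
    hence "\<not> int p dvd coeff f 1" using square_not_dvd_coeff_0[OF p] by blast
    hence "coprime (int p) (coeff f 1)" using p by (intro prime_imp_coprime) auto
    thus ?thesis using mem_if_coprime_multiples[OF PJ _ p\<beta> f1\<beta>] by blast
  qed
  hence "B \<subseteq> ?P \<star> J"
    using ideal_OK_D(4)[OF PJ] unfolding B_def principal_ideal by (auto simp: mult.commute)
  moreover have "?P \<star> J \<subseteq> B"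
    by (rule prod_ideal_least[OF B]) (auto simp: J_def mult.commute)
  ultimately have "B = ?P \<star> J" by blast
  thus ?thesis
    unfolding ideal_divides_elem_def factor_def B_def using J by auto
qed

lemma prime_ideal_factorization_exists:
  assumes p: "p > 0"
  obtains e where "is_prime_ideal_factorization (PIdl\<^bsub>\<O>\<^esub> (of_nat p) :: 'a set) e"
proof -
  define pO where "pO = (PIdl\<^bsub>\<O>\<^esub> (of_nat p) :: 'a set)"
  have pO: "ideal pO (\<O> :: 'a ring)" unfolding pO_def by (rule ideal_principal[OF OK_of_nat])
  have "of_nat p \<in> pO" unfolding pO_def principal_ideal by (rule image_eqI[of _ _ 1]) auto
  then obtain Ms where Ms: "primes_over p Ms" "pO = prods Ms"
    using ideal_factorization_exists[OF p pO] by blast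
  have "prods Ms = finprod (ideals_set \<O>) (\<lambda>P. P [^]\<^bsub>ideals_set \<O>\<^esub> count_list Ms P) (set Ms)"
    using G.foldr_mult_eq_finprod[of Ms] Ms(1) prime_over_D(1) by auto
  moreover have "{P. count_list Ms P \<noteq> 0} = set Ms" by (auto simp: count_list_0_iff)
  ultimately have "is_prime_ideal_factorization pO (count_list Ms)"
    using Ms p by (auto simp: is_prime_ideal_factorization_def prime_over_def count_list_0_iff)
  thus ?thesis using that by (simp add: pO_def)
qed

lemma ideal_valuation_ge_iff:
  assumes p: "p > 0" and M: "prime_over p M"
  shows "n \<le> ideal_valuation M (PIdl\<^bsub>\<O>\<^esub> (of_nat p)) \<longleftrightarrow> PIdl\<^bsub>\<O>\<^esub> (of_nat p) \<subseteq> M [^]\<^bsub>ideals_set \<O>\<^esub> n"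
proof -
  let ?pO = "PIdl\<^bsub>\<O>\<^esub> (of_nat p) :: 'a set"
  obtain e where e: "is_prime_ideal_factorization ?pO e"
    by (rule prime_ideal_factorization_exists[OF p])
  have "e' = e" if e': "is_prime_ideal_factorization ?pO e'" for e'
  proof
    fix P
    show "e' P = e P"
    proof (cases "prime_over p P")
      case True
      have "n \<le> e' P \<longleftrightarrow> n \<le> e P" for n
        using prime_ideal_factorization_exponent[OF p e' True] prime_ideal_factorization_exponent[OF p e True] by blast
      thus ?thesis by (meson order_antisym order_refl)
    next
      case False
      thus ?thesis using prime_over_if_exponent_nonzero[OF p e'] prime_over_if_exponent_nonzero[OF p e] by (metis)
    qed
  qed
  hence "(THE e. is_prime_ideal_factorization ?pO e) = e" using e by (intro the_equality)
  thus ?thesis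
    using prime_ideal_factorization_exponent[OF p e M] by (simp add: ideal_valuation_def)
qed

text \<open>If \<open>p\<close> divides the linear coefficient of \<open>f\<close>, then \<open>f(\<beta>) = 0\<close> puts the constant coefficient into the
square of \<open>P = (p, \<beta>)\<close>. As \<open>p\<close> divides the constant coefficient only once, \<open>p\<close> itself lies in this square.\<close>

lemma residue_ideal_ramified:
  assumes p: "prime p" and f0: "int p dvd coeff f 0" and f1: "int p dvd coeff f 1"
  shows "ramified (residue_ideal p)"
proof -
  let ?P = "residue_ideal p"
  have p0: "p > 0" using p by (simp add: prime_gt_0_nat)
  have over: "prime_over p ?P" by (rule prime_over_residue_ideal[OF p f0])
  note PD = prime_over_D[OF over]
  have PP: "ideal (?P \<star> ?P) (\<O> :: 'a ring)" by (rule prod_ideal_ideal[OF PD(1) PD(1)])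
  have \<beta>P: "\<beta> \<in> ?P" by (rule generator_mem_residue_ideal)
  obtain c where c: "coeff f 0 = int p * c" using f0 by (elim dvdE)
  obtain s where s: "coeff f 1 = int p * s" using f1 by (elim dvdE)
  obtain g where g: "of_int (coeff f 0) + of_int (coeff f 1) * \<beta> + \<beta> * (\<beta> * ipoly g \<beta>) = 0"
    by (rule constant_coeff_split)
  have gOK: "- ipoly g \<beta> \<in> OK" using algebraic_int_ipoly[of g] by simp
  have "of_int (- s) * (of_nat p * \<beta>) + (- ipoly g \<beta>) * (\<beta> * \<beta>) \<in> ?P \<star> ?P"
    by (intro ideal_OK_D(3,4)[OF PP] OK_of_int gOK prod_ideal_mem PD(2) \<beta>P)
  also have "of_int (- s) * (of_nat p * \<beta>) + (- ipoly g \<beta>) * (\<beta> * \<beta>) = of_int c * of_nat p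
      - (of_int (coeff f 0) + of_int (coeff f 1) * \<beta> + \<beta> * (\<beta> * ipoly g \<beta>))"
    unfolding c s by (simp add: algebra_simps)
  also have "\<dots> = of_int c * of_nat p" unfolding g by simp
  finally have cp: "of_int c * of_nat p \<in> ?P \<star> ?P" .
  have pp: "of_int (int p) * of_nat p \<in> ?P \<star> ?P" using prod_ideal_mem[OF PD(2,2)] by simp
  have "\<not> int p dvd c"
  proof
    assume "int p dvd c"
    hence "int p ^ 2 dvd coeff f 0" unfolding c power2_eq_square by (intro mult_dvd_mono) auto
    thus False using square_not_dvd_coeff_0[OF p f1] by blast
  qed
  hence "coprime (int p) c" using p by (intro prime_imp_coprime) auto
  hence "of_nat p \<in> ?P \<star> ?P" using mem_if_coprime_multiples[OF PP _ pp cp] by blast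
  hence "PIdl\<^bsub>\<O>\<^esub> (of_nat p) \<subseteq> ?P \<star> ?P"
    using ideal_OK_D(4)[OF PP] unfolding principal_ideal by (auto simp: mult.commute)
  also have "?P \<star> ?P = ?P [^]\<^bsub>ideals_set \<O>\<^esub> (2::nat)"
    using prod_OK[OF PD(1)] by (simp add: numeral_2_eq_2)
  finally have "2 \<le> ideal_valuation ?P (PIdl\<^bsub>\<O>\<^esub> (of_nat p))"
    by (simp add: ideal_valuation_ge_iff[OF p0 over])
  moreover have "(THE r. prime r \<and> of_nat r \<in> ?P) = p"
    using p of_nat_mem_residue_ideal[OF f0] by (intro the_equality) (auto dest: primes_dvd_imp_eq)
  moreover have "?P \<noteq> {0}" using PD(2) p0 by auto
  ultimately show ?thesis using over by (simp add: ramified_def prime_over_def)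
qed

end

section \<open>The uniform bound\<close>

lemma digits_eq_lessThan:
  assumes "\<bar>field_norm \<beta>\<bar> > 1"
  shows "digits \<beta> = {..<nat \<lfloor>\<bar>field_norm \<beta>\<bar>\<rfloor>}"
proof -
  have "of_nat a \<le> \<bar>field_norm \<beta>\<bar> - 1 \<longleftrightarrow> a < nat \<lfloor>\<bar>field_norm \<beta>\<bar>\<rfloor>" for a
  proof -
    have "of_nat a \<le> \<bar>field_norm \<beta>\<bar> - 1 \<longleftrightarrow> of_int (int a + 1) \<le> \<bar>field_norm \<beta>\<bar>" by (simp add: algebra_simps)
    also have "\<dots> \<longleftrightarrow> int a + 1 \<le> \<lfloor>\<bar>field_norm \<beta>\<bar>\<rfloor>" by (simp only: le_floor_iff)
    also have "\<dots> \<longleftrightarrow> a < nat \<lfloor>\<bar>field_norm \<beta>\<bar>\<rfloor>" by linarith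
    finally show ?thesis .
  qed
  thus ?thesis by (auto simp: digits_def)
qed

text \<open>The number of digits is the integer part of the absolute norm. By this monotonicity the exponent
formed with the number of digits is at most the exponent formed with the norm.\<close>

lemma ln_ratio_mono:
  fixes x y :: real
  assumes "2 \<le> x" "x \<le> y"
  shows "ln (x - 1) / ln x \<le> ln (y - 1) / ln y"
proof -
  have ratio: "ln (z - 1) / ln z = 1 - ln (z / (z - 1)) / ln z" if "z \<ge> 2" for z :: real
    using that by (simp add: ln_div field_simps)
  have "y / (y - 1) \<le> x / (x - 1)" using assms by (simp add: field_simps)
  hence "ln (y / (y - 1)) \<le> ln (x / (x - 1))" using assms by (subst ln_le_cancel_iff) auto
  moreover have "ln (x / (x - 1)) \<ge> 0" using assms by (intro ln_ge_zero) (simp add: field_simps)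
  ultimately have "ln (y / (y - 1)) / ln y \<le> ln (x / (x - 1)) / ln x"
    using assms by (intro frac_le) auto
  thus ?thesis using assms by (simp add: ratio)
qed

theorem theorem1p5:
  fixes \<beta> :: "'k::field_char_0"
  assumes "number_field TYPE('k)"
    and "\<beta> \<in> carrier \<O>"
    and "\<bar>field_norm \<beta>\<bar> > 1"
    and "canonical_number_system \<beta>"
    and "\<not> (\<exists>P. ramified P \<and> ideal_divides_elem P \<beta>)"
  shows "\<exists>C\<^sub>1::real. \<forall>\<alpha> \<in> carrier \<O>. \<forall>b \<in> digits \<beta>. \<forall>N::nat.
    relatively_prime \<alpha> \<beta> \<and> \<not> (\<exists>k>0. \<alpha> ^ k = 1) \<and> b \<ge> 1 \<and> N \<ge> 1
    \<longrightarrow> real (missing_digit_count b \<alpha> \<beta> N) \<le> C\<^sub>1 * real N powr sigma \<beta>"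
proof -
  have "algebraic_int \<beta>" using assms(2) by (simp add: ring_of_integers_def)
  then obtain f :: "int poly" where f: "lead_coeff f = 1" "\<And>h. ipoly h \<beta> = 0 \<longleftrightarrow> f dvd h"
    by (rule minimal_int_poly) blast
  define q where "q = nat \<lfloor>\<bar>field_norm \<beta>\<bar>\<rfloor>"
  interpret C: cns_generator \<beta> f q
    by unfold_locales (use f assms(3,4) in \<open>simp_all add: digits_eq_lessThan q_def\<close>)
  interpret M: monogenic_integers \<beta> f
    by unfold_locales (rule C.algebraic_int_iff)
  have dvd_f0: "int p dvd coeff f 0" if "int p dvd int q" for p
    using that by (simp add: C.q_eq)
  have prime_divisor: "\<exists>p. prime p \<and> int p dvd m \<and> int p dvd int q" if "\<not> coprime m (int q)" for m
  proof -
    define c where "c = nat (gcd m (int q))"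
    have c: "int c = gcd m (int q)" by (simp add: c_def)
    have "c \<noteq> 1" using that c by (auto simp: coprime_iff_gcd_eq_1)
    then obtain p where "prime p" "p dvd c" using prime_factor_nat by blast
    moreover from this have "int p dvd gcd m (int q)" by (simp flip: c)
    ultimately show ?thesis by auto
  qed
  have c1: "coprime (coeff f 1) (int q)"
  proof (rule ccontr)
    assume "\<not> coprime (coeff f 1) (int q)"
    then obtain p where p: "prime p" "int p dvd coeff f 1" "int p dvd int q" using prime_divisor by blast
    show False
      using assms(5) M.residue_ideal_ramified[OF p(1) dvd_f0[OF p(3)] p(2)]
        M.residue_ideal_divides_generator[OF p(1) dvd_f0[OF p(3)]] by blast
  qed
  obtain K where K: "C.congruent_expansions_bound (int q) K"
    using C.congruent_expansions_bound_exists by blast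
  have q_le: "real q \<le> real_of_rat \<bar>field_norm \<beta>\<bar>"
  proof -
    have "of_nat q \<le> \<bar>field_norm \<beta>\<bar>" using assms(3) unfolding q_def by simp
    hence "real_of_rat (of_nat q) \<le> real_of_rat \<bar>field_norm \<beta>\<bar>" by (simp only: of_rat_less_eq)
    thus ?thesis by simp
  qed
  have sigma: "ln (real q - 1) / ln (real q) \<le> sigma \<beta>"
    unfolding sigma_def using C.q_ge_2 q_le by (intro ln_ratio_mono) auto
  define C1 where "C1 = real (totient (q ^ 2)) * real K * real (q - 1) ^ 2"
  show ?thesis
  proof (intro exI[of _ C1] ballI allI impI, elim conjE)
    fix \<alpha> b N
    assume \<alpha>: "\<alpha> \<in> carrier \<O>" and b: "b \<in> digits \<beta>" "b \<ge> 1" and rp: "relatively_prime \<alpha> \<beta>"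
      and nru: "\<not> (\<exists>k>0. \<alpha> ^ k = 1)" and N: "N \<ge> (1::nat)"
    obtain h where h: "\<alpha> = ipoly h \<beta>" using \<alpha> C.algebraic_int_iff by (auto simp: ring_of_integers_def)
    have hq: "coprime (coeff h 0) (int q)"
    proof (rule ccontr)
      assume "\<not> coprime (coeff h 0) (int q)"
      then obtain p where p: "prime p" "int p dvd coeff h 0" "int p dvd int q" using prime_divisor by blast
      have "primeideal (M.residue_ideal p) \<O>"
        using M.prime_over_residue_ideal[OF p(1) dvd_f0[OF p(3)]] by (simp add: M.prime_over_def)
      moreover have "\<alpha> \<in> M.residue_ideal p"
        using p(2) M.ipoly_mem_residue_ideal[OF dvd_f0[OF p(3)]] by (simp add: h)
      ultimately show False
        using rp M.residue_ideal_divides_generator[OF p(1) dvd_f0[OF p(3)]] by (auto simp: relatively_prime_def)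
    qed
    have bq: "b < q" using b(1) by (simp add: C.digits_eq)
    obtain t where t: "q ^ t \<le> q ^ 2 * N"
      "card (C.survivors b \<alpha> N) \<le> totient (q ^ 2) * (q - 1) ^ t * K"
      by (rule C.card_survivors_le[OF c1 K h hq _ b(2) bq N]) (use nru in blast)+
    have "real (missing_digit_count b \<alpha> \<beta> N) = real (card (C.survivors b \<alpha> N))"
      by (simp add: missing_digit_count_def C.survivors_def)
    also have "\<dots> \<le> real (totient (q ^ 2) * (q - 1) ^ t * K)" using t(2) by (rule of_nat_mono)
    also have "\<dots> = real (totient (q ^ 2)) * real K * real ((q - 1) ^ t)" by simp
    also have "\<dots> \<le> real (totient (q ^ 2)) * real K * (real (q - 1) ^ 2 * real N powr (ln (real q - 1) / ln (real q)))"
      by (intro mult_left_mono C.power_le_powr_sigma[OF t(1) N]) auto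
    also have "\<dots> \<le> real (totient (q ^ 2)) * real K * (real (q - 1) ^ 2 * real N powr sigma \<beta>)"
      using N sigma by (intro mult_left_mono powr_mono) auto
    finally show "real (missing_digit_count b \<alpha> \<beta> N) \<le> C1 * real N powr sigma \<beta>"
      by (simp add: C1_def mult.assoc)
  qed
qed

end
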